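(* Let $\Omega\subset\mathbb R^n$ be a bounded $C^2$ domain and let $\mathscr A,\mathscr B$ be arbitrary first order homogeneous constant coefficient operators as in the context (no ellipticity is assumed). Then $$\int_\Omega\Big(|\mathscr A u(x)|^2+|\mathscr B u(x)|^2-\langle Du(x),\mathbb M Du(x)\rangle\Big)\,dx=\int_{\partial\Omega}\langle u(x),L_B(x)u(x)\rangle\,d\sigma(x)$$ for all $u\in C^1(\overline\Omega,F)$ satisfying the boundary condition $\mathbb B(\nu(x))u(x)=0$ for all $x\in\partial\Omega$.
   Context: Let $E,F,G$ be finite-dimensional real or complex inner product spaces; in the complex case $\langle\cdot,\cdot\rangle$ denotes the real part of the complex inner product. For linear maps $X,Y$ between inner product spaces, $\langle X,Y\rangle:=\mathrm{Re}\,\mathrm{tr}(X^*Y)$. Let $e_1,\dots,e_n$ be the standard basis of $\mathbb R^n$. Let $A_1,\dots,A_n\in\mathcal L(F,G)$, $B_1,\dots,B_n\in\mathcal L(F,E)$, $\mathscr A=\sum_jA_j\partial_j$, $\mathscr B=\sum_jB_j\partial_j$ acting on $F$-valued functions, with symbols $\mathbb A(\xi)=\sum_j\xi_jA_j$, $\mathbb B(\xi)=\sum_j\xi_jB_j$ for $\xi\in\mathbb R^n$. Define $M_{ij}:=A_i^*A_j+B_j^*B_i\in\mathcal L(F)$ and $\mathbb M:\mathcal L(\mathbb R^n,F)\to\mathcal L(\mathbb R^n,F)$ by $(\mathbb M X)(e_i)=\sum_j M_{ij}X(e_j)$. $Du(x)\in\mathcal L(\mathbb R^n,F)$ is the Jacobian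 of $u$. For a bounded $C^2$ domain $\Omega$, $\nu$ denotes the outward unit normal, $\sigma$ the surface measure on $\partial\Omega$, $N$ is any $C^1$ extension of $\nu$ to a neighbourhood of $\partial\Omega$, and the generalized Levi matrix is $L_B(x):=\sum_{j=1}^n\mathbb B(e_j)^*\,\mathbb B(\partial_jN(x))\in\mathcal L(F)$. *)

theory Defs
  imports "HOL-Analysis.Analysis"
begin

text \<open>Normalising constant omega_s = pi^(s/2) / Gamma(s/2+1), so that H^(n-1) is
  the usual surface measure on C^1 hypersurfaces.\<close>
definition hausdorff_const :: "real \<Rightarrow> real" where
  "hausdorff_const s = pi powr (s / 2) / Gamma (s / 2 + 1)"

definition diam_pow :: "real \<Rightarrow> real \<Rightarrow> real" where
  "diam_pow d s = (if d = 0 then (if s = 0 then 1 else 0) else d powr s)"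

definition hausdorff_pre :: "real \<Rightarrow> real \<Rightarrow> 'a::euclidean_space set \<Rightarrow> ennreal" where
  "hausdorff_pre s \<delta> A =
     (INF C \<in> {C :: nat \<Rightarrow> 'a set. A \<subseteq> (\<Union>i. C i) \<and> (\<forall>i. bounded (C i) \<and> diameter (C i) \<le> \<delta>)}.
        (\<Sum>i. ennreal (if C i = {} then 0
                        else hausdorff_const s * diam_pow (diameter (C i) / 2) s)))"

definition hausdorff_outer :: "real \<Rightarrow> 'a::euclidean_space set \<Rightarrow> ennreal" where
  "hausdorff_outer s A = (SUP \<delta> \<in> {0<..}. hausdorff_pre s \<delta> A)"

definition hausdorff_measure :: "real \<Rightarrow> 'a::euclidean_space measure" where
  "hausdorff_measure s = measure_of UNIV (sets borel) (hausdorff_outer s)"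

definition surface_measure :: "(real^'n) set \<Rightarrow> (real^'n) measure" where
  "surface_measure S = restrict_space (hausdorff_measure (real CARD('n) - 1)) S"

definition C2_on :: "(real^'n) set \<Rightarrow> (real^'n \<Rightarrow> real) \<Rightarrow> bool" where
  "C2_on U \<rho> \<longleftrightarrow> (\<exists>D1 D2. (\<forall>x\<in>U. (\<rho> has_derivative blinfun_apply (D1 x)) (at x)
                                \<and> (D1 has_derivative blinfun_apply (D2 x)) (at x))
                       \<and> continuous_on U D2)"

definition local_defining_function :: "(real^'n) set \<Rightarrow> real^'n \<Rightarrow> real \<Rightarrow> (real^'n \<Rightarrow> real) \<Rightarrow> bool" where
  "local_defining_function \<Omega> p r \<rho> \<longleftrightarrow>
     r > 0 \<and> C2_on (ball p r) \<rho> \<and>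
     (\<forall>y\<in>ball p r. frechet_derivative \<rho> (at y) \<noteq> (\<lambda>h. 0)) \<and>
     \<Omega> \<inter> ball p r = {y \<in> ball p r. \<rho> y < 0}"

definition C2_domain :: "(real^'n) set \<Rightarrow> bool" where
  "C2_domain \<Omega> \<longleftrightarrow> open \<Omega> \<and> connected \<Omega> \<and> \<Omega> \<noteq> {} \<and>
     (\<forall>p\<in>frontier \<Omega>. \<exists>r \<rho>. local_defining_function \<Omega> p r \<rho>)"

definition outward_unit_normal :: "(real^'n) set \<Rightarrow> real^'n \<Rightarrow> real^'n \<Rightarrow> bool" where
  "outward_unit_normal \<Omega> x \<nu> \<longleftrightarrow>
     (\<exists>r \<rho> g. local_defining_function \<Omega> x r \<rho> \<and>
        (\<rho> has_derivative (\<lambda>h. g \<bullet> h)) (at x) \<and> \<nu> = g /\<^sub>R norm g)"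

definition op_trace :: "('a::euclidean_space \<Rightarrow> 'a) \<Rightarrow> real" where
  "op_trace T = (\<Sum>b\<in>Basis. b \<bullet> T b)"

definition hs_inner :: "(real^'n \<Rightarrow> 'f::euclidean_space) \<Rightarrow> (real^'n \<Rightarrow> 'f) \<Rightarrow> real" where
  "hs_inner X Y = op_trace (adjoint X \<circ> Y)"

definition sym_op :: "('n::finite \<Rightarrow> 'f \<Rightarrow> 'g::real_vector) \<Rightarrow> real^'n \<Rightarrow> 'f \<Rightarrow> 'g" where
  "sym_op A \<xi> = (\<lambda>w. \<Sum>j\<in>UNIV. (\<xi> $ j) *\<^sub>R A j w)"

definition Mcoef :: "('n::finite \<Rightarrow> 'f::real_inner \<Rightarrow> 'g::real_inner) \<Rightarrow> ('n \<Rightarrow> 'f \<Rightarrow> 'e::real_inner)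
                     \<Rightarrow> 'n \<Rightarrow> 'n \<Rightarrow> 'f \<Rightarrow> 'f" where
  "Mcoef A B i j = (\<lambda>w. adjoint (A i) (A j w) + adjoint (B j) (B i w))"

definition Mop :: "('n::finite \<Rightarrow> 'f::real_inner \<Rightarrow> 'g::real_inner) \<Rightarrow> ('n \<Rightarrow> 'f \<Rightarrow> 'e::real_inner)
                   \<Rightarrow> (real^'n \<Rightarrow> 'f) \<Rightarrow> (real^'n \<Rightarrow> 'f)" where
  "Mop A B X = (\<lambda>v. \<Sum>i\<in>UNIV. (v $ i) *\<^sub>R (\<Sum>j\<in>UNIV. Mcoef A B i j (X (axis j 1))))"

text \<open>First order operator applied to u at x, given the Jacobian Du x: sum_j A_j (d_j u(x)).\<close>
definition diff_op :: "('n::finite \<Rightarrow> 'f \<Rightarrow> 'g::real_vector) \<Rightarrow> (real^'n \<Rightarrow> 'f) \<Rightarrow> 'g" where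
  "diff_op A X = (\<Sum>j\<in>UNIV. A j (X (axis j 1)))"

text \<open>Generalised Levi matrix L_B(x) = sum_j B(e_j)^* B(d_j N(x)), given DN = DN(x).\<close>
definition levi_op :: "('n::finite \<Rightarrow> 'f::real_inner \<Rightarrow> 'e::real_inner) \<Rightarrow> (real^'n \<Rightarrow> real^'n) \<Rightarrow> 'f \<Rightarrow> 'f" where
  "levi_op B DN = (\<lambda>w. \<Sum>j\<in>UNIV. adjoint (sym_op B (axis j 1)) (sym_op B (DN (axis j 1)) w))"

end

theory Submission
  imports Defs
begin

text \<open>The integrand is the null Lagrangian
  \<open>\<Sum>\<^sub>i\<^sub>j \<langle>B\<^sub>i \<partial>\<^sub>iu, B\<^sub>j \<partial>\<^sub>ju\<rangle> - \<langle>B\<^sub>i \<partial>\<^sub>ju, B\<^sub>j \<partial>\<^sub>iu\<rangle>\<close>, so that its integral is the boundary integral of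
  \<open>\<Sum>\<^sub>i\<^sub>j \<langle>B\<^sub>i u, \<nu>\<^sub>i B\<^sub>j \<partial>\<^sub>ju - \<nu>\<^sub>j B\<^sub>j \<partial>\<^sub>iu\<rangle>\<close>. The first summand vanishes by the boundary condition. For the second
  one, \<open>z = \<B>(N)u\<close> vanishes on the boundary while \<open>\<Sum>\<^sub>i B\<^sub>iu \<otimes> e\<^sub>i\<close> is tangential, hence
  \<open>0 = \<Sum>\<^sub>i \<langle>B\<^sub>iu, \<partial>\<^sub>iz\<rangle> = \<Sum>\<^sub>i \<langle>B\<^sub>iu, \<B>(\<nu>)\<partial>\<^sub>iu\<rangle> + \<langle>u, L\<^sub>B u\<rangle>\<close> after integration.

  The divergence theorem is proved without changes of variables. For a unit vector \<open>v\<close> transversal to the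
  boundary near \<open>p\<close>, integration along the lines in direction \<open>v\<close> shows that the flux \<open>I(v) = \<integral>\<^sub>\<Omega> \<partial>\<^sub>vf\<close> of a
  nonnegative \<open>f\<close> supported near \<open>p\<close> is the integral of \<open>f\<close> over the projection of the boundary along \<open>v\<close>.
  Projections are contractions, and the isodiametric inequality identifies Hausdorff measure with
  Lebesgue measure on hyperplanes, so \<open>I(v) \<le> J = \<integral> f d\<sigma>\<close>, with almost equality for \<open>v = \<nu>(p)\<close>. A linear functional
  with these two properties is close to \<open>v \<mapsto> J \<langle>\<nu>(p), v\<rangle>\<close>, and a partition of unity of small mesh concludes.

  Since \<open>u\<close> has no second derivatives, the null Lagrangian identity is obtained by averaging difference
  quotients of \<open>u\<close> over small parallelograms that are translated into \<open>\<Omega>\<close>.\<close>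

section \<open>Hausdorff outer measure\<close>

text \<open>The flux I(v) is linear in v, and this linearity replaces the Jacobian factor of a
  graph. Testing with v proportional to \<nu> + s z, and using |\<nu> + s z| \<le> 1 + s<\<nu>,z> +
  s^2/2 together with I(\<nu>) \<ge> (1 - \<eta>) J, gives I(z) - <\<nu>,z> J \<le> (\<eta>/s + s/2)
  J. The tilt s is fixed before the opening of the cone. One inequality is enough, because z may be
  replaced by -z.

  In the second half the obstacle is that u and z = B(N)u are merely C1, so nothing is
  differentiated along the surface. Instead the bulk integral of d1 f . d2 h - d2 f . d1 h, for two
  C1 functions, is turned into a boundary integral in both orders: if h is zero on the boundary,
  then the boundary integral containing the tangential derivatives of h is zero as well. This is
  applied to h = z and f = N_j B_i u.

  The charts live over a space of dimension n - 1 and are used for n - 1 \<ge> 1; for n = 1 both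
  sides of the theorem are zero.\<close>

definition hausdorff_cost :: "real \<Rightarrow> 'a::euclidean_space set \<Rightarrow> ennreal" where
  "hausdorff_cost s C =
     ennreal (if C = {} then 0 else hausdorff_const s * diam_pow (diameter C / 2) s)"

definition fine_cover :: "real \<Rightarrow> 'a::euclidean_space set \<Rightarrow> (nat \<Rightarrow> 'a set) \<Rightarrow> bool" where
  "fine_cover \<delta> A C \<longleftrightarrow> A \<subseteq> (\<Union>i. C i) \<and> (\<forall>i. bounded (C i) \<and> diameter (C i) \<le> \<delta>)"

lemma hausdorff_pre_eq: "hausdorff_pre s \<delta> A = (INF C\<in>Collect (fine_cover \<delta> A). \<Sum>i. hausdorff_cost s (C i))"
  unfolding hausdorff_pre_def fine_cover_def hausdorff_cost_def by simp

lemma hausdorff_pre_le: "fine_cover \<delta> A C \<Longrightarrow> hausdorff_pre s \<delta> A \<le> (\<Sum>i. hausdorff_cost s (C i))"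
  unfolding hausdorff_pre_eq by (intro INF_lower) auto

lemma le_hausdorff_pre:
  "(\<And>C. fine_cover \<delta> A C \<Longrightarrow> x \<le> (\<Sum>i. hausdorff_cost s (C i))) \<Longrightarrow> x \<le> hausdorff_pre s \<delta> A"
  unfolding hausdorff_pre_eq by (intro INF_greatest) auto

lemma hausdorff_cost_empty [simp]: "hausdorff_cost s {} = 0"
  by (simp add: hausdorff_cost_def)

lemma hausdorff_const_eq: "hausdorff_const s = unit_ball_vol s"
  by (simp add: hausdorff_const_def unit_ball_vol_def)

lemma diam_pow_eq: "s > 0 \<Longrightarrow> diam_pow d s = d powr s"
  by (simp add: diam_pow_def)

lemma hausdorff_cost_eq:
  "s > 0 \<Longrightarrow> hausdorff_cost s C = ennreal (unit_ball_vol s * (diameter C / 2) powr s)"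
  by (simp add: hausdorff_cost_def hausdorff_const_eq diam_pow_eq)

lemma fine_cover_empty: "\<delta> \<ge> 0 \<Longrightarrow> fine_cover \<delta> {} (\<lambda>_. {})"
  by (simp add: fine_cover_def)

lemma hausdorff_pre_empty: "\<delta> \<ge> 0 \<Longrightarrow> hausdorff_pre s \<delta> {} = 0"
  using hausdorff_pre_le[OF fine_cover_empty, of \<delta> s] by simp

lemma hausdorff_pre_mono: "A \<subseteq> B \<Longrightarrow> hausdorff_pre s \<delta> A \<le> hausdorff_pre s \<delta> B"
  by (intro le_hausdorff_pre hausdorff_pre_le) (auto simp: fine_cover_def)

lemma hausdorff_pre_antimono: "\<delta> \<le> \<delta>' \<Longrightarrow> hausdorff_pre s \<delta>' A \<le> hausdorff_pre s \<delta> A"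
  by (intro le_hausdorff_pre hausdorff_pre_le) (auto simp: fine_cover_def intro: order_trans)

lemma hausdorff_pre_Union:
  fixes A :: "nat \<Rightarrow> 'a::euclidean_space set"
  shows "hausdorff_pre s \<delta> (\<Union>k. A k) \<le> (\<Sum>k. hausdorff_pre s \<delta> (A k))"
proof (cases "(\<Sum>k. hausdorff_pre s \<delta> (A k)) = \<infinity>")
  case False
  show ?thesis
  proof (rule ennreal_le_epsilon)
    fix e :: real assume e: "e > 0"
    have "\<exists>C. fine_cover \<delta> (A k) C \<and> (\<Sum>i. hausdorff_cost s (C i)) \<le> hausdorff_pre s \<delta> (A k) + ennreal (e * (1/2) ^ Suc k)" for k
    proof -
      have "hausdorff_pre s \<delta> (A k) \<noteq> \<infinity>"
        using False ennreal_suminf_lessD[of "\<lambda>k. hausdorff_pre s \<delta> (A k)" \<infinity> k]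
        by (auto simp: less_top)
      then have "hausdorff_pre s \<delta> (A k) < hausdorff_pre s \<delta> (A k) + ennreal (e * (1/2) ^ Suc k)"
        using e by (simp add: ennreal_add_left_cancel_less[of _ 0, simplified] less_top)
      then show ?thesis unfolding hausdorff_pre_eq[of s \<delta> "A k"] INF_less_iff
        by (auto intro: less_imp_le)
    qed
    then obtain C where C: "\<And>k. fine_cover \<delta> (A k) (C k)"
      "\<And>k. (\<Sum>i. hausdorff_cost s (C k i)) \<le> hausdorff_pre s \<delta> (A k) + ennreal (e * (1/2) ^ Suc k)"
      by metis
    let ?D = "\<lambda>n. case prod_decode n of (k, i) \<Rightarrow> C k i"
    have "fine_cover \<delta> (\<Union>k. A k) ?D"
    proof -
      have "x \<in> (\<Union>n. ?D n)" if x: "x \<in> A k" for x k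
      proof -
        have "A k \<subseteq> (\<Union>i. C k i)" using C(1)[of k] by (simp add: fine_cover_def)
        then obtain i where "x \<in> C k i" using x by auto
        then have "x \<in> ?D (prod_encode (k, i))" by simp
        then show ?thesis by (rule UN_I[OF UNIV_I])
      qed
      then show ?thesis using C(1) by (auto simp: fine_cover_def split: prod.splits)
    qed
    then have "hausdorff_pre s \<delta> (\<Union>k. A k) \<le> (\<Sum>n. hausdorff_cost s (?D n))"
      by (rule hausdorff_pre_le)
    also have "\<dots> = (\<Sum>n. (\<lambda>(k,i). hausdorff_cost s (C k i)) (prod_decode n))"
      by (intro suminf_cong) (simp split: prod.splits)
    also have "\<dots> = (\<Sum>k. \<Sum>i. hausdorff_cost s (C k i))"
      by (rule suminf_ennreal_2dimen) simp
    also have "\<dots> \<le> (\<Sum>k. hausdorff_pre s \<delta> (A k) + ennreal (e * (1/2) ^ Suc k))"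
      by (intro suminf_le C(2)) auto
    also have "\<dots> = (\<Sum>k. hausdorff_pre s \<delta> (A k)) + (\<Sum>k. ennreal (e * (1/2) ^ Suc k))"
      by (intro suminf_add[symmetric]) auto
    also have "(\<Sum>k. ennreal (e * (1/2) ^ Suc k)) = ennreal e"
      using sums_mult[OF power_half_series, of e] e
      by (intro suminf_ennreal_eq) auto
    finally show "hausdorff_pre s \<delta> (\<Union>k. A k) \<le> (\<Sum>k. hausdorff_pre s \<delta> (A k)) + ennreal e" .
  qed
qed simp

lemma hausdorff_pre_le_outer: "\<delta> > 0 \<Longrightarrow> hausdorff_pre s \<delta> A \<le> hausdorff_outer s A"
  unfolding hausdorff_outer_def by (intro SUP_upper) auto

lemma hausdorff_outer_least:
  "(\<And>\<delta>. \<delta> > 0 \<Longrightarrow> hausdorff_pre s \<delta> A \<le> x) \<Longrightarrow> hausdorff_outer s A \<le> x"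
  unfolding hausdorff_outer_def by (intro SUP_least) auto

lemma hausdorff_outer_empty [simp]: "hausdorff_outer s {} = 0"
  using hausdorff_outer_least[of s "{}" 0] by (simp add: hausdorff_pre_empty)

lemma hausdorff_outer_mono: "A \<subseteq> B \<Longrightarrow> hausdorff_outer s A \<le> hausdorff_outer s B"
  by (meson hausdorff_outer_least hausdorff_pre_le_outer hausdorff_pre_mono order_trans)

lemma hausdorff_outer_Union:
  "hausdorff_outer s (\<Union>k. A k) \<le> (\<Sum>k. hausdorff_outer s (A (k::nat)))"
  by (intro hausdorff_outer_least order_trans[OF hausdorff_pre_Union] suminf_le
        hausdorff_pre_le_outer) auto

lemma hausdorff_outer_Un:
  "hausdorff_outer s (A \<union> B) \<le> hausdorff_outer s A + hausdorff_outer s B"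
proof -
  have "hausdorff_outer s (\<Union>k. binaryset A B k) \<le> (\<Sum>k. hausdorff_outer s (binaryset A B k))"
    by (rule hausdorff_outer_Union)
  also have "\<dots> = hausdorff_outer s A + hausdorff_outer s B"
    by (rule suminf_binaryset_eq) simp
  finally show ?thesis by (simp add: UN_binaryset_eq)
qed

text \<open>A cover by sets of diameter less than the distance of two sets splits into covers of each.\<close>
lemma hausdorff_outer_metric:
  fixes A B :: "'a::euclidean_space set"
  assumes \<eta>: "\<eta> > 0" and sep: "\<And>x y. x \<in> A \<Longrightarrow> y \<in> B \<Longrightarrow> \<eta> \<le> dist x y"
  shows "hausdorff_outer s A + hausdorff_outer s B \<le> hausdorff_outer s (A \<union> B)"
proof -
  have 1: "hausdorff_pre s \<delta> A + hausdorff_pre s \<delta> B \<le> hausdorff_pre s \<delta> (A \<union> B)" if d: "\<delta> < \<eta>" for \<delta>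
  proof (rule le_hausdorff_pre)
    fix C assume C: "fine_cover \<delta> (A \<union> B) C"
    define CA where "CA = (\<lambda>i. if C i \<inter> A = {} then {} else C i)"
    define CB where "CB = (\<lambda>i. if C i \<inter> A = {} then C i else {})"
    have disj: "C i \<inter> B = {}" if *: "C i \<inter> A \<noteq> {}" for i
    proof (rule ccontr)
      assume "C i \<inter> B \<noteq> {}"
      with * obtain x y where "x \<in> A" "y \<in> B" "x \<in> C i" "y \<in> C i" by blast
      then have "dist x y \<le> \<delta>" using C diameter_bounded_bound[of "C i" x y]
        unfolding fine_cover_def by (meson order_trans)
      then show False using sep[OF \<open>x \<in> A\<close> \<open>y \<in> B\<close>] d by simp
    qed
    have "\<delta> \<ge> 0" using C diameter_ge_0[of "C 0"] unfolding fine_cover_def by (meson order_trans)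
    have "fine_cover \<delta> A CA"
      using C \<open>\<delta> \<ge> 0\<close> unfolding fine_cover_def CA_def by (auto split: if_splits) blast
    moreover have "fine_cover \<delta> B CB"
      using C \<open>\<delta> \<ge> 0\<close> disj unfolding fine_cover_def CB_def by (auto split: if_splits) blast
    ultimately have "hausdorff_pre s \<delta> A + hausdorff_pre s \<delta> B
        \<le> (\<Sum>i. hausdorff_cost s (CA i)) + (\<Sum>i. hausdorff_cost s (CB i))"
      by (intro add_mono hausdorff_pre_le)
    also have "\<dots> = (\<Sum>i. hausdorff_cost s (CA i) + hausdorff_cost s (CB i))"
      by (intro suminf_add) auto
    also have "\<dots> = (\<Sum>i. hausdorff_cost s (C i))"
      by (intro suminf_cong) (auto simp: CA_def CB_def)
    finally show "hausdorff_pre s \<delta> A + hausdorff_pre s \<delta> B \<le> (\<Sum>i. hausdorff_cost s (C i))" .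
  qed
  \<comment> \<open>Two independent scales, because the two suprema are taken one after the other; a
    common scale below \<eta> dominates both terms.\<close>
  have 2: "hausdorff_pre s \<delta>1 A + hausdorff_pre s \<delta>2 B \<le> hausdorff_outer s (A \<union> B)"
    if "\<delta>1 > 0" "\<delta>2 > 0" for \<delta>1 \<delta>2
  proof -
    let ?d = "Min {\<delta>1, \<delta>2, \<eta> / 2}"
    have "hausdorff_pre s \<delta>1 A + hausdorff_pre s \<delta>2 B \<le> hausdorff_pre s ?d A + hausdorff_pre s ?d B"
      by (intro add_mono hausdorff_pre_antimono) auto
    also have "\<dots> \<le> hausdorff_pre s ?d (A \<union> B)" using \<eta> by (intro 1) (auto simp: min_less_iff_disj)
    also have "\<dots> \<le> hausdorff_outer s (A \<union> B)" using that \<eta> by (intro hausdorff_pre_le_outer) auto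
    finally show ?thesis .
  qed
  show ?thesis
    unfolding hausdorff_outer_def[of s A] hausdorff_outer_def[of s B]
    by (subst ennreal_SUP_add_left[symmetric], force, intro SUP_least,
        subst ennreal_SUP_add_right, force, intro SUP_least) (auto intro: 2)
qed

text \<open>Images of covering sets have diameters enlarged by at most L, so costs grow by at most
  L^s. For s > 0 the cost is a power of the diameter even for the empty set, which removes the case
  distinction in \<open>hausdorff_cost\<close>.\<close>

lemma hausdorff_outer_lipschitz:
  fixes f :: "'a::euclidean_space \<Rightarrow> 'b::euclidean_space"
  assumes s: "s > 0" and L: "L > 0"
    and lip: "\<And>x y. x \<in> A \<Longrightarrow> y \<in> A \<Longrightarrow> dist (f x) (f y) \<le> L * dist x y"
  shows "hausdorff_outer s (f ` A) \<le> ennreal (L powr s) * hausdorff_outer s A"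
proof (rule hausdorff_outer_least)
  fix \<delta> :: real assume \<delta>: "\<delta> > 0"
  have *: "hausdorff_pre s \<delta> (f ` A) \<le> ennreal (L powr s) * (\<Sum>i. hausdorff_cost s (C i))"
    if C: "fine_cover (\<delta> / L) A C" for C
  proof -
    have bd: "bounded (C i)" "diameter (C i) \<le> \<delta> / L" for i using C by (auto simp: fine_cover_def)
    have dist: "dist (f x) (f y) \<le> L * diameter (C i)" if "x \<in> C i \<inter> A" "y \<in> C i \<inter> A" for x y i
      using lip[of x y] diameter_bounded_bound[OF bd(1), of x i y] that L
      by (meson IntE mult_left_mono order_trans less_imp_le)
    have diam: "diameter (f ` (C i \<inter> A)) \<le> L * diameter (C i)" for i
      by (rule diameter_le) (use dist[of _ i] L diameter_ge_0[OF bd(1), of i] in \<open>auto simp: dist_norm[symmetric]\<close>)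
    \<comment> \<open>The covering sets are cut down to A before f is applied, since the Lipschitz
      bound holds on A only.\<close>
    have "fine_cover \<delta> (f ` A) (\<lambda>i. f ` (C i \<inter> A))"
      unfolding fine_cover_def
    proof (intro conjI allI)
      show "f ` A \<subseteq> (\<Union>i. f ` (C i \<inter> A))" using C unfolding fine_cover_def by blast
      show "bounded (f ` (C i \<inter> A))" for i
        unfolding bounded_two_points using dist[of _ i] by blast
      show "diameter (f ` (C i \<inter> A)) \<le> \<delta>" for i
        using diam[of i] bd(2)[of i] L by (simp add: field_simps)
    qed
    then have "hausdorff_pre s \<delta> (f ` A) \<le> (\<Sum>i. hausdorff_cost s (f ` (C i \<inter> A)))"
      by (rule hausdorff_pre_le)
    also have "\<dots> \<le> (\<Sum>i. ennreal (L powr s) * hausdorff_cost s (C i))"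
    proof (intro suminf_le)
      fix i
      have "(diameter (f ` (C i \<inter> A)) / 2) powr s \<le> (L * (diameter (C i) / 2)) powr s"
        using diam[of i] s diameter_ge_0[of "f ` (C i \<inter> A)"] C
        by (intro powr_mono2) (auto intro!: diameter_ge_0 simp: \<open>fine_cover \<delta> (f ` A) (\<lambda>i. f ` (C i \<inter> A))\<close>[unfolded fine_cover_def])
      also have "\<dots> = L powr s * (diameter (C i) / 2) powr s"
        using L diameter_ge_0[OF bd(1)] powr_mult[of L "diameter (C i) / 2" s] by simp
      finally show "hausdorff_cost s (f ` (C i \<inter> A)) \<le> ennreal (L powr s) * hausdorff_cost s (C i)"
        using s by (auto simp: hausdorff_cost_eq ennreal_mult'[symmetric] mult.left_commute
             intro!: ennreal_leI mult_left_mono)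
    qed auto
    also have "\<dots> = ennreal (L powr s) * (\<Sum>i. hausdorff_cost s (C i))" by simp
    finally show ?thesis .
  qed
  have "hausdorff_pre s \<delta> (f ` A) \<le> ennreal (L powr s) * hausdorff_pre s (\<delta> / L) A"
  proof -
    have "hausdorff_pre s \<delta> (f ` A) / ennreal (L powr s) \<le> hausdorff_pre s (\<delta> / L) A"
      by (rule le_hausdorff_pre, rule divide_le_posI_ennreal) (use * L in auto)
    then have "ennreal (L powr s) * (hausdorff_pre s \<delta> (f ` A) / ennreal (L powr s))
        \<le> ennreal (L powr s) * hausdorff_pre s (\<delta> / L) A" by (intro mult_left_mono) auto
    moreover have "ennreal (L powr s) * (hausdorff_pre s \<delta> (f ` A) / ennreal (L powr s)) = hausdorff_pre s \<delta> (f ` A)"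
      unfolding ennreal_times_divide mult.commute[of "ennreal (L powr s)" "hausdorff_pre s \<delta> (f ` A)"]
      using L by (intro mult_divide_eq_ennreal) auto
    ultimately show ?thesis by simp
  qed
  also have "\<dots> \<le> ennreal (L powr s) * hausdorff_outer s A"
    using \<delta> L by (intro mult_left_mono hausdorff_pre_le_outer) auto
  finally show "hausdorff_pre s \<delta> (f ` A) \<le> ennreal (L powr s) * hausdorff_outer s A" .
qed

text \<open>Two shells of equal parity are separated by a shell in between, hence have positive
  distance, and the outer measure is additive on them. The even and the odd shells contribute
  \<open>hausdorff_outer s X\<close> at most once each, whence the factor 2.\<close>

lemma hausdorff_outer_shells:
  fixes d :: "'a::euclidean_space \<Rightarrow> real" and X :: "'a set"
  assumes lip: "\<And>x y. \<bar>d x - d y\<bar> \<le> dist x y"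
  defines "R \<equiv> \<lambda>j. {x \<in> X. 1 / real (j + 2) \<le> d x \<and> d x < 1 / real (j + 1)}"
  shows "(\<Sum>j. hausdorff_outer s (R j)) \<le> 2 * hausdorff_outer s X"
proof -
  have parity: "(\<Sum>j<n. hausdorff_outer s (R (2 * j + c))) \<le> hausdorff_outer s (\<Union>j<n. R (2 * j + c))" for c n
  proof (induction n)
    case (Suc n)
    have "(\<Sum>j<Suc n. hausdorff_outer s (R (2 * j + c)))
        \<le> hausdorff_outer s (\<Union>j<n. R (2 * j + c)) + hausdorff_outer s (R (2 * n + c))"
      using Suc by (simp add: add_right_mono)
    also have "\<dots> \<le> hausdorff_outer s ((\<Union>j<n. R (2 * j + c)) \<union> R (2 * n + c))"
    \<comment> \<open>For n = 0 the union is empty, and the gap below would divide by zero when c =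
      0.\<close>
    proof (cases "n = 0")
      case False
      \<comment> \<open>The distance between the lower end 1/(2n+c) of the preceding shell of this
        parity and the upper end 1/(2n+c+1) of the new one.\<close>
      let ?\<eta> = "1 / real (2 * n + c) - 1 / real (2 * n + c + 1)"
      show ?thesis
      proof (rule hausdorff_outer_metric[of ?\<eta>])
        show "?\<eta> > 0"
          using False divide_strict_left_mono[of "real (2 * n + c)" "real (2 * n + c + 1)" 1] by simp
        fix x y assume "x \<in> (\<Union>j<n. R (2 * j + c))" and y: "y \<in> R (2 * n + c)"
        then obtain j where j: "j < n" "x \<in> R (2 * j + c)" by blast
        have "1 / real (2 * n + c) \<le> 1 / real (2 * j + c + 2)"
          using j(1) by (intro divide_left_mono) auto
        also have "\<dots> \<le> d x" using j(2) by (simp add: R_def)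
        finally have "1 / real (2 * n + c) \<le> d x" .
        moreover have "d y < 1 / real (2 * n + c + 1)" using y by (simp add: R_def)
        ultimately show "?\<eta> \<le> dist x y" using lip[of x y] by linarith
      qed
    qed simp
    also have "(\<Union>j<n. R (2 * j + c)) \<union> R (2 * n + c) = (\<Union>j<Suc n. R (2 * j + c))"
      by (auto simp: less_Suc_eq)
    finally show ?case .
  qed simp
  have parity': "(\<Sum>j<n. hausdorff_outer s (R (2 * j + c))) \<le> hausdorff_outer s X" for c n
    by (rule order_trans[OF parity]) (auto intro!: hausdorff_outer_mono simp: R_def)
  have split: "(\<Sum>j<2 * n. f j) = (\<Sum>j<n. f (2 * j)) + (\<Sum>j<n. f (2 * j + 1))" for f :: "nat \<Rightarrow> ennreal" and n
    by (induction n) (auto simp: algebra_simps)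
  have "(\<Sum>j<n. hausdorff_outer s (R j)) \<le> 2 * hausdorff_outer s X" for n
  proof -
    have "(\<Sum>j<n. hausdorff_outer s (R j)) \<le> (\<Sum>j<2 * n. hausdorff_outer s (R j))"
      by (intro sum_mono2) auto
    also have "\<dots> \<le> 2 * hausdorff_outer s X"
      unfolding split mult_2[of "hausdorff_outer s X"] using parity'[where c=0] parity'[where c=1]
      by (intro add_mono) simp_all
    finally show ?thesis .
  qed
  then show ?thesis unfolding suminf_eq_SUP by (intro SUP_least)
qed

text \<open>The hard half of Caratheodory's criterion for closed sets. The points \<open>A k\<close>
  at distance at least 1/(k+1) from F split off additively from X \<inter> F; what X - F has beyond
  \<open>A k\<close> lies in the shells from index k on, and these have small total measure because
  the series over all shells converges.\<close>

lemma hausdorff_outer_closed_split: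
  fixes X F :: "'a::euclidean_space set"
  assumes F: "closed F"
  shows "hausdorff_outer s (X \<inter> F) + hausdorff_outer s (X - F) \<le> hausdorff_outer s X"
proof (cases "F = {} \<or> hausdorff_outer s X = \<infinity>")
  case False
  then have ne: "F \<noteq> {}" and fin: "hausdorff_outer s X \<noteq> \<infinity>" by auto
  define R where "R = (\<lambda>j. {x \<in> X. 1 / real (j + 2) \<le> infdist x F \<and> infdist x F < 1 / real (j + 1)})"
  define A where "A = (\<lambda>k::nat. {x \<in> X. 1 / real (k + 1) \<le> infdist x F})"
  have "(\<Sum>j. hausdorff_outer s (R j)) \<le> 2 * hausdorff_outer s X"
    unfolding R_def by (rule hausdorff_outer_shells) (rule infdist_triangle_abs)
  also have "\<dots> < \<infinity>" using fin by (simp add: ennreal_mult_less_top less_top)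
  finally have "(\<Sum>j. hausdorff_outer s (R j)) \<noteq> \<infinity>" by simp
  then have Rfin: "hausdorff_outer s (R j) \<noteq> \<infinity>" for j
    using ennreal_suminf_lessD[of "\<lambda>k. hausdorff_outer s (R k)" \<infinity> j] by (auto simp: less_top)
  define r where "r = (\<lambda>j. enn2real (hausdorff_outer s (R j)))"
  have R_eq: "hausdorff_outer s (R j) = ennreal (r j)" for j
    using Rfin[of j] by (simp add: r_def less_top)
  have r0: "r j \<ge> 0" for j by (simp add: r_def)
  have "summable r"
    using \<open>(\<Sum>j. hausdorff_outer s (R j)) \<noteq> \<infinity>\<close> unfolding R_eq
    by (intro summable_suminf_not_top) (auto simp: r0)
  show ?thesis
  proof (rule ennreal_le_epsilon)
    fix e :: real assume e: "e > 0"
    obtain k where k: "norm (\<Sum>j. r (j + k)) < e"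
      using suminf_exist_split[OF e \<open>summable r\<close>] by auto
    have "X - F \<subseteq> A k \<union> (\<Union>j. R (j + k))"
    proof
      fix x assume x: "x \<in> X - F"
      then have pos: "infdist x F > 0"
        using F ne in_closed_iff_infdist_zero[of F x] infdist_nonneg[of x F] by auto
      show "x \<in> A k \<union> (\<Union>j. R (j + k))"
      proof (cases "x \<in> A k")
        case False
        define P where "P = (\<lambda>j. 1 / real (j + k + 2) \<le> infdist x F)"
        have "\<exists>j. P j"
        proof -
          obtain N where N: "N \<noteq> 0" "inverse (real N) < infdist x F"
            using ex_inverse_of_nat_less[OF pos] by auto
          have "1 / real (N + k + 2) \<le> inverse (real N)"
            using N(1) by (simp add: field_simps)
          then show ?thesis using N by (auto simp: P_def intro!: exI[of _ N])
        qed
        \<comment> \<open>The least index whose lower bound is met selects the shell of x; for index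
          0 the upper bound comes from x not being in \<open>A k\<close>.\<close>
        define j where "j = (LEAST j. P j)"
        have "P j" unfolding j_def using \<open>\<exists>j. P j\<close> by (rule LeastI_ex)
        moreover have "infdist x F < 1 / real (j + k + 1)"
        proof (cases j)
          case 0
          then show ?thesis using False x by (auto simp: A_def)
        next
          case (Suc i)
          then have "\<not> P i" using not_less_Least[of i P] by (simp add: j_def)
          then show ?thesis using Suc by (simp add: P_def add.commute)
        qed
        ultimately have "x \<in> R (j + k)" using x by (auto simp: P_def R_def)
        then show ?thesis by blast
      qed simp
    qed
    then have "hausdorff_outer s (X - F) \<le> hausdorff_outer s (A k) + (\<Sum>j. hausdorff_outer s (R (j + k)))"
      by (rule order_trans[OF order_trans[OF hausdorff_outer_mono hausdorff_outer_Un]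
            add_left_mono[OF hausdorff_outer_Union]])
    also have "(\<Sum>j. hausdorff_outer s (R (j + k))) = ennreal (\<Sum>j. r (j + k))"
      unfolding R_eq using \<open>summable r\<close> r0 by (intro suminf_ennreal2) auto
    also have "\<dots> \<le> ennreal e" using k by (intro ennreal_leI) auto
    finally have 1: "hausdorff_outer s (X - F) \<le> hausdorff_outer s (A k) + ennreal e"
      by (simp add: add_left_mono)
    have "hausdorff_outer s (X \<inter> F) + hausdorff_outer s (A k) \<le> hausdorff_outer s ((X \<inter> F) \<union> A k)"
    proof (rule hausdorff_outer_metric[of "1 / real (k + 1)"])
      fix x y assume "x \<in> X \<inter> F" "y \<in> A k"
      then show "1 / real (k + 1) \<le> dist x y"
        using infdist_le[of x F y] by (auto simp: A_def dist_commute)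
    qed simp
    also have "\<dots> \<le> hausdorff_outer s X" by (intro hausdorff_outer_mono) (auto simp: A_def)
    finally show "hausdorff_outer s (X \<inter> F) + hausdorff_outer s (X - F) \<le> hausdorff_outer s X + ennreal e"
      by (intro order_trans[OF add_left_mono[OF 1]]) (simp only: add.assoc[symmetric] add_right_mono)
  qed
qed auto

text \<open>\<open>measure_of\<close> yields the zero measure unless its argument is a measure on
  the sigma algebra, so this is what gives \<open>hausdorff_measure\<close> a meaning. By
  Caratheodory's theorem it suffices that closed sets belong to the lambda system.\<close>

lemma measure_space_hausdorff_outer:
  "measure_space UNIV (sets borel) (hausdorff_outer s :: 'a::euclidean_space set \<Rightarrow> ennreal)"
proof -
  let ?f = "hausdorff_outer s :: 'a set \<Rightarrow> ennreal"
  let ?L = "lambda_system UNIV (Pow UNIV) ?f"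
  interpret P: sigma_algebra UNIV "Pow UNIV :: 'a set set" by (rule sigma_algebra_Pow)
  have "outer_measure_space (Pow UNIV) ?f"
    unfolding outer_measure_space_def positive_def increasing_def countably_subadditive_def
    by (auto intro: hausdorff_outer_mono hausdorff_outer_Union)
  then have ms: "measure_space UNIV ?L ?f" by (rule P.caratheodory_lemma)
  then have sa: "sigma_algebra UNIV ?L" by (simp add: measure_space_def)
  have "F \<in> ?L" if "closed F" for F
  proof -
    have "?f (X \<inter> F) + ?f (X - F) = ?f X" for X
    proof (rule antisym)
      show "?f X \<le> ?f (X \<inter> F) + ?f (X - F)"
        using hausdorff_outer_Un[of s "X \<inter> F" "X - F"] by (simp add: Int_Diff_Un)
    qed (rule hausdorff_outer_closed_split[OF that])
    then show ?thesis by (subst P.lambda_system_eq) auto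
  qed
  then have "sets (borel :: 'a measure) \<subseteq> ?L"
    unfolding borel_eq_closed using sigma_algebra.sigma_sets_subset[OF sa, of "Collect closed"] by auto
  then show ?thesis using measure_down[OF ms] sets.sigma_algebra_axioms[of "borel :: 'a measure"] by simp
qed

lemma sets_hausdorff_measure [simp, measurable_cong]: "sets (hausdorff_measure s) = sets borel"
  unfolding hausdorff_measure_def 
  using sets.sigma_sets_eq[of borel] by (simp add: sets_measure_of_conv)

lemma space_hausdorff_measure [simp]: "space (hausdorff_measure s) = UNIV"
  using sets_eq_imp_space_eq[OF sets_hausdorff_measure, of s] by simp

lemma emeasure_hausdorff_measure:
  assumes "A \<in> sets borel"
  shows "emeasure (hausdorff_measure s) A = hausdorff_outer s A"
  unfolding hausdorff_measure_def
proof (rule emeasure_measure_of_sigma[OF _ _ _ assms])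
  show "sigma_algebra UNIV (sets (borel :: 'a measure))"
    using sets.sigma_algebra_axioms[of "borel :: 'a measure"] by simp
qed (use measure_space_hausdorff_outer[of s, where 'a='a] in \<open>auto simp: measure_space_def\<close>)

section \<open>Steiner symmetrization and the isodiametric inequality\<close>

abbreviation lborel_fun :: "'i set \<Rightarrow> ('i \<Rightarrow> real) measure" where
  "lborel_fun I \<equiv> Pi\<^sub>M I (\<lambda>_. lborel)"

definition steiner_len :: "'i \<Rightarrow> ('i \<Rightarrow> real) set \<Rightarrow> ('i \<Rightarrow> real) \<Rightarrow> ennreal" where
  "steiner_len k A x = emeasure lborel {t. x(k := t) \<in> A}"

text \<open>Each line in direction k is replaced by the open interval centred at 0 whose length is
  that of the section of A. Coordinate functions are used instead of vectors, so that Fubini can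
  split off one coordinate.\<close>

definition steiner :: "'i set \<Rightarrow> 'i \<Rightarrow> ('i \<Rightarrow> real) set \<Rightarrow> ('i \<Rightarrow> real) set" where
  "steiner I k A = {x \<in> space (lborel_fun I). ennreal (2 * \<bar>x k\<bar>) < steiner_len k A x}"

lemma steiner_len_upd [simp]: "steiner_len k A (x(k := t)) = steiner_len k A x"
  by (simp add: steiner_len_def)

lemma steiner_len_measurable:
  assumes k: "k \<in> I" and A: "A \<in> sets (lborel_fun I)"
  shows "steiner_len k A \<in> borel_measurable (lborel_fun I)"
proof -
  let ?M = "lborel_fun I"
  let ?B = "(\<lambda>(x, t). x(k := t)) -` A \<inter> space (?M \<Otimes>\<^sub>M lborel)"
  have "(\<lambda>(x, t). x(k := t)) \<in> ?M \<Otimes>\<^sub>M lborel \<rightarrow>\<^sub>M ?M"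
    unfolding case_prod_beta using k
    by (intro measurable_fun_upd[where J=I] measurable_fst measurable_snd) auto
  then have B: "?B \<in> sets (?M \<Otimes>\<^sub>M lborel)" using A by (rule measurable_sets)
  have "steiner_len k A x = emeasure lborel (Pair x -` ?B)" if "x \<in> space ?M" for x
    using that by (auto simp: steiner_len_def space_pair_measure intro!: arg_cong[where f="emeasure lborel"])
  then show ?thesis
    using lborel.measurable_emeasure_Pair[OF B] by (subst measurable_cong) auto
qed

lemma steiner_sets:
  assumes "k \<in> I" "A \<in> sets (lborel_fun I)"
  shows "steiner I k A \<in> sets (lborel_fun I)"
proof -
  note [measurable] = steiner_len_measurable[OF assms]
  have [measurable]: "(\<lambda>x. x k) \<in> borel_measurable (lborel_fun I)"
    using measurable_component_singleton[OF \<open>k \<in> I\<close>, of "\<lambda>_. lborel :: real measure"] by simp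
  show ?thesis unfolding steiner_def by measurable
qed

lemma emeasure_steiner_section: "emeasure lborel {t::real. ennreal (2 * \<bar>t\<bar>) < l} = l"
proof (cases l)
  case (real r)
  have "{t::real. ennreal (2 * \<bar>t\<bar>) < l} = {- (r / 2) <..< r / 2}"
    using real by (auto simp: ennreal_less_iff)
  then show ?thesis using real by simp
next
  case top
  then have "{t::real. ennreal (2 * \<bar>t\<bar>) < l} = UNIV" by simp
  then show ?thesis using top by simp
qed

text \<open>Cavalieri's principle: both sets have sections of equal length in direction k.\<close>

lemma emeasure_steiner:
  assumes fin: "finite I" and k: "k \<in> I" and A: "A \<in> sets (lborel_fun I)"
  shows "emeasure (lborel_fun I) (steiner I k A) = emeasure (lborel_fun I) A"
proof -
  interpret product_sigma_finite "\<lambda>_. lborel :: real measure" ..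
  define J where "J = I - {k}"
  have I: "I = insert k J" "k \<notin> J" "finite J" using k fin by (auto simp: J_def)
  have eq: "emeasure (lborel_fun I) X = (\<integral>\<^sup>+ x. steiner_len k X x \<partial>lborel_fun J)"
    if X: "X \<in> sets (lborel_fun I)" for X
  proof -
    have "emeasure (lborel_fun I) X = (\<integral>\<^sup>+ x. indicator X x \<partial>lborel_fun I)"
      using X by simp
    also have "\<dots> = (\<integral>\<^sup>+ x. (\<integral>\<^sup>+ t. indicator X (x(k := t)) \<partial>lborel) \<partial>lborel_fun J)"
      unfolding I(1) using X I by (intro product_nn_integral_insert) auto
    also have "\<dots> = (\<integral>\<^sup>+ x. steiner_len k X x \<partial>lborel_fun J)"
    proof (intro nn_integral_cong)
      fix x assume x: "x \<in> space (lborel_fun J)"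
      have "(\<lambda>t. x(k := t)) \<in> lborel \<rightarrow>\<^sub>M lborel_fun I"
        using x I(1) by (intro measurable_fun_upd[where J=J]) auto
      from measurable_sets[OF this X] have "{t. x(k := t) \<in> X} \<in> sets lborel"
        by (simp add: vimage_def)
      then have "(\<integral>\<^sup>+ t. indicator {t. x(k := t) \<in> X} t \<partial>lborel) = steiner_len k X x"
        by (simp add: steiner_len_def)
      then show "(\<integral>\<^sup>+ t. indicator X (x(k := t)) \<partial>lborel) = steiner_len k X x"
        by (simp add: indicator_def)
    qed
    finally show ?thesis .
  qed
  have "steiner_len k (steiner I k A) x = steiner_len k A x"
    if "x \<in> space (lborel_fun J)" for x
  proof -
    have "x(k := t) \<in> space (lborel_fun I)" for t
      using that I by (auto simp: space_PiM PiE_def extensional_def)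
    then show ?thesis
      by (subst steiner_len_def) (simp add: steiner_def emeasure_steiner_section)
  qed
  then show ?thesis
    using eq[OF A] eq[OF steiner_sets[OF k A]] by (simp cong: nn_integral_cong)
qed

text \<open>If all distances were at most a + b, then T would lie between sup S - (a + b) and inf S
  + (a + b), so the enclosing intervals of S and T would have total length 2(a + b), against the
  hypotheses. This is the one-dimensional core of the diameter estimate.\<close>

lemma emeasure_gt_two_points:
  fixes S T :: "real set"
  assumes len: "ennreal (2 * a) < emeasure lborel S" "ennreal (2 * b) < emeasure lborel T"
    and a: "a \<ge> 0" "b \<ge> 0"
  shows "\<exists>s\<in>S. \<exists>t\<in>T. a + b < \<bar>s - t\<bar>"
proof (rule ccontr)
  assume "\<not> ?thesis"
  then have D: "\<bar>s - t\<bar> \<le> a + b" if "s \<in> S" "t \<in> T" for s t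
    using that by (meson not_le)
  have ne: "S \<noteq> {}" "T \<noteq> {}" using len by auto
  then obtain s0 t0 where st0: "s0 \<in> S" "t0 \<in> T" by auto
  have bS: "bdd_below S" "bdd_above S"
    using D[OF _ st0(2)] by (auto intro!: bdd_belowI[of _ "t0 - (a + b)"] bdd_aboveI[of _ "t0 + (a + b)"] simp: abs_le_iff algebra_simps)
  let ?l = "Inf S" and ?u = "Sup S"
  have "?l \<le> ?u" using bS ne by (intro cInf_le_cSup) auto
  have S: "S \<subseteq> {?l .. ?u}" using bS by (auto intro: cInf_lower cSup_upper)
  have T: "T \<subseteq> {?u - (a + b) .. ?l + (a + b)}"
  proof
    fix t assume t: "t \<in> T"
    have "?u \<le> t + (a + b)" using D[OF _ t] ne by (intro cSup_least) (auto simp: abs_le_iff algebra_simps)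
    moreover have "t - (a + b) \<le> ?l" using D[OF _ t] ne by (intro cInf_greatest) (auto simp: abs_le_iff algebra_simps)
    ultimately show "t \<in> {?u - (a + b) .. ?l + (a + b)}" by simp
  qed
  have "2 * a < ?u - ?l"
    using len(1) emeasure_mono[OF S, of lborel] \<open>?l \<le> ?u\<close> a
    by (auto simp: ennreal_less_iff dest: less_le_trans)
  moreover have "2 * b < ?l + (a + b) - (?u - (a + b))"
  proof -
    have "?u - (a + b) \<le> ?l + (a + b)" using T ne by force
    then show ?thesis using len(2) emeasure_mono[OF T, of lborel] a
      by (auto simp: ennreal_less_iff dest: less_le_trans)
  qed
  ultimately show False by simp
qed

text \<open>The heights of x and y are less than half the lengths of their sections, so these
  sections contain s and t with |s - t| > |x k| + |y k| \<ge> |x k - y k|; the other coordinates are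
  unchanged.\<close>

lemma steiner_diam:
  assumes fin: "finite I" and k: "k \<in> I"
    and D: "\<And>x y. x \<in> A \<Longrightarrow> y \<in> A \<Longrightarrow> (\<Sum>i\<in>I. (x i - y i)\<^sup>2) \<le> D"
    and x: "x \<in> steiner I k A" and y: "y \<in> steiner I k A"
  shows "(\<Sum>i\<in>I. (x i - y i)\<^sup>2) \<le> D"
proof -
  obtain s t where st: "x(k := s) \<in> A" "y(k := t) \<in> A" "\<bar>x k\<bar> + \<bar>y k\<bar> < \<bar>s - t\<bar>"
    using emeasure_gt_two_points[of "\<bar>x k\<bar>" "{s. x(k := s) \<in> A}" "\<bar>y k\<bar>" "{t. y(k := t) \<in> A}"] x y
    by (auto simp: steiner_def steiner_len_def)
  have "\<bar>x k - y k\<bar> \<le> \<bar>s - t\<bar>" using st(3) by linarith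
  then have "(x k - y k)\<^sup>2 \<le> (s - t)\<^sup>2" by (simp add: abs_le_square_iff)
  then have "(\<Sum>i\<in>I. (x i - y i)\<^sup>2) \<le> (\<Sum>i\<in>I. ((x(k := s)) i - (y(k := t)) i)\<^sup>2)"
    by (intro sum_mono) auto
  also have "\<dots> \<le> D" by (rule D[OF st(1,2)])
  finally show ?thesis .
qed

lemma steiner_flip:
  assumes "x \<in> steiner I k A" "k \<in> I"
  shows "x(k := - x k) \<in> steiner I k A"
  using assms by (auto simp: steiner_def space_PiM PiE_def extensional_def)

text \<open>Symmetries gained in earlier steps survive, because the sections over x and over its
  mirror image in coordinate j coincide.\<close>

lemma steiner_flip_other:
  assumes "x \<in> steiner I k A" "j \<in> I" "j \<noteq> k" and flip: "\<And>x. x \<in> A \<Longrightarrow> x(j := - x j) \<in> A"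
  shows "x(j := - x j) \<in> steiner I k A"
proof -
  have "x(j := - x j, k := t) \<in> A \<longleftrightarrow> x(k := t) \<in> A" for t
  proof -
    have "x(k := t, j := x j) = x(k := t)" using \<open>j \<noteq> k\<close> by auto
    then show ?thesis using flip[of "x(k := t)"] flip[of "x(j := - x j, k := t)"] \<open>j \<noteq> k\<close>
      by (auto simp: fun_upd_twist)
  qed
  then show ?thesis using assms
    by (auto simp: steiner_def steiner_len_def space_PiM PiE_def extensional_def)
qed

lemma exists_symmetrization:
  fixes A :: "('i \<Rightarrow> real) set"
  assumes fin: "finite I" and "J \<subseteq> I" and A: "A \<in> sets (lborel_fun I)"
    and D: "\<forall>x\<in>A. \<forall>y\<in>A. (\<Sum>i\<in>I. (x i - y i)\<^sup>2) \<le> D"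
  shows "\<exists>A' \<in> sets (lborel_fun I).
      emeasure (lborel_fun I) A' = emeasure (lborel_fun I) A \<and>
      (\<forall>x\<in>A'. \<forall>y\<in>A'. (\<Sum>i\<in>I. (x i - y i)\<^sup>2) \<le> D) \<and> (\<forall>j\<in>J. \<forall>x\<in>A'. x(j := - x j) \<in> A')"
  using finite_subset[OF \<open>J \<subseteq> I\<close> fin] \<open>J \<subseteq> I\<close>
proof (induction rule: finite_induct)
  case empty
  then show ?case using A D by auto
next
  case (insert k J)
  have "J \<subseteq> I" using insert.prems by simp
  obtain A' where A': "A' \<in> sets (lborel_fun I)"
      "emeasure (lborel_fun I) A' = emeasure (lborel_fun I) A"
    and A'_ball: "\<forall>x\<in>A'. \<forall>y\<in>A'. (\<Sum>i\<in>I. (x i - y i)\<^sup>2) \<le> D"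
      "\<forall>j\<in>J. \<forall>x\<in>A'. x(j := - x j) \<in> A'"
    using insert.IH[OF \<open>J \<subseteq> I\<close>] by (elim bexE conjE) (rule that)
  note A' = A' A'_ball[rule_format]
  have k: "k \<in> I" using insert by auto
  show ?case
  proof (intro bexI[of _ "steiner I k A'"] conjI ballI)
    fix j x assume j: "j \<in> insert k J" and x: "x \<in> steiner I k A'"
    show "x(j := - x j) \<in> steiner I k A'"
    proof (cases "j = k")
      case True
      then show ?thesis using steiner_flip[OF x k] by simp
    next
      case False
      then show ?thesis using j insert.prems A'(4) by (intro steiner_flip_other x) auto
    qed
  qed (use A' emeasure_steiner[OF fin k A'(1)] steiner_diam[OF fin k A'(3)] steiner_sets[OF k A'(1)] in auto)
qed

text \<open>A set of diameter d need not lie in a ball of radius d/2. After symmetrization in all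
  coordinates it does: with x it contains -x, so 2|x| \<le> d.\<close>

lemma isodiametric_PiM:
  fixes A :: "('i \<Rightarrow> real) set"
  assumes fin: "finite I" and A: "A \<in> sets (lborel_fun I)" and d: "d > 0"
    and D: "\<And>x y. x \<in> A \<Longrightarrow> y \<in> A \<Longrightarrow> (\<Sum>i\<in>I. (x i - y i)\<^sup>2) \<le> d\<^sup>2"
  shows "emeasure (lborel_fun I) A \<le> ennreal (unit_ball_vol (card I) * (d / 2) ^ card I)"
proof -
  have D': "\<forall>x\<in>A. \<forall>y\<in>A. (\<Sum>i\<in>I. (x i - y i)\<^sup>2) \<le> d\<^sup>2" using D by blast
  obtain A' where A': "A' \<in> sets (lborel_fun I)"
      "emeasure (lborel_fun I) A' = emeasure (lborel_fun I) A"
    and A'_ball: "\<forall>x\<in>A'. \<forall>y\<in>A'. (\<Sum>i\<in>I. (x i - y i)\<^sup>2) \<le> d\<^sup>2"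
      "\<forall>j\<in>I. \<forall>x\<in>A'. x(j := - x j) \<in> A'"
    using exists_symmetrization[OF fin order_refl A D'] by (elim bexE conjE) (rule that)
  note A' = A' A'_ball[rule_format]
  have flips: "(\<lambda>i. if i \<in> S then - x i else x i) \<in> A'" if x: "x \<in> A'" and "S \<subseteq> I" for x S
    using finite_subset[OF \<open>S \<subseteq> I\<close> fin] \<open>S \<subseteq> I\<close>
  proof (induction rule: finite_induct)
    case (insert k S)
    let ?g = "\<lambda>i. if i \<in> S then - x i else x i"
    have "?g(k := - ?g k) \<in> A'" using insert by (intro A'(4)) auto
    moreover have "?g(k := - ?g k) = (\<lambda>i. if i \<in> insert k S then - x i else x i)"
      using insert.hyps by (intro ext) auto
    ultimately show ?case by (simp only:)
  qed (use x in simp)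
  have "A' \<subseteq> {f. sqrt (\<Sum>i\<in>I. (f i)\<^sup>2) \<le> d / 2} \<inter> space (lborel_fun I)"
  proof
    fix x assume x: "x \<in> A'"
    have "(\<Sum>i\<in>I. (x i - (if i \<in> I then - x i else x i))\<^sup>2) \<le> d\<^sup>2"
      by (rule A'(3)[OF x flips[OF x order_refl]])
    also have "(\<Sum>i\<in>I. (x i - (if i \<in> I then - x i else x i))\<^sup>2) = 4 * (\<Sum>i\<in>I. (x i)\<^sup>2)"
      unfolding sum_distrib_left by (intro sum.cong) (auto simp: power2_eq_square algebra_simps)
    finally have "(\<Sum>i\<in>I. (x i)\<^sup>2) \<le> (d / 2)\<^sup>2" by (simp add: power_divide)
    then have "sqrt (\<Sum>i\<in>I. (x i)\<^sup>2) \<le> d / 2" using d by (intro real_le_lsqrt) (auto intro: sum_nonneg)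
    then show "x \<in> {f. sqrt (\<Sum>i\<in>I. (f i)\<^sup>2) \<le> d / 2} \<inter> space (lborel_fun I)"
      using sets.sets_into_space[OF A'(1)] x by auto
  qed
  then have "emeasure (lborel_fun I) A'
      \<le> emeasure (lborel_fun I) ({f. sqrt (\<Sum>i\<in>I. (f i)\<^sup>2) \<le> d / 2} \<inter> space (lborel_fun I))"
  proof (rule emeasure_mono)
    have "(\<lambda>f. sqrt (\<Sum>i\<in>I. (f i)\<^sup>2)) \<in> borel_measurable (lborel_fun I)"
      by (intro measurable_compose[OF borel_measurable_sum borel_measurable_sqrt] borel_measurable_power)
         (use measurable_component_singleton[of _ I "\<lambda>_. lborel :: real measure"] in auto)
    then show "{f. sqrt (\<Sum>i\<in>I. (f i)\<^sup>2) \<le> d / 2} \<inter> space (lborel_fun I)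
        \<in> sets (lborel_fun I)"
      by (simp add: Int_def conj_commute borel_measurable_iff_le)
  qed
  also have "\<dots> = ennreal (unit_ball_vol (card I) * (d / 2) ^ card I)"
    using emeasure_cball_aux[OF fin, of "d / 2"] d by simp
  finally show ?thesis using A'(2) by simp
qed

lemma isodiametric:
  fixes A :: "'a::euclidean_space set"
  assumes A: "A \<in> sets borel" and bd: "bounded A"
  shows "emeasure lborel A \<le> ennreal (unit_ball_vol DIM('a) * (diameter A / 2) ^ DIM('a))"
\<comment> \<open>A set of at most one point is treated apart, since \<open>isodiametric_PiM\<close>
  is stated for positive d.\<close>
proof (cases "diameter A = 0")
  case True
  then have "x = y" if "x \<in> A" "y \<in> A" for x y
    using diameter_bounded_bound[OF bd that] by simp
  then have "A = {} \<or> (\<exists>x. A = {x})" by blast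
  then show ?thesis by auto
next
  case False
  let ?f = "\<lambda>f::'a \<Rightarrow> real. \<Sum>b\<in>Basis. f b *\<^sub>R b"
  let ?M = "Pi\<^sub>M Basis (\<lambda>_. lborel) :: ('a \<Rightarrow> real) measure"
  have meas: "?f \<in> ?M \<rightarrow>\<^sub>M borel"
    by (intro borel_measurable_sum borel_measurable_scaleR)
       (use measurable_component_singleton[of _ Basis "\<lambda>_. lborel :: real measure"] in auto)
  have "emeasure lborel A = emeasure ?M (?f -` A \<inter> space ?M)"
    unfolding lborel_eq[where 'a='a] using A meas by (subst emeasure_distr) auto
  also have "\<dots> \<le> ennreal (unit_ball_vol (card (Basis :: 'a set)) * (diameter A / 2) ^ card (Basis :: 'a set))"
  proof (rule isodiametric_PiM)
    show "?f -` A \<inter> space ?M \<in> sets ?M" using meas A by (rule measurable_sets)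
    show "diameter A > 0" using False diameter_ge_0[OF bd] by simp
    fix x y assume "x \<in> ?f -` A \<inter> space ?M" "y \<in> ?f -` A \<inter> space ?M"
    then have "dist (?f x) (?f y) \<le> diameter A" by (intro diameter_bounded_bound bd) auto
    moreover have "dist (?f x) (?f y) = sqrt (\<Sum>b\<in>Basis. (x b - y b)\<^sup>2)"
      by (simp add: euclidean_dist_l2[of "?f x"] L2_set_def dist_real_def)
    ultimately have "(sqrt (\<Sum>b\<in>Basis. (x b - y b)\<^sup>2))\<^sup>2 \<le> (diameter A)\<^sup>2"
      by (intro power_mono) (auto intro: sum_nonneg)
    then show "(\<Sum>b\<in>Basis. (x b - y b)\<^sup>2) \<le> (diameter A)\<^sup>2" by (simp add: sum_nonneg)
  qed simp
  finally show ?thesis .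
qed

section \<open>Hausdorff and Lebesgue measure in full dimension\<close>

lemma hausdorff_pre_Un:
  "hausdorff_pre s \<delta> (A \<union> B) \<le> hausdorff_pre s \<delta> A + hausdorff_pre s \<delta> B" if "\<delta> \<ge> 0"
proof -
  have "hausdorff_pre s \<delta> (\<Union>k. binaryset A B k) \<le> (\<Sum>k. hausdorff_pre s \<delta> (binaryset A B k))"
    by (rule hausdorff_pre_Union)
  also have "\<dots> = hausdorff_pre s \<delta> A + hausdorff_pre s \<delta> B"
    by (rule suminf_binaryset_eq) (simp add: hausdorff_pre_empty that)
  finally show ?thesis by (simp add: UN_binaryset_eq)
qed

text \<open>Vitali's theorems deliver families over abstract countable index sets, whereas
  \<open>fine_cover\<close> speaks of sequences. Positions that are not hit receive the empty set,
  which costs nothing.\<close>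

lemma hausdorff_pre_le_countable:
  assumes "countable K" "A \<subseteq> (\<Union>i\<in>K. X i)" "\<delta> \<ge> 0"
    and X: "\<And>i. i \<in> K \<Longrightarrow> bounded (X i)" "\<And>i. i \<in> K \<Longrightarrow> diameter (X i) \<le> \<delta>"
  shows "hausdorff_pre s \<delta> A \<le> (\<integral>\<^sup>+i. hausdorff_cost s (X i) \<partial>count_space K)"
proof -
  let ?e = "to_nat_on K"
  define D where "D = (\<lambda>n. if n \<in> ?e ` K then X (from_nat_into K n) else {})"
  have DX: "D (?e i) = X i" if "i \<in> K" for i
    using that \<open>countable K\<close> by (auto simp: D_def)
  have "fine_cover \<delta> A D"
    unfolding fine_cover_def
  proof (intro conjI allI)
    show "A \<subseteq> (\<Union>n. D n)" using assms(2) DX by blast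
    show "bounded (D n)" "diameter (D n) \<le> \<delta>" for n
      using X \<open>\<delta> \<ge> 0\<close> \<open>countable K\<close> by (auto simp: D_def)
  qed
  then have "hausdorff_pre s \<delta> A \<le> (\<Sum>n. hausdorff_cost s (D n))" by (rule hausdorff_pre_le)
  also have "\<dots> = (\<integral>\<^sup>+n. hausdorff_cost s (D n) \<partial>count_space UNIV)"
    by (rule nn_integral_count_space_nat[symmetric])
  also have "\<dots> = (\<integral>\<^sup>+n. hausdorff_cost s (D n) \<partial>count_space (?e ` K))"
    by (subst nn_integral_count_space_indicator[of "?e ` K"])
       (auto intro!: nn_integral_cong simp: D_def split: split_indicator)
  also have "\<dots> = (\<integral>\<^sup>+i. hausdorff_cost s (D (?e i)) \<partial>count_space K)"
    using \<open>countable K\<close>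
    by (intro nn_integral_bij_count_space[symmetric] inj_on_imp_bij_betw inj_on_to_nat_on)
  also have "\<dots> = (\<integral>\<^sup>+i. hausdorff_cost s (X i) \<partial>count_space K)"
    by (intro nn_integral_cong) (simp add: DX)
  finally show ?thesis .
qed

text \<open>The point where the normalising constant matters: covering by a ball costs exactly its
  volume.\<close>

lemma hausdorff_cost_ball:
  fixes a :: "'a::euclidean_space"
  assumes "r > 0"
  shows "hausdorff_cost DIM('a) (ball a r) = emeasure lborel (ball a r)"
  using assms by (simp add: hausdorff_cost_eq emeasure_ball powr_realpow)

lemma emeasure_disjoint_balls:
  assumes "countable C" "pairwise (\<lambda>i j. disjnt (ball (a i) (r i)) (ball (a j) (r j))) C"
  shows "(\<integral>\<^sup>+i. emeasure lborel (ball (a i) (r i)) \<partial>count_space C)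
      = emeasure lborel (\<Union>i\<in>C. ball (a i) (r i))"
  using assms by (intro emeasure_UN_countable[symmetric])
    (auto simp: disjoint_family_on_def pairwise_def disjnt_def)

text \<open>By Vitali's covering lemma, disjoint balls inside an open set of measure at most e have
  fivefold enlargements that cover Z, at a cost of at most 5^n e.\<close>

lemma hausdorff_pre_negligible:
  fixes Z :: "'a::euclidean_space set"
  assumes Z: "negligible Z" and \<delta>: "\<delta> > 0"
  shows "hausdorff_pre DIM('a) \<delta> Z = 0"
proof -
  let ?n = "DIM('a)"
  have "hausdorff_pre ?n \<delta> Z \<le> ennreal (5 ^ ?n) * ennreal e" if e: "e > 0" for e
  proof -
    have "Z \<in> null_sets lebesgue" using Z by (simp add: negligible_iff_null_sets)
    then obtain G where G: "open G" "Z \<subseteq> G" "emeasure lebesgue (G - Z) < ennreal e"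
      using sets_lebesgue_outer_open[OF _ e] by (metis null_setsD2)
    then have "emeasure lebesgue G \<le> ennreal e"
      using \<open>Z \<in> null_sets lebesgue\<close> by (simp add: emeasure_Diff_null_set less_imp_le)
    then have Ge: "emeasure lborel G \<le> ennreal e" using G(1) by simp
    \<comment> \<open>The fivefold enlarged ball has diameter 10 r, which must not exceed
      \<delta>.\<close>
    define K where "K = {(x, r). 0 < r \<and> 10 * r \<le> \<delta> \<and> ball x r \<subseteq> G}"
    have cov: "Z \<subseteq> (\<Union>i\<in>K. ball (fst i) (snd i))"
    proof
      fix x assume "x \<in> Z"
      then obtain r where "r > 0" "ball x r \<subseteq> G" using G(1,2) open_contains_ball by blast
      then have "(x, min r (\<delta> / 10)) \<in> K" using \<delta> unfolding K_def by auto
      then show "x \<in> (\<Union>i\<in>K. ball (fst i) (snd i))"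
        by (rule UN_I) (use \<open>r > 0\<close> \<delta> in simp)
    qed
    have bnd: "0 < snd i \<and> snd i \<le> \<delta>" if "i \<in> K" for i using that by (auto simp: K_def)
    obtain C where C: "countable C" "C \<subseteq> K"
      "pairwise (\<lambda>i j. disjnt (ball (fst i) (snd i)) (ball (fst j) (snd j))) C"
      "Z \<subseteq> (\<Union>i\<in>C. ball (fst i) (5 * snd i))"
      by (rule Vitali_covering_lemma_balls[OF cov bnd])
    have K: "snd i > 0" "10 * snd i \<le> \<delta>" "ball (fst i) (snd i) \<subseteq> G" if "i \<in> C" for i
      using subsetD[OF C(2) that] by (simp_all add: K_def case_prod_beta)
    have "hausdorff_pre ?n \<delta> Z \<le> (\<integral>\<^sup>+i. hausdorff_cost ?n (ball (fst i) (5 * snd i)) \<partial>count_space C)"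
      using C(1,4) \<delta> K by (intro hausdorff_pre_le_countable) (auto intro: less_imp_le)
    also have "\<dots> = (\<integral>\<^sup>+i. ennreal (5 ^ ?n) * emeasure lborel (ball (fst i) (snd i)) \<partial>count_space C)"
      using K by (intro nn_integral_cong)
        (simp add: hausdorff_cost_ball emeasure_ball power_mult_distrib ennreal_mult'[symmetric] less_imp_le mult.left_commute)
    also have "\<dots> = ennreal (5 ^ ?n) * emeasure lborel (\<Union>i\<in>C. ball (fst i) (snd i))"
      using emeasure_disjoint_balls[OF C(1,3)] by (simp add: nn_integral_cmult)
    also have "\<dots> \<le> ennreal (5 ^ ?n) * emeasure lborel G"
      using UN_least[OF K(3)] G(1) by (intro mult_left_mono emeasure_mono) simp_all
    also have "\<dots> \<le> ennreal (5 ^ ?n) * ennreal e" by (intro mult_left_mono Ge) auto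
    finally show ?thesis .
  qed
  then have "hausdorff_pre ?n \<delta> Z \<le> 0 + ennreal e" if "e > 0" for e
    using that[THEN divide_pos_pos, of "5 ^ ?n"] by (fastforce simp: ennreal_mult'[symmetric])
  then have "hausdorff_pre ?n \<delta> Z \<le> 0" by (rule ennreal_le_epsilon)
  then show ?thesis by simp
qed

text \<open>Vitali's covering theorem fills U, up to a null set, with disjoint small balls, each of
  which costs its volume; the null set costs nothing by
  \<open>hausdorff_pre_negligible\<close>.\<close>

lemma hausdorff_pre_open_le:
  fixes U :: "'a::euclidean_space set"
  assumes U: "open U" and \<delta>: "\<delta> > 0"
  shows "hausdorff_pre DIM('a) \<delta> U \<le> emeasure lborel U"
proof -
  let ?n = "DIM('a)"
  define K where "K = {(x, r). 0 < r \<and> 2 * r \<le> \<delta> \<and> ball x r \<subseteq> U}"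
  have fine: "\<exists>i. i \<in> K \<and> x \<in> ball (fst i) (snd i) \<and> snd i < d" if "x \<in> U" "d > 0" for x d
  proof -
    obtain r where "r > 0" "ball x r \<subseteq> U" using U \<open>x \<in> U\<close> open_contains_ball by blast
    then have "(x, Min {r, \<delta> / 2, d / 2}) \<in> K" using \<delta> \<open>d > 0\<close> unfolding K_def by auto
    then show ?thesis
      using \<open>r > 0\<close> \<open>d > 0\<close> \<delta> by (intro exI[of _ "(x, Min {r, \<delta> / 2, d / 2})"]) auto
  qed
  obtain C where C: "countable C" "C \<subseteq> K"
      "pairwise (\<lambda>i j. disjnt (ball (fst i) (snd i)) (ball (fst j) (snd j))) C"
      "negligible (U - (\<Union>i\<in>C. ball (fst i) (snd i)))"
    by (rule Vitali_covering_theorem_balls[of U K fst snd, OF fine])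
  let ?V = "\<Union>i\<in>C. ball (fst i) (snd i)"
  have K: "snd i > 0" "2 * snd i \<le> \<delta>" "ball (fst i) (snd i) \<subseteq> U" if "i \<in> C" for i
    using subsetD[OF C(2) that] by (simp_all add: K_def case_prod_beta)
  have "hausdorff_pre ?n \<delta> U \<le> hausdorff_pre ?n \<delta> (?V \<union> (U - ?V))"
    by (rule hausdorff_pre_mono) auto
  also have "\<dots> \<le> hausdorff_pre ?n \<delta> ?V + hausdorff_pre ?n \<delta> (U - ?V)"
    using \<delta> by (intro hausdorff_pre_Un) auto
  also have "hausdorff_pre ?n \<delta> (U - ?V) = 0" using C(4) \<delta> by (rule hausdorff_pre_negligible)
  also have "hausdorff_pre ?n \<delta> ?V \<le> (\<integral>\<^sup>+i. hausdorff_cost ?n (ball (fst i) (snd i)) \<partial>count_space C)"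
    using C(1) \<delta> K by (intro hausdorff_pre_le_countable) (auto intro: less_imp_le)
  also have "\<dots> = (\<integral>\<^sup>+i. emeasure lborel (ball (fst i) (snd i)) \<partial>count_space C)"
    using K by (intro nn_integral_cong) (simp add: hausdorff_cost_ball)
  also have "\<dots> = emeasure lborel ?V" by (rule emeasure_disjoint_balls[OF C(1,3)])
  also have "\<dots> \<le> emeasure lborel U" using UN_least[OF K(3)] U by (intro emeasure_mono) simp_all
  finally show ?thesis by (simp add: add_right_mono)
qed

text \<open>The upper bound is Vitali's theorem with outer regularity, the lower bound is the
  isodiametric inequality applied to each set of a cover.\<close>

lemma hausdorff_outer_eq_lborel:
  fixes A :: "'a::euclidean_space set"
  assumes A: "A \<in> sets borel"
  shows "hausdorff_outer DIM('a) A = emeasure lborel A"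
proof (rule antisym)
  show "hausdorff_outer DIM('a) A \<le> emeasure lborel A"
  proof (rule hausdorff_outer_least, rule ennreal_le_epsilon)
    fix \<delta> e :: real assume \<delta>: "\<delta> > 0" and e: "e > 0"
    obtain U where U: "open U" "A \<subseteq> U" "emeasure lebesgue (U - A) < ennreal e"
      by (rule sets_lebesgue_outer_open[OF _ e, of A]) (use A in \<open>simp add: sets_completionI_sets\<close>)
    have "hausdorff_pre DIM('a) \<delta> A \<le> hausdorff_pre DIM('a) \<delta> U"
      using U(2) by (rule hausdorff_pre_mono)
    also have "\<dots> \<le> emeasure lborel U" using U(1) \<delta> by (rule hausdorff_pre_open_le)
    also have "\<dots> = emeasure lborel (A \<union> (U - A))" using U(2) by (simp add: Un_absorb1)
    also have "\<dots> = emeasure lborel A + emeasure lborel (U - A)"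
      using A U(1) by (intro plus_emeasure[symmetric]) auto
    also have "\<dots> \<le> emeasure lborel A + ennreal e"
      using U A by (intro add_left_mono) (simp add: emeasure_completion less_imp_le)
    finally show "hausdorff_pre DIM('a) \<delta> A \<le> emeasure lborel A + ennreal e" .
  qed
  have "emeasure lborel A \<le> hausdorff_pre DIM('a) 1 A"
  proof (rule le_hausdorff_pre)
    fix C assume C: "fine_cover 1 A C"
    have "A \<subseteq> (\<Union>i. C i)" using C by (simp add: fine_cover_def)
    \<comment> \<open>Covering sets are arbitrary; their closures are Borel and have the same
      diameter.\<close>
    also have "\<dots> \<subseteq> (\<Union>i. closure (C i))" using closure_subset by blast
    finally have "emeasure lborel A \<le> emeasure lborel (\<Union>i. closure (C i))"
      by (intro emeasure_mono) auto
    also have "\<dots> \<le> (\<Sum>i. emeasure lborel (closure (C i)))"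
      by (intro emeasure_subadditive_countably) auto
    also have "\<dots> \<le> (\<Sum>i. hausdorff_cost DIM('a) (C i))"
    proof (intro suminf_le)
      fix i
      have bd: "bounded (C i)" using C by (simp add: fine_cover_def)
      have "emeasure lborel (closure (C i))
          \<le> ennreal (unit_ball_vol DIM('a) * (diameter (closure (C i)) / 2) ^ DIM('a))"
        using bd by (intro isodiametric) auto
      also have "\<dots> = hausdorff_cost DIM('a) (C i)"
        using bd diameter_ge_0[OF bd]
        by (cases "diameter (C i) = 0") (auto simp: diameter_closure hausdorff_cost_eq powr_realpow)
      finally show "emeasure lborel (closure (C i)) \<le> hausdorff_cost DIM('a) (C i)" .
    qed auto
    finally show "emeasure lborel A \<le> (\<Sum>i. hausdorff_cost DIM('a) (C i))" .
  qed
  also have "\<dots> \<le> hausdorff_outer DIM('a) A" by (rule hausdorff_pre_le_outer) simp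
  finally show "emeasure lborel A \<le> hausdorff_outer DIM('a) A" .
qed

text \<open>Hausdorff measure depends on the metric only, so isometries preserve it and hence
  Lebesgue measure. This avoids determinants and allows different types for source and target, here
  a product with \<open>real\<close> and a space of vectors.\<close>

lemma distr_lborel_isometry:
  fixes T :: "'a::euclidean_space \<Rightarrow> 'b::euclidean_space"
  assumes dim: "DIM('a) = DIM('b)" and iso: "\<And>x y. dist (T x) (T y) = dist x y" and surj: "surj T"
  shows "distr lborel borel T = lborel"
proof (rule measure_eqI)
  fix A :: "'b set" assume "A \<in> sets (distr lborel borel T)"
  then have A: "A \<in> sets borel" by simp
  have "continuous_on UNIV T"
    unfolding continuous_on_iff using iso by auto
  then have T: "T \<in> borel_measurable borel" by (rule borel_measurable_continuous_onI)
  have B: "T -` A \<in> sets borel" using measurable_sets[OF T A] by simp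
  have TA: "T ` (T -` A) = A" using surj by (rule surj_image_vimage_eq)
  have inj: "inj T" using iso by (metis injI dist_eq_0_iff)
  have "hausdorff_outer DIM('b) (T ` (T -` A)) \<le> ennreal (1 powr DIM('b)) * hausdorff_outer DIM('b) (T -` A)"
    by (intro hausdorff_outer_lipschitz) (auto simp: iso)
  moreover have "hausdorff_outer DIM('b) (inv T ` A) \<le> ennreal (1 powr DIM('b)) * hausdorff_outer DIM('b) A"
  proof (intro hausdorff_outer_lipschitz)
    show "dist (inv T x) (inv T y) \<le> 1 * dist x y" for x y
      using iso[of "inv T x" "inv T y"] surj by (simp add: surj_f_inv_f)
  qed auto
  moreover have "inv T ` A = T -` A" using surj inj TA by (metis image_inv_f_f)
  ultimately have "hausdorff_outer DIM('b) A = hausdorff_outer DIM('a) (T -` A)"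
    using TA dim by auto
  then have "emeasure lborel A = emeasure lborel (T -` A)"
    using hausdorff_outer_eq_lborel[OF A] hausdorff_outer_eq_lborel[OF B] by simp
  then show "emeasure (distr lborel borel T) A = emeasure lborel A"
    using A T by (simp add: emeasure_distr)
qed simp

text \<open>An index type with one element less than the finite type \<open>'n\<close>
  (the degenerate case of a one-element type is excluded where it is used).\<close>
typedef (overloaded) ('n::finite) drop_one = "{i::'n. i \<noteq> (SOME j. True) \<or> CARD('n) = 1}"
  morphisms drop_one_rep drop_one_abs
proof -
  have "\<exists>i::'n. i \<noteq> (SOME j. True)" if "CARD('n) \<noteq> 1"
  proof (rule ccontr)
    assume "\<nexists>i::'n. i \<noteq> (SOME j. True)"
    then have "(UNIV :: 'n set) = {SOME j. True}" by blast
    then show False using that by (metis card_1_singleton_iff One_nat_def)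
  qed
  then show ?thesis by auto
qed

instance drop_one :: (finite) finite
proof
  have "(UNIV :: 'a drop_one set) = drop_one_abs ` {i. i \<noteq> (SOME j. True) \<or> CARD('a) = 1}"
    by (rule type_definition.Abs_image[OF type_definition_drop_one, symmetric])
  then show "finite (UNIV :: 'a drop_one set)" by (metis finite finite_imageI)
qed

lemma CARD_drop_one:
  assumes "CARD('n::finite) \<noteq> 1"
  shows "CARD('n drop_one) + 1 = CARD('n)"
proof -
  have "CARD('n drop_one) = card {i::'n. i \<noteq> (SOME j. True) \<or> CARD('n) = 1}"
    by (rule type_definition.card[OF type_definition_drop_one])
  also have "{i::'n. i \<noteq> (SOME j. True) \<or> CARD('n) = 1} = UNIV - {SOME j. True}"
    using assms by auto
  also have "card \<dots> = CARD('n) - 1" by (simp add: card_Diff_singleton)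
  finally show ?thesis by simp
qed

section \<open>Graphs over hyperplanes\<close>

text \<open>The Householder reflection in the hyperplane orthogonal to w = a - b. Equal norms give
  2<a,w> = <w,w>, hence a is moved by exactly w.\<close>

lemma exists_reflection:
  fixes a b :: "'a::euclidean_space"
  assumes "norm a = norm b"
  shows "\<exists>Q. linear Q \<and> (\<forall>x. norm (Q x) = norm x) \<and> surj Q \<and> Q a = b"
proof (cases "a = b")
  case True
  then show ?thesis by (intro exI[of _ id]) (auto simp: linear_id[unfolded id_def] id_def)
next
  case False
  define w where "w = a - b"
  have w: "w \<bullet> w \<noteq> 0" using False by (simp add: w_def)
  define Q where "Q = (\<lambda>x. x - (2 * (x \<bullet> w) / (w \<bullet> w)) *\<^sub>R w)"
  have lin: "linear Q"
    unfolding Q_def by (rule linearI) (simp_all add: inner_add_left scaleR_add_left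
        scaleR_diff_right add_divide_distrib distrib_left)
  have "Q x \<bullet> Q x = x \<bullet> x" for x
    using w by (simp add: Q_def inner_diff_left inner_diff_right inner_commute field_simps power2_eq_square)
  then have norm: "norm (Q x) = norm x" for x by (simp add: norm_eq_sqrt_inner)
  then have "inj Q" using lin by (metis linear_injective_0 norm_eq_zero norm_zero)
  then have "surj Q" using lin linear_injective_imp_surjective by blast
  have "a \<bullet> a = b \<bullet> b" using assms by (simp add: norm_eq_sqrt_inner)
  then have "2 * (a \<bullet> w) = w \<bullet> w" by (simp add: w_def inner_diff_left inner_diff_right inner_commute)
  then have "Q a = b" using w by (simp add: Q_def) (simp add: w_def)
  then show ?thesis using lin norm \<open>surj Q\<close> by blast
qed

text \<open>Any linear isometry between the two spaces, followed by a reflection that turns the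
  image of the last axis into v.\<close>

lemma exists_coordinates:
  fixes v :: "'a::euclidean_space"
  assumes dim: "DIM('m::euclidean_space) + 1 = DIM('a)" and v: "norm v = 1"
  shows "\<exists>T :: 'm \<times> real \<Rightarrow> 'a. linear T \<and> (\<forall>z. norm (T z) = norm z) \<and> surj T \<and> T (0, 1) = v"
proof -
  obtain S :: "'m \<times> real \<Rightarrow> 'a" where S: "linear S" "S ` UNIV = UNIV" "\<And>x. x \<in> UNIV \<Longrightarrow> norm (S x) = norm x"
    by (rule isometry_subspaces[of "UNIV :: ('m \<times> real) set" "UNIV :: 'a set"]) (use dim in auto)
  have "norm (S (0, 1)) = norm v" using S(3)[of "(0, 1)"] v by (simp add: norm_Pair)
  then obtain Q where "linear Q" "\<forall>x. norm (Q x) = norm x" "surj Q" "Q (S (0, 1)) = v"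
    using exists_reflection by blast
  then show ?thesis using S comp_surj[of S Q]
    by (intro exI[of _ "Q \<circ> S"]) (simp add: linear_compose)
qed

lemma lipschitz_lborel_le_hausdorff:
  fixes f :: "'a::euclidean_space \<Rightarrow> 'm::euclidean_space"
  assumes "f ` A \<in> sets borel" and lip: "\<And>x y. x \<in> A \<Longrightarrow> y \<in> A \<Longrightarrow> dist (f x) (f y) \<le> dist x y"
  shows "emeasure lborel (f ` A) \<le> hausdorff_outer DIM('m) A"
  using hausdorff_outer_lipschitz[of "DIM('m)" 1 A f] assms
  by (simp add: hausdorff_outer_eq_lborel)

lemma nn_integral_bilipschitz_image:
  fixes pr :: "'a::euclidean_space \<Rightarrow> 'm::euclidean_space" and F :: "'a \<Rightarrow> ennreal"
  assumes K: "compact K" and c: "c > 0"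
    and up: "\<And>x y. x \<in> K \<Longrightarrow> y \<in> K \<Longrightarrow> dist (pr x) (pr y) \<le> dist x y"
    and low: "\<And>x y. x \<in> K \<Longrightarrow> y \<in> K \<Longrightarrow> c * dist x y \<le> dist (pr x) (pr y)"
    and F: "F \<in> borel_measurable borel"
  defines "g \<equiv> inv_into K pr" and "H \<equiv> hausdorff_measure DIM('m)"
  shows "compact (pr ` K)" "continuous_on (pr ` K) g" "inj_on pr K"
    and "(\<integral>\<^sup>+y. F (g y) * indicator (pr ` K) y \<partial>lborel) \<le> (\<integral>\<^sup>+x. F x * indicator K x \<partial>H)"
    and "(\<integral>\<^sup>+x. F x * indicator K x \<partial>H)
        \<le> ennreal ((1 / c) powr DIM('m)) * (\<integral>\<^sup>+y. F (g y) * indicator (pr ` K) y \<partial>lborel)"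
proof -
  show inj: "inj_on pr K"
    using low c by (intro inj_onI) (metis dist_eq_0_iff dist_le_zero_iff mult_le_0_iff not_le)
  have g: "g (pr x) = x" if "x \<in> K" for x using inj that by (simp add: g_def)
  have cont: "continuous_on K pr"
    unfolding continuous_on_iff using up by (meson order_le_less_trans)
  show cK: "compact (pr ` K)" using cont K by (rule compact_continuous_image)
  show cg: "continuous_on (pr ` K) g" by (rule continuous_on_inv[OF cont K]) (simp add: g)
  have [measurable]: "pr ` K \<in> sets borel" "K \<in> sets borel" using cK K by (auto intro: borel_compact)
  have gm: "g \<in> restrict_space lborel (pr ` K) \<rightarrow>\<^sub>M borel"
    using borel_measurable_continuous_on_restrict[OF cg]
    by (simp cong: measurable_cong_sets sets_restrict_space_cong)
  have gX: "g -` X \<inter> pr ` K = pr ` (X \<inter> K)" for X using g by auto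
  have prX: "pr ` (X \<inter> K) \<in> sets borel" if "X \<in> sets borel" for X
    using measurable_sets[OF gm that] by (simp add: space_restrict_space gX sets_restrict_space_iff)
  let ?\<mu> = "distr (restrict_space lborel (pr ` K)) borel g"
  let ?\<nu> = "density H (indicator K)"
  have e\<mu>: "emeasure ?\<mu> X = emeasure lborel (pr ` (X \<inter> K))" if X: "X \<in> sets borel" for X
    using X gm by (simp add: emeasure_distr space_restrict_space gX emeasure_restrict_space image_mono)
  have e\<nu>: "emeasure ?\<nu> X = hausdorff_outer DIM('m) (X \<inter> K)" if X: "X \<in> sets borel" for X
    using X by (simp add: emeasure_restricted H_def emeasure_hausdorff_measure Int_commute)
  have i\<mu>: "(\<integral>\<^sup>+x. F x \<partial>?\<mu>) = (\<integral>\<^sup>+y. F (g y) * indicator (pr ` K) y \<partial>lborel)"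
    using gm F by (simp add: nn_integral_distr nn_integral_restrict_space)
  have i\<nu>: "(\<integral>\<^sup>+x. F x \<partial>?\<nu>) = (\<integral>\<^sup>+x. F x * indicator K x \<partial>H)"
    using F by (subst nn_integral_density) (auto simp: H_def mult.commute cong: measurable_cong_sets)
  have "?\<mu> \<le> ?\<nu>"
    using prX up by (subst le_measure) (auto simp: H_def e\<mu> e\<nu>[unfolded H_def] intro!: lipschitz_lborel_le_hausdorff)
  then show "(\<integral>\<^sup>+y. F (g y) * indicator (pr ` K) y \<partial>lborel) \<le> (\<integral>\<^sup>+x. F x * indicator K x \<partial>H)"
    unfolding i\<mu>[symmetric] i\<nu>[symmetric] by (intro nn_integral_mono_measure) (auto simp: H_def)
  have "hausdorff_outer DIM('m) (X \<inter> K) \<le> ennreal ((1 / c) powr DIM('m)) * emeasure lborel (pr ` (X \<inter> K))"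
    if X: "X \<in> sets borel" for X
  proof -
    have "hausdorff_outer DIM('m) (g ` pr ` (X \<inter> K))
        \<le> ennreal ((1 / c) powr DIM('m)) * hausdorff_outer DIM('m) (pr ` (X \<inter> K))"
      using c low by (intro hausdorff_outer_lipschitz) (auto simp: g field_simps)
    moreover have "g ` pr ` (X \<inter> K) = X \<inter> K" using g by force
    ultimately show ?thesis using hausdorff_outer_eq_lborel[OF prX[OF X]] by simp
  qed
  then have "?\<nu> \<le> scale_measure (ennreal ((1 / c) powr DIM('m))) ?\<mu>"
    by (subst le_measure) (auto simp: H_def e\<mu> e\<nu>[unfolded H_def])
  then have "(\<integral>\<^sup>+x. F x \<partial>?\<nu>) \<le> (\<integral>\<^sup>+x. F x \<partial>scale_measure (ennreal ((1 / c) powr DIM('m))) ?\<mu>)"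
    by (intro nn_integral_mono_measure) (auto simp: H_def)
  also have "\<dots> = ennreal ((1 / c) powr DIM('m)) * (\<integral>\<^sup>+x. F x \<partial>?\<mu>)"
    using F by (intro nn_integral_scale_measure) simp
  finally show "(\<integral>\<^sup>+x. F x * indicator K x \<partial>H)
        \<le> ennreal ((1 / c) powr DIM('m)) * (\<integral>\<^sup>+y. F (g y) * indicator (pr ` K) y \<partial>lborel)"
    unfolding i\<mu> i\<nu> .
qed

section \<open>Line charts and the flux through a graph\<close>

text \<open>Derivatives are plain functions of point and direction, continuous for each direction
  separately; in finite dimension this is continuity of the Jacobian. On the frontier
  \<open>f' x\<close> is linear and tied to f only as a continuous extension from the
  inside.\<close>

definition C1_closure ::
  "'a::euclidean_space set \<Rightarrow> ('a \<Rightarrow> 'b::real_normed_vector) \<Rightarrow> ('a \<Rightarrow> 'a \<Rightarrow> 'b) \<Rightarrow> bool" where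
  "C1_closure \<Omega> f f' \<longleftrightarrow> continuous_on (closure \<Omega>) f
     \<and> (\<forall>v. continuous_on (closure \<Omega>) (\<lambda>x. f' x v))
     \<and> (\<forall>x\<in>closure \<Omega>. linear (f' x)) \<and> (\<forall>x\<in>\<Omega>. (f has_derivative f' x) (at x))"

text \<open>Near \<open>p\<close> the set \<open>\<Omega>\<close> lies below a Lipschitz graph over the hyperplane orthogonal to \<open>v\<close>.\<close>
definition cone_at :: "'a::euclidean_space set \<Rightarrow> 'a \<Rightarrow> real \<Rightarrow> 'a \<Rightarrow> real \<Rightarrow> bool" where
  "cone_at \<Omega> p r v \<epsilon> \<longleftrightarrow>
     (\<forall>x\<in>closure \<Omega> \<inter> ball p r. \<forall>y\<in>ball p r. \<epsilon> * norm (x - y) < (x - y) \<bullet> v \<longrightarrow> y \<in> \<Omega>)"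

lemma cone_atD:
  "cone_at \<Omega> p r v \<epsilon> \<Longrightarrow> x \<in> closure \<Omega> \<Longrightarrow> x \<in> ball p r \<Longrightarrow> y \<in> ball p r
    \<Longrightarrow> \<epsilon> * norm (x - y) < (x - y) \<bullet> v \<Longrightarrow> y \<in> \<Omega>"
  unfolding cone_at_def by blast

text \<open>T is an isometric coordinate system whose last axis is v. Functions will be supported in
  the ball of radius r', while the cone condition is available in the larger ball of radius
  r.\<close>

locale line_chart =
  fixes \<Omega> :: "'a::euclidean_space set" and T :: "'m::euclidean_space \<times> real \<Rightarrow> 'a"
    and p :: 'a and r r' \<epsilon> :: real and v :: 'a
  assumes op: "open \<Omega>" and bd: "bounded \<Omega>"
    and lin: "linear T" and normT: "\<And>z. norm (T z) = norm z" and surjT: "surj T" and v: "v = T (0, 1)"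
    and dim: "DIM('m) + 1 = DIM('a)"
    and cone: "cone_at \<Omega> p r v \<epsilon>" and \<epsilon>: "0 \<le> \<epsilon>" "\<epsilon> < 1" and r: "r' < r"
begin

definition K where "K = frontier \<Omega> \<inter> cball p r'"
definition pr :: "'a \<Rightarrow> 'm" where "pr x = fst (inv T x)"
definition g :: "'m \<Rightarrow> 'a" where "g = inv_into K pr"

lemma compact_K: "compact K"
  unfolding K_def by (intro closed_Int_compact) auto

lemma norm_v: "norm v = 1"
  by (simp add: v normT norm_Pair)

lemma T_line: "T (y, t) = T (y, 0) + t *\<^sub>R v"
proof -
  have "(y, t) = (y, 0) + t *\<^sub>R (0, 1)" by simp
  then show ?thesis unfolding v by (metis lin linear_add linear_scale)
qed

lemma inner_T: "T z \<bullet> T w = z \<bullet> w"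
  unfolding dot_norm linear_add[OF lin, symmetric] normT ..

lemma T_pr: "T (pr x, x \<bullet> v) = x"
proof -
  have *: "T (inv T x) = x" by (rule surj_f_inv_f[OF surjT])
  then have "x \<bullet> v = inv T x \<bullet> (0, 1)" unfolding v using inner_T by metis
  then have "(pr x, x \<bullet> v) = inv T x" by (simp add: pr_def prod_eq_iff inner_prod_def)
  then show ?thesis using * by simp
qed

lemma pr_T: "pr (T (y, t)) = y" "T (y, t) \<bullet> v = t"
proof -
  show *: "T (y, t) \<bullet> v = t" by (simp add: v inner_T inner_prod_def)
  have "T (pr (T (y, t)), t) = T (y, t)" using T_pr[of "T (y, t)"] * by simp
  then have "norm (T ((pr (T (y, t)), t) - (y, t))) = 0" by (simp only: linear_diff[OF lin]) simp
  then show "pr (T (y, t)) = y" by (simp add: normT norm_Pair)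
qed

lemma pythagoras: "(norm (x - y))\<^sup>2 = (norm (pr x - pr y))\<^sup>2 + ((x - y) \<bullet> v)\<^sup>2"
proof -
  have "x - y = T (pr x - pr y, (x - y) \<bullet> v)"
    using T_pr[of x] T_pr[of y] linear_diff[OF lin, of "(pr x, x \<bullet> v)" "(pr y, y \<bullet> v)"]
    by (simp add: inner_diff_left)
  then have "norm (x - y) = norm (pr x - pr y, (x - y) \<bullet> v)" using normT by metis
  then show ?thesis by (simp add: norm_Pair)
qed

text \<open>If the segment between two frontier points were steeper than the cone, its lower end
  would lie in the open set \<Omega> and not on the frontier.\<close>

lemma frontier_cone:
  assumes "x \<in> frontier \<Omega>" "y \<in> frontier \<Omega>" "x \<in> ball p r" "y \<in> ball p r"
  shows "\<bar>(x - y) \<bullet> v\<bar> \<le> \<epsilon> * norm (x - y)"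
proof -
  have *: "(x - y) \<bullet> v \<le> \<epsilon> * norm (x - y)"
    if "x \<in> frontier \<Omega>" "y \<in> frontier \<Omega>" "x \<in> ball p r" "y \<in> ball p r" for x y
    using cone_atD[OF cone, of x y] that op by (force simp: frontier_def interior_open)
  show ?thesis using *[of x y] *[of y x] assms
    by (simp add: norm_minus_commute inner_diff_left abs_le_iff)
qed

lemma K_ball: "x \<in> K \<Longrightarrow> x \<in> ball p r" "x \<in> K \<Longrightarrow> x \<in> frontier \<Omega>"
  using r by (auto simp: K_def)

text \<open>Pythagoras: \<open>frontier_cone\<close> bounds the vertical part of x - y by
  \<epsilon>|x - y|, so the horizontal part keeps at least the share sqrt(1 - \<epsilon>^2).\<close>

lemma pr_bilipschitz:
  assumes "x \<in> K" "y \<in> K"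
  shows "dist (pr x) (pr y) \<le> dist x y" "sqrt (1 - \<epsilon>\<^sup>2) * dist x y \<le> dist (pr x) (pr y)"
proof -
  have "(norm (pr x - pr y))\<^sup>2 \<le> (norm (x - y))\<^sup>2"
    unfolding pythagoras[of x y] by simp
  then show "dist (pr x) (pr y) \<le> dist x y"
    unfolding dist_norm by (rule power2_le_imp_le) simp
  have "((x - y) \<bullet> v)\<^sup>2 \<le> (\<epsilon> * norm (x - y))\<^sup>2"
    using power_mono[OF frontier_cone[of x y], of 2] K_ball[OF assms(1)] K_ball[OF assms(2)] by simp
  then have "(1 - \<epsilon>\<^sup>2) * (norm (x - y))\<^sup>2 \<le> (norm (pr x - pr y))\<^sup>2"
    using pythagoras[of x y] by (simp add: algebra_simps power_mult_distrib)
  then have "(sqrt (1 - \<epsilon>\<^sup>2) * norm (x - y))\<^sup>2 \<le> (norm (pr x - pr y))\<^sup>2"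
    using \<epsilon> by (simp add: power_mult_distrib abs_square_le_1)
  then show "sqrt (1 - \<epsilon>\<^sup>2) * dist x y \<le> dist (pr x) (pr y)"
    unfolding dist_norm by (rule power2_le_imp_le) simp
qed

lemma sqrt_pos: "0 < sqrt (1 - \<epsilon>\<^sup>2)"
  using \<epsilon> by (simp add: power_less_one_iff abs_square_less_1)

lemma graph_measure:
  fixes F :: "'a \<Rightarrow> ennreal"
  assumes F: "F \<in> borel_measurable borel"
  shows "(\<integral>\<^sup>+y. F (g y) * indicator (pr ` K) y \<partial>lborel)
        \<le> (\<integral>\<^sup>+x. F x * indicator K x \<partial>hausdorff_measure DIM('m))"
    and "(\<integral>\<^sup>+x. F x * indicator K x \<partial>hausdorff_measure DIM('m))
        \<le> ennreal ((1 / sqrt (1 - \<epsilon>\<^sup>2)) powr DIM('m)) * (\<integral>\<^sup>+y. F (g y) * indicator (pr ` K) y \<partial>lborel)"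
  unfolding g_def
  by (rule nn_integral_bilipschitz_image[OF compact_K sqrt_pos pr_bilipschitz F]; assumption)+

lemma graph_chart: "compact (pr ` K)" "continuous_on (pr ` K) g" "inj_on pr K"
  unfolding g_def
  by (rule nn_integral_bilipschitz_image[OF compact_K sqrt_pos pr_bilipschitz borel_measurable_const[of 0]];
      assumption)+

lemma g_pr: "x \<in> K \<Longrightarrow> g (pr x) = x"
  using graph_chart(3) by (simp add: g_def)

end

context line_chart
begin

text \<open>The line over y meets the closed ball of radius r' in a segment. If the segment carries
  a frontier point, the cone condition puts everything below it into \<Omega> and everything above
  it outside; otherwise the segment is entirely inside or outside. As f is zero at the ends of the
  segment, the fundamental theorem leaves only the value at the frontier point.\<close>

lemma line_integral:
  fixes f :: "'a \<Rightarrow> real"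
  assumes f: "C1_closure \<Omega> f f'"
    and supp: "\<And>x. x \<in> closure \<Omega> \<Longrightarrow> x \<notin> ball p r' \<Longrightarrow> f x = 0 \<and> f' x = (\<lambda>_. 0)"
  shows "((\<lambda>t. if T (y, t) \<in> \<Omega> then f' (T (y, t)) v else 0) has_integral
           (if y \<in> pr ` K then f (g y) else 0)) UNIV"
proof -
  define c where "c = (\<lambda>t. T (y, t))"
  have c_eq: "c = (\<lambda>t. T (y, 0) + t *\<^sub>R v)" unfolding c_def by (rule ext) (rule T_line)
  have c_diff: "c s - c t = (s - t) *\<^sub>R v" for s t by (simp add: c_eq algebra_simps)
  have c_dist: "dist (c s) (c t) = \<bar>s - t\<bar>" for s t by (simp add: dist_norm c_diff norm_v)
  have c_cont: "continuous_on S c" for S unfolding c_eq by (intro continuous_intros)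
  have c_deriv: "(c has_derivative (\<lambda>h. h *\<^sub>R v)) (at t)" for t
    unfolding c_eq by (auto intro!: derivative_eq_intros)
  have vv: "v \<bullet> v = 1" using norm_v by (simp add: norm_eq_1)
  have ball: "cball p r' \<subseteq> ball p r" using r by auto
  have cl: "x \<in> closure \<Omega>" if "x \<in> \<Omega>" for x using that closure_subset by blast
  have down: "c t \<in> \<Omega>" if "c s \<in> closure \<Omega>" "c s \<in> cball p r'" "c t \<in> cball p r'" "t < s" for s t
  proof (rule cone_atD[OF cone that(1)])
    show "\<epsilon> * norm (c s - c t) < (c s - c t) \<bullet> v"
      using that(4) \<epsilon> by (simp add: c_diff norm_v vv)
  qed (use that ball in auto)
  define J where "J = {t. c t \<in> cball p r'}"
  have "convex J"
  proof (rule convexI)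
    fix s t a b :: real assume st: "s \<in> J" "t \<in> J" and ab: "0 \<le> a" "0 \<le> b" "a + b = 1"
    have "c (a *\<^sub>R s + b *\<^sub>R t) = (a + b) *\<^sub>R T (y, 0) + (a *\<^sub>R s + b *\<^sub>R t) *\<^sub>R v"
      using ab by (simp add: c_eq)
    also have "\<dots> = a *\<^sub>R c s + b *\<^sub>R c t" by (simp add: c_eq algebra_simps)
    finally show "a *\<^sub>R s + b *\<^sub>R t \<in> J"
      using convexD[OF convex_cball _ _ ab, of "c s" p r' "c t"] st by (simp add: J_def)
  qed
  moreover have "closed J"
    unfolding J_def using continuous_closed_vimage[of "cball p r'" c] c_cont[of UNIV]
    by (simp add: vimage_def continuous_on_eq_continuous_at)
  moreover have "bounded J"
  proof -
    have "\<bar>t\<bar> \<le> norm p + r'" if "t \<in> J" for t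
    proof -
      have "\<bar>t\<bar> \<le> norm (y, t)" using norm_snd_le[of t y] by simp
      also have "\<dots> = norm (c t)" by (simp add: c_def normT)
      also have "\<dots> \<le> norm p + dist p (c t)"
        by (metis dist_norm norm_minus_commute norm_triangle_sub)
      finally show ?thesis using that by (simp add: J_def)
    qed
    then show ?thesis by (auto simp: bounded_real)
  qed
  ultimately have "connected J \<and> compact J" by (simp add: convex_connected compact_eq_bounded_closed)
  then obtain \<alpha> \<beta> where J: "J = {\<alpha>..\<beta>}" using connected_compact_interval_1[of J] by auto
  \<comment> \<open>The segment is maximal, so its ends are not in the open ball, and f is zero
    there.\<close>
  have ends: "c \<alpha> \<notin> ball p r'" "c \<beta> \<notin> ball p r'" if "\<alpha> \<le> \<beta>"
  proof -
    have *: "c t \<notin> ball p r'" if "\<And>e. e > 0 \<Longrightarrow> t - e \<notin> J \<or> t + e \<notin> J" for t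
    proof
      assume t: "c t \<in> ball p r'"
      define e where "e = r' - dist p (c t)"
      have "e > 0" using t by (simp add: e_def)
      have "t + d \<in> J" if "\<bar>d\<bar> \<le> e" for d
        using dist_triangle[of p "c (t + d)" "c t"] that c_dist[of t "t + d"] by (simp add: J_def e_def)
      from this[of e] this[of "- e"] show False using \<open>e > 0\<close> that[of e] by simp
    qed
    show "c \<alpha> \<notin> ball p r'" "c \<beta> \<notin> ball p r'" by (rule *, simp add: J)+
  qed
  \<comment> \<open>The derivative of f along the line is known inside \<Omega> only; at the ends of
    the interval continuity has to suffice.\<close>
  have ftc: "((\<lambda>t. f' (c t) v) has_integral (f (c b) - f (c a))) {a..b}"
    if "a \<le> b" and C: "\<And>t. t \<in> {a..b} \<Longrightarrow> c t \<in> closure \<Omega>"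
      and I: "\<And>t. t \<in> {a<..<b} \<Longrightarrow> c t \<in> \<Omega>" for a b
  proof (rule fundamental_theorem_of_calculus_interior[OF \<open>a \<le> b\<close>])
    have "continuous_on (c ` {a..b}) f"
      using f C by (auto simp: C1_closure_def intro: continuous_on_subset)
    then show "continuous_on {a..b} (\<lambda>t. f (c t))"
      using continuous_on_compose[OF c_cont, of "{a..b}" f] by (simp add: o_def)
    fix t assume "t \<in> {a<..<b}"
    then have t: "c t \<in> \<Omega>" by (rule I)
    then have "(f has_derivative f' (c t)) (at (c t))" "linear (f' (c t))"
      using f cl by (auto simp: C1_closure_def)
    then have "((\<lambda>t. f (c t)) has_derivative (\<lambda>h. f' (c t) (h *\<^sub>R v))) (at t)"
      using has_derivative_compose[OF c_deriv] by blast
    then show "((\<lambda>t. f (c t)) has_vector_derivative f' (c t) v) (at t)"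
      using \<open>linear (f' (c t))\<close> by (simp add: has_vector_derivative_def linear_scale)
  qed
  have zero: "f' (c t) v = 0" if "c t \<in> \<Omega>" "t \<notin> J" for t
    using supp[of "c t"] that cl[of "c t"] by (auto simp: J_def)
  show ?thesis unfolding c_def[symmetric, THEN fun_cong]
  proof (cases "y \<in> pr ` K")
    case True
    then obtain x where x: "x \<in> K" "y = pr x" by blast
    define t0 where "t0 = x \<bullet> v"
    have ct0: "c t0 = x" using x(2) T_pr[of x] by (simp add: c_def t0_def)
    have t0J: "t0 \<in> J" using x(1) ct0 by (simp add: J_def K_def)
    have xcl: "x \<in> closure \<Omega>" "x \<notin> \<Omega>"
      using K_ball(2)[OF x(1)] op by (auto simp: frontier_def interior_open)
    have below: "c t \<in> \<Omega>" if "t \<in> {\<alpha>..<t0}" for t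
    proof (rule down[of t0])
      have "t \<in> J" using that t0J unfolding J by simp
      then show "c t \<in> cball p r'" "c t0 \<in> cball p r'" using t0J by (simp_all add: J_def)
    qed (use that xcl ct0 in auto)
    have above: "c t \<notin> \<Omega>" if "t \<in> J" "t > t0" for t
      using down[of t t0] that t0J xcl(2) ct0 cl[of "c t"] by (auto simp: J_def)
    have "((\<lambda>t. f' (c t) v) has_integral (f (c t0) - f (c \<alpha>))) {\<alpha>..t0}"
    proof (rule ftc)
      show "\<alpha> \<le> t0" using t0J J by simp
      show "c t \<in> closure \<Omega>" if "t \<in> {\<alpha>..t0}" for t
        using below[of t] cl that xcl(1) ct0 by (cases "t = t0") auto
    qed (use below in auto)
    moreover have "f (c \<alpha>) = 0"
    proof -
      have "c \<alpha> \<in> closure \<Omega>" using below[of \<alpha>] cl xcl(1) ct0 t0J J by (cases "\<alpha> = t0") auto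
      then show ?thesis using supp ends t0J J by auto
    qed
    ultimately have "((\<lambda>t. if t \<in> {\<alpha>..t0} then f' (c t) v else 0) has_integral f x) UNIV"
      by (simp only: has_integral_restrict_UNIV ct0 diff_zero)
    then have "((\<lambda>t. if c t \<in> \<Omega> then f' (c t) v else 0) has_integral f x) UNIV"
    \<comment> \<open>At \<open>t0\<close> itself the line is on the frontier, so the two integrands
      may differ there.\<close>
    proof (rule has_integral_spike_finite[of "{t0}", rotated 2])
      fix t assume t: "t \<in> UNIV - {t0}"
      show "(if c t \<in> \<Omega> then f' (c t) v else 0) = (if t \<in> {\<alpha>..t0} then f' (c t) v else 0)"
      proof (cases "t \<in> J")
        case True
        then show ?thesis using t below[of t] above[of t] J by auto
      next
        case False
        then show ?thesis using zero[of t] t0J J by auto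
      qed
    qed simp
    then show "((\<lambda>t. if c t \<in> \<Omega> then f' (c t) v else 0) has_integral
        (if y \<in> pr ` K then f (g y) else 0)) UNIV"
      using x by (simp add: g_pr)
  next
    case False
    \<comment> \<open>Without a frontier point the connected segment lies on one side of the
      frontier.\<close>
    have noK: "c t \<notin> frontier \<Omega>" if "t \<in> J" for t
      using False that pr_T(1)[of y t] by (force simp: J_def K_def c_def)
    have "((\<lambda>t. if c t \<in> \<Omega> then f' (c t) v else 0) has_integral 0) UNIV"
    proof (cases "\<exists>t\<in>J. c t \<in> \<Omega>")
      case True
      have "connected (c ` J)" using c_cont J by (intro connected_continuous_image) auto
      then have sub: "c ` J \<subseteq> \<Omega>" using connected_Int_frontier[of "c ` J" \<Omega>] True noK by blast
      have "\<alpha> \<le> \<beta>" using True J by auto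
      have subJ: "c t \<in> \<Omega>" if "t \<in> {\<alpha>..\<beta>}" for t using sub that J by blast
      have "((\<lambda>t. f' (c t) v) has_integral (f (c \<beta>) - f (c \<alpha>))) {\<alpha>..\<beta>}"
        by (rule ftc) (use subJ cl \<open>\<alpha> \<le> \<beta>\<close> in auto)
      moreover have "f (c \<alpha>) = 0" "f (c \<beta>) = 0"
        using supp ends[OF \<open>\<alpha> \<le> \<beta>\<close>] subJ[of \<alpha>] subJ[of \<beta>] cl \<open>\<alpha> \<le> \<beta>\<close> by auto
      ultimately have "((\<lambda>t. if t \<in> J then f' (c t) v else 0) has_integral 0) UNIV"
        by (simp only: has_integral_restrict_UNIV J diff_self)
      moreover have "(if t \<in> J then f' (c t) v else 0) = (if c t \<in> \<Omega> then f' (c t) v else 0)" for t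
        using sub zero[of t] by auto
      ultimately show ?thesis by simp
    next
      case False
      then have "(if c t \<in> \<Omega> then f' (c t) v else 0) = 0" for t using zero[of t] by auto
      then show ?thesis by simp
    qed
    then show "((\<lambda>t. if c t \<in> \<Omega> then f' (c t) v else 0) has_integral
        (if y \<in> pr ` K then f (g y) else 0)) UNIV"
      using False by simp
  qed
qed

end

lemma set_integrable_continuous_closure:
  fixes f :: "'a::euclidean_space \<Rightarrow> 'b::euclidean_space"
  assumes "open \<Omega>" "bounded \<Omega>" "continuous_on (closure \<Omega>) f"
  shows "set_integrable lborel \<Omega> f"
proof (rule set_integrable_subset)
  show "set_integrable lborel (closure \<Omega>) f"
    unfolding set_integrable_def using assms by (intro borel_integrable_compact) (auto simp: compact_closure)
qed (use assms closure_subset in auto)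

context line_chart
begin

text \<open>Fubini in the coordinates T, which preserve Lebesgue measure, with
  \<open>line_integral\<close> as the inner integral.\<close>

lemma flux_eq:
  fixes f :: "'a \<Rightarrow> real"
  assumes f: "C1_closure \<Omega> f f'"
    and supp: "\<And>x. x \<in> closure \<Omega> \<Longrightarrow> x \<notin> ball p r' \<Longrightarrow> f x = 0 \<and> f' x = (\<lambda>_. 0)"
  shows "integrable lborel (\<lambda>y. indicator (pr ` K) y *\<^sub>R f (g y))"
    and "(LINT x:\<Omega>|lborel. f' x v) = (\<integral>y. indicator (pr ` K) y *\<^sub>R f (g y) \<partial>lborel)"
proof -
  have gK: "g ` pr ` K = K" using g_pr by force
  have Kcl: "K \<subseteq> closure \<Omega>" using K_ball(2) by (auto simp: frontier_def)
  have "continuous_on (pr ` K) (\<lambda>y. f (g y))"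
    using continuous_on_compose[of "pr ` K" g f] graph_chart(2) f Kcl
    unfolding gK by (auto simp: C1_closure_def o_def intro: continuous_on_subset)
  then show "integrable lborel (\<lambda>y. indicator (pr ` K) y *\<^sub>R f (g y))"
    using graph_chart(1) by (intro borel_integrable_compact)
  define \<phi> where "\<phi> = (\<lambda>x. indicator \<Omega> x *\<^sub>R f' x v)"
  have \<phi>_int: "integrable lborel \<phi>"
    using set_integrable_continuous_closure[OF op bd, of "\<lambda>x. f' x v"] f
    by (simp add: \<phi>_def set_integrable_def C1_closure_def)
  have "continuous_on UNIV T" using lin by (simp add: linear_continuous_on linear_linear)
  then have Tm: "T \<in> borel_measurable lborel" by (simp add: borel_measurable_continuous_onI)
  have distr: "distr lborel borel T = lborel"
  proof (rule distr_lborel_isometry)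
    show "DIM('m \<times> real) = DIM('a)" using dim by simp
    show "dist (T x) (T y) = dist x y" for x y
      by (simp add: dist_norm linear_diff[OF lin, symmetric] normT)
  qed (rule surjT)
  have \<phi>T: "integrable (lborel \<Otimes>\<^sub>M lborel) (\<lambda>z. \<phi> (T z))"
    using \<phi>_int Tm by (subst (asm) distr[symmetric]) (simp add: integrable_distr_eq lborel_prod borel_measurable_integrable[OF \<phi>_int, simplified])
  have "(LINT x:\<Omega>|lborel. f' x v) = integral\<^sup>L lborel \<phi>"
    by (simp add: set_lebesgue_integral_def \<phi>_def)
  also have "\<dots> = integral\<^sup>L lborel (\<lambda>z. \<phi> (T z))"
    using \<phi>_int Tm by (subst distr[symmetric]) (simp add: integral_distr borel_measurable_integrable[OF \<phi>_int, simplified])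
  also have "\<dots> = (\<integral>y. \<integral>t. \<phi> (T (y, t)) \<partial>lborel \<partial>lborel)"
    using lborel_pair.integral_fst'[OF \<phi>T] by (simp add: lborel_prod)
  also have "\<dots> = (\<integral>y. indicator (pr ` K) y *\<^sub>R f (g y) \<partial>lborel)"
  proof (rule integral_cong_AE)
    \<comment> \<open>On almost every line the integrand is Lebesgue integrable, so its Lebesgue
      integral agrees with the gauge integral of \<open>line_integral\<close>.\<close>
    show "AE y in lborel. (\<integral>t. \<phi> (T (y, t)) \<partial>lborel) = indicator (pr ` K) y *\<^sub>R f (g y)"
      using lborel_pair.AE_integrable_fst'[OF \<phi>T]
    proof eventually_elim
      case (elim y)
      have "((\<lambda>t. \<phi> (T (y, t))) has_integral (if y \<in> pr ` K then f (g y) else 0)) UNIV"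
      proof -
        have "(\<lambda>t. \<phi> (T (y, t))) = (\<lambda>t. if T (y, t) \<in> \<Omega> then f' (T (y, t)) v else 0)"
          by (auto simp: \<phi>_def)
        then show ?thesis by (simp only:) (rule line_integral[OF f supp])
      qed
      then have "((\<lambda>t. \<phi> (T (y, t))) has_integral (indicator (pr ` K) y *\<^sub>R f (g y))) UNIV"
        by (cases "y \<in> pr ` K") simp_all
      then show ?case by (rule has_integral_unique[OF has_integral_integral_lborel[OF elim]])
    qed
    show "(\<lambda>y. \<integral>t. \<phi> (T (y, t)) \<partial>lborel) \<in> borel_measurable lborel"
      using lborel_pair.integrable_fst'[OF \<phi>T] by (rule borel_measurable_integrable)
    show "(\<lambda>y. indicator (pr ` K) y *\<^sub>R f (g y)) \<in> borel_measurable lborel"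
      using \<open>integrable lborel (\<lambda>y. indicator (pr ` K) y *\<^sub>R f (g y))\<close> by (rule borel_measurable_integrable)
  qed
  finally show "(LINT x:\<Omega>|lborel. f' x v) = (\<integral>y. indicator (pr ` K) y *\<^sub>R f (g y) \<partial>lborel)" .
qed

text \<open>By \<open>flux_eq\<close> the flux is an integral over the projected frontier;
  \<open>graph_measure\<close> compares this with the integral over the frontier itself. The factor
  tends to 1 with \<epsilon>, that is, when v is nearly normal.\<close>

lemma flux_bounds:
  fixes f :: "'a \<Rightarrow> real"
  assumes f: "C1_closure \<Omega> f f'"
    and supp: "\<And>x. x \<in> closure \<Omega> \<Longrightarrow> x \<notin> ball p r' \<Longrightarrow> f x = 0 \<and> f' x = (\<lambda>_. 0)"
    and pos: "\<And>x. x \<in> frontier \<Omega> \<Longrightarrow> f x \<ge> 0"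
  defines "I \<equiv> LINT x:\<Omega>|lborel. f' x v"
    and "J \<equiv> \<integral>\<^sup>+x. ennreal (indicator (frontier \<Omega>) x * f x) \<partial>hausdorff_measure DIM('m)"
  shows "0 \<le> I" "ennreal I \<le> J" "J \<le> ennreal ((1 / sqrt (1 - \<epsilon>\<^sup>2)) powr DIM('m) * I)"
proof -
  have I_lborel: "I = (\<integral>y. indicator (pr ` K) y *\<^sub>R f (g y) \<partial>lborel)"
    unfolding I_def by (rule flux_eq(2)[OF f supp])
  have int: "integrable lborel (\<lambda>y. indicator (pr ` K) y *\<^sub>R f (g y))"
    by (rule flux_eq(1)[OF f supp])
  have posK: "f (g y) \<ge> 0" if "y \<in> pr ` K" for y using that pos K_ball(2) g_pr by auto
  show I: "0 \<le> I" unfolding I_lborel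
    by (intro integral_nonneg_AE) (auto simp: indicator_def posK)
  define F where "F = (\<lambda>x. ennreal (indicator K x *\<^sub>R f x))"
  have Kcl: "K \<subseteq> closure \<Omega>" using K_ball(2) by (auto simp: frontier_def)
  have Fm: "F \<in> borel_measurable borel"
    unfolding F_def using f Kcl compact_K
    by (intro measurable_compose[OF borel_measurable_continuous_on_indicator measurable_ennreal])
       (auto simp: C1_closure_def borel_compact intro: continuous_on_subset)
  have "ennreal I = (\<integral>\<^sup>+y. ennreal (indicator (pr ` K) y *\<^sub>R f (g y)) \<partial>lborel)"
    unfolding I_lborel using int
    by (intro nn_integral_eq_integral[symmetric]) (auto simp: indicator_def posK)
  also have "\<dots> = (\<integral>\<^sup>+y. F (g y) * indicator (pr ` K) y \<partial>lborel)"
    by (intro nn_integral_cong) (auto simp: F_def indicator_def g_pr)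
  finally have I_eq: "ennreal I = (\<integral>\<^sup>+y. F (g y) * indicator (pr ` K) y \<partial>lborel)" .
  have J_eq: "J = (\<integral>\<^sup>+x. F x * indicator K x \<partial>hausdorff_measure DIM('m))"
    unfolding J_def
  proof (intro nn_integral_cong)
    fix x
    have "f x = 0" if "x \<in> frontier \<Omega>" "x \<notin> K"
      using that supp[of x] by (auto simp: K_def frontier_def)
    then show "ennreal (indicator (frontier \<Omega>) x * f x) = F x * indicator K x"
      by (auto simp: F_def indicator_def K_def)
  qed
  show "ennreal I \<le> J" unfolding I_eq J_eq by (rule graph_measure(1)[OF Fm])
  show "J \<le> ennreal ((1 / sqrt (1 - \<epsilon>\<^sup>2)) powr DIM('m) * I)"
    unfolding ennreal_mult'[OF powr_ge_zero] unfolding I_eq J_eq by (rule graph_measure(2)[OF Fm])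
qed

lemma hausdorff_K_finite: "hausdorff_outer DIM('m) (frontier \<Omega> \<inter> cball p r') < \<infinity>"
proof -
  have "hausdorff_outer DIM('m) K = (\<integral>\<^sup>+x. 1 * indicator K x \<partial>hausdorff_measure DIM('m))"
    using compact_K by (simp add: borel_compact emeasure_hausdorff_measure)
  also have "\<dots> \<le> ennreal ((1 / sqrt (1 - \<epsilon>\<^sup>2)) powr DIM('m)) * (\<integral>\<^sup>+y. 1 * indicator (pr ` K) y \<partial>lborel)"
    by (rule graph_measure(2)) (rule borel_measurable_const)
  also have "\<dots> = ennreal ((1 / sqrt (1 - \<epsilon>\<^sup>2)) powr DIM('m)) * emeasure lborel (pr ` K)"
    using graph_chart(1) by (simp add: borel_compact)
  also have "\<dots> < \<infinity>"
    using emeasure_bounded_finite[OF compact_imp_bounded[OF graph_chart(1)]]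
    by (simp add: ennreal_mult_less_top)
  finally show ?thesis by (simp add: K_def)
qed

end

section \<open>Functions of class C1 up to the boundary\<close>

lemma C1_closureD:
  assumes "C1_closure \<Omega> f f'"
  shows "continuous_on (closure \<Omega>) f" "continuous_on (closure \<Omega>) (\<lambda>x. f' x v)"
    "x \<in> closure \<Omega> \<Longrightarrow> linear (f' x)" "x \<in> \<Omega> \<Longrightarrow> (f has_derivative f' x) (at x)"
  using assms by (auto simp: C1_closure_def)

lemma C1_closure_const: "C1_closure \<Omega> (\<lambda>_. c) (\<lambda>_ _. 0)"
  by (auto simp: C1_closure_def linear_zero)

lemma C1_closure_add:
  assumes "C1_closure \<Omega> f f'" "C1_closure \<Omega> g g'"
  shows "C1_closure \<Omega> (\<lambda>x. f x + g x) (\<lambda>x v. f' x v + g' x v)"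
  using assms by (auto simp: C1_closure_def intro!: continuous_intros linear_compose_add derivative_eq_intros)

lemma C1_closure_sum:
  assumes "finite P" "\<And>p. p \<in> P \<Longrightarrow> C1_closure \<Omega> (f p) (f' p)"
  shows "C1_closure \<Omega> (\<lambda>x. \<Sum>p\<in>P. f p x) (\<lambda>x v. \<Sum>p\<in>P. f' p x v)"
  using assms by (induction P rule: finite_induct) (auto intro: C1_closure_const C1_closure_add)

lemma C1_closure_linear:
  assumes "bounded_linear L" "C1_closure \<Omega> f f'"
  shows "C1_closure \<Omega> (\<lambda>x. L (f x)) (\<lambda>x v. L (f' x v))"
  unfolding C1_closure_def
proof (intro conjI allI ballI)
  show "linear (\<lambda>v. L (f' x v))" if "x \<in> closure \<Omega>" for x
    using linear_compose[OF C1_closureD(3)[OF assms(2) that] bounded_linear.linear[OF assms(1)]]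
    by (simp add: o_def)
  show "((\<lambda>x. L (f x)) has_derivative (\<lambda>v. L (f' x v))) (at x)" if "x \<in> \<Omega>" for x
    by (rule bounded_linear.has_derivative[OF assms(1) C1_closureD(4)[OF assms(2) that]])
qed (rule bounded_linear.continuous_on[OF assms(1)] C1_closureD(1,2)[OF assms(2)])+

lemma (in bounded_bilinear) C1_closure_prod:
  assumes f: "C1_closure \<Omega> f f'" and g: "C1_closure \<Omega> g g'"
  shows "C1_closure \<Omega> (\<lambda>x. prod (f x) (g x)) (\<lambda>x v. prod (f x) (g' x v) + prod (f' x v) (g x))"
  unfolding C1_closure_def
proof (intro conjI allI ballI)
  fix x assume x: "x \<in> closure \<Omega>"
  have "linear (\<lambda>v. prod (f x) (g' x v))"
    using linear_compose[OF C1_closureD(3)[OF g x] bounded_linear.linear[OF bounded_linear_right]]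
    by (simp add: o_def)
  moreover have "linear (\<lambda>v. prod (f' x v) (g x))"
    using linear_compose[OF C1_closureD(3)[OF f x] bounded_linear.linear[OF bounded_linear_left]]
    by (simp add: o_def)
  ultimately show "linear (\<lambda>v. prod (f x) (g' x v) + prod (f' x v) (g x))"
    by (rule linear_compose_add)
next
  fix x assume "x \<in> \<Omega>"
  then show "((\<lambda>x. prod (f x) (g x)) has_derivative (\<lambda>v. prod (f x) (g' x v) + prod (f' x v) (g x))) (at x)"
    using assms by (intro FDERIV) (auto dest: C1_closureD)
qed (use assms in \<open>auto intro!: continuous_on continuous_on_add dest: C1_closureD\<close>)

lemmas C1_closure_scaleR = bounded_bilinear.C1_closure_prod[OF bounded_bilinear_scaleR]

lemma C1_closure_inverse:
  fixes f :: "'a::euclidean_space \<Rightarrow> real"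
  assumes f: "C1_closure \<Omega> f f'" and pos: "\<And>x. x \<in> closure \<Omega> \<Longrightarrow> f x > 0"
  shows "C1_closure \<Omega> (\<lambda>x. inverse (f x)) (\<lambda>x v. - (inverse (f x) * f' x v * inverse (f x)))"
  unfolding C1_closure_def
proof (intro conjI allI ballI)
  have nz: "\<forall>x\<in>closure \<Omega>. f x \<noteq> 0" using pos by force
  show "continuous_on (closure \<Omega>) (\<lambda>x. inverse (f x))"
    using C1_closureD(1)[OF f] nz by (rule continuous_on_inverse)
  then show "continuous_on (closure \<Omega>) (\<lambda>x. - (inverse (f x) * f' x v * inverse (f x)))" for v
    by (intro continuous_on_minus continuous_on_mult C1_closureD(2)[OF f])
  fix x
  show "linear (\<lambda>v. - (inverse (f x) * f' x v * inverse (f x)))" if "x \<in> closure \<Omega>"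
    using C1_closureD(3)[OF f that]
    by (intro linearI) (auto simp: linear_add linear_scale algebra_simps)
  show "((\<lambda>x. inverse (f x)) has_derivative (\<lambda>v. - (inverse (f x) * f' x v * inverse (f x)))) (at x)"
    if "x \<in> \<Omega>"
    using C1_closureD(4)[OF f that] nz that closure_subset[of \<Omega>] by (intro Deriv.has_derivative_inverse) auto
qed

lemma continuous_on_glue_zero:
  fixes h :: "'a::topological_space \<Rightarrow> 'b::{topological_space, zero}"
  assumes U: "open U" and C: "closed C" "C \<subseteq> U"
    and h: "continuous_on (S \<inter> U) h" and z: "\<And>x. x \<in> S \<Longrightarrow> x \<notin> C \<Longrightarrow> h x = 0"
  shows "continuous_on S h"
proof -
  have "continuous_on ((S \<inter> U) \<union> (S \<inter> - C)) h"
  proof (rule continuous_on_Un_local_open)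
    show "openin (top_of_set ((S \<inter> U) \<union> (S \<inter> - C))) (S \<inter> U)"
      using U by (auto intro!: openin_open[THEN iffD2] exI[of _ U])
    show "openin (top_of_set ((S \<inter> U) \<union> (S \<inter> - C))) (S \<inter> - C)"
      using C(1) by (auto intro!: openin_open[THEN iffD2] exI[of _ "- C"])
    show "continuous_on (S \<inter> - C) h"
      using z by (subst continuous_on_cong[OF refl, of _ _ "\<lambda>_. 0"]) auto
  qed (rule h)
  moreover have "(S \<inter> U) \<union> (S \<inter> - C) = S" using C(2) by blast
  ultimately show ?thesis by simp
qed

text \<open>The second factor needs to be defined and regular on the support of the first one only.\<close>
lemma (in bounded_bilinear) C1_closure_prod_local:
  assumes op: "open \<Omega>" and f: "C1_closure \<Omega> f f'" and U: "open U" and C: "closed C" "C \<subseteq> U"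
    and supp: "\<And>x. x \<in> closure \<Omega> \<Longrightarrow> x \<notin> C \<Longrightarrow> f x = 0 \<and> f' x = (\<lambda>_. 0)"
    and g: "continuous_on (closure \<Omega> \<inter> U) g" "\<And>v. continuous_on (closure \<Omega> \<inter> U) (\<lambda>x. g' x v)"
      "\<And>x. x \<in> closure \<Omega> \<inter> U \<Longrightarrow> linear (g' x)"
      "\<And>x. x \<in> \<Omega> \<inter> U \<Longrightarrow> (g has_derivative g' x) (at x)"
  shows "C1_closure \<Omega> (\<lambda>x. prod (f x) (g x)) (\<lambda>x v. prod (f x) (g' x v) + prod (f' x v) (g x))"
proof -
  have fU: "continuous_on (closure \<Omega> \<inter> U) f" "continuous_on (closure \<Omega> \<inter> U) (\<lambda>x. f' x v)" for v
    by (rule continuous_on_subset[OF C1_closureD(1)[OF f]], simp)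
       (rule continuous_on_subset[OF C1_closureD(2)[OF f]], simp)
  have cl: "x \<in> closure \<Omega>" if "x \<in> \<Omega>" for x using that closure_subset by blast
  show ?thesis
    unfolding C1_closure_def
  proof (intro conjI allI ballI)
    show "continuous_on (closure \<Omega>) (\<lambda>x. prod (f x) (g x))"
      by (rule continuous_on_glue_zero[OF U C continuous_on[OF fU(1) g(1)]])
         (simp add: supp zero_left)
    show "continuous_on (closure \<Omega>) (\<lambda>x. prod (f x) (g' x v) + prod (f' x v) (g x))" for v
      by (rule continuous_on_glue_zero[OF U C continuous_on_add[OF continuous_on[OF fU(1) g(2)]
            continuous_on[OF fU(2) g(1)]]]) (simp add: supp zero_left)
  next
    fix x assume x: "x \<in> closure \<Omega>"
    show "linear (\<lambda>v. prod (f x) (g' x v) + prod (f' x v) (g x))"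
    proof (cases "x \<in> C")
      case True
      then have "linear (\<lambda>v. prod (f x) (g' x v))"
        using linear_compose[OF g(3)[of x] bounded_linear.linear[OF bounded_linear_right]] C x
        by (auto simp: o_def)
      moreover have "linear (\<lambda>v. prod (f' x v) (g x))"
        using linear_compose[OF C1_closureD(3)[OF f x] bounded_linear.linear[OF bounded_linear_left]]
        by (simp add: o_def)
      ultimately show ?thesis by (rule linear_compose_add)
    qed (use supp x in \<open>simp add: zero_left linear_zero\<close>)
  next
    fix x assume x: "x \<in> \<Omega>"
    show "((\<lambda>x. prod (f x) (g x)) has_derivative (\<lambda>v. prod (f x) (g' x v) + prod (f' x v) (g x))) (at x)"
    proof (cases "x \<in> C")
      case True
      then show ?thesis using C1_closureD(4)[OF f x] g(4)[of x] C x by (intro FDERIV) auto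
    next
      case False
      have z: "f y = 0" "f' y = (\<lambda>_. 0)" if "y \<in> \<Omega>" "y \<notin> C" for y using supp cl that by auto
      have "((\<lambda>x. 0) has_derivative (\<lambda>v. prod (f x) (g' x v) + prod (f' x v) (g x))) (at x)"
        using z[OF x False] by (simp add: zero_left)
      then show ?thesis
        by (rule has_derivative_transform_within_open[of _ _ _ _ "\<Omega> - C"])
           (use op C(1) x False z in \<open>auto simp: zero_left\<close>)
    qed
  qed
qed

text \<open>The source of all cut-off functions: the squared positive part is C1, and only C1
  cut-offs occur.\<close>

lemma DERIV_pos_part_square: "((\<lambda>t. (max 0 t)\<^sup>2) has_real_derivative 2 * max 0 t) (at (t::real))"
proof -
  consider "t < 0" | "t = 0" | "t > 0" by linarith
  then show ?thesis
  proof cases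
    case 1
    have "((\<lambda>t. 0) has_real_derivative 2 * max 0 t) (at t)" using 1 by simp
    then show ?thesis by (rule DERIV_cong_ev[THEN iffD1, rotated 3])
      (use 1 in \<open>auto intro!: eventually_mono[OF eventually_nhds_in_open[of "{..<0}"]]\<close>)
  next
    case 2
    have "((\<lambda>h. (max 0 h)\<^sup>2 / h) \<longlongrightarrow> 0) (at (0::real))"
    proof (rule Lim_null_comparison)
      show "((\<lambda>h. \<bar>h\<bar>) \<longlongrightarrow> 0) (at (0::real))" by (intro tendsto_eq_intros) auto
      show "\<forall>\<^sub>F h in at 0. norm ((max 0 h)\<^sup>2 / h) \<le> \<bar>h\<bar>"
        by (intro always_eventually allI) (auto simp: max_def power2_eq_square)
    qed
    then show ?thesis using 2 by (simp add: DERIV_def)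
  next
    case 3
    have "((\<lambda>t. t\<^sup>2) has_real_derivative 2 * max 0 t) (at t)"
      using 3 by (auto intro!: derivative_eq_intros)
    then show ?thesis by (rule DERIV_cong_ev[THEN iffD1, rotated 3])
      (use 3 in \<open>auto intro!: eventually_mono[OF eventually_nhds_in_open[of "{0<..}"]]\<close>)
  qed
qed

definition bump :: "'a::real_inner \<Rightarrow> real \<Rightarrow> 'a \<Rightarrow> real" where
  "bump p R x = (max 0 (R\<^sup>2 - (x - p) \<bullet> (x - p)))\<^sup>2"

definition bump' :: "'a::real_inner \<Rightarrow> real \<Rightarrow> 'a \<Rightarrow> 'a \<Rightarrow> real" where
  "bump' p R x v = 2 * max 0 (R\<^sup>2 - (x - p) \<bullet> (x - p)) * (- 2 * ((x - p) \<bullet> v))"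

lemma C1_closure_bump: "C1_closure \<Omega> (bump p R) (bump' p R)"
  unfolding C1_closure_def
proof (intro conjI allI ballI)
  show "continuous_on (closure \<Omega>) (bump p R)"
    unfolding bump_def[abs_def] by (intro continuous_intros)
  show "continuous_on (closure \<Omega>) (\<lambda>x. bump' p R x v)" for v
    unfolding bump'_def by (intro continuous_intros)
  show "linear (bump' p R x)" for x
    unfolding bump'_def by (rule linearI) (auto simp: inner_add_right algebra_simps)
  show "(bump p R has_derivative bump' p R x) (at x)" for x
  proof -
    have 1: "((\<lambda>x. R\<^sup>2 - (x - p) \<bullet> (x - p)) has_derivative (\<lambda>v. - 2 * ((x - p) \<bullet> v))) (at x)"
      by (auto intro!: derivative_eq_intros simp: inner_commute)
    have "((\<lambda>t. (max 0 t)\<^sup>2) has_derivative (*) (2 * max 0 (R\<^sup>2 - (x - p) \<bullet> (x - p)))) (at (R\<^sup>2 - (x - p) \<bullet> (x - p)))"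
      using DERIV_pos_part_square unfolding has_field_derivative_def .
    from has_derivative_compose[OF 1 this] show ?thesis
      unfolding bump_def[abs_def] bump'_def[abs_def] .
  qed
qed

lemma bump_pos: "0 \<le> bump p R x" "x \<in> ball p R \<Longrightarrow> 0 < bump p R x"
proof -
  show "0 \<le> bump p R x" by (simp add: bump_def)
  assume x: "x \<in> ball p R"
  then have "(norm (x - p))\<^sup>2 < R\<^sup>2"
    by (intro power_strict_mono) (auto simp: dist_norm norm_minus_commute)
  then show "0 < bump p R x" by (simp add: bump_def power2_norm_eq_inner)
qed

lemma bump_zero:
  assumes "R > 0" "x \<notin> ball p R"
  shows "bump p R x = 0" "bump' p R x = (\<lambda>_. 0)"
proof -
  have "R\<^sup>2 \<le> (norm (x - p))\<^sup>2"
    using assms by (intro power_mono) (auto simp: dist_norm norm_minus_commute)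
  then show "bump p R x = 0" "bump' p R x = (\<lambda>_. 0)"
    by (simp_all add: bump_def bump'_def[abs_def] power2_norm_eq_inner)
qed

text \<open>A partition of unity by the functions \<open>bump / \<Sum>bump\<close>.\<close>
lemma C1_closure_localize:
  fixes f :: "'a::euclidean_space \<Rightarrow> 'b::real_normed_vector"
  assumes op: "open \<Omega>" and bd: "bounded \<Omega>" and f: "C1_closure \<Omega> f f'"
    and R: "\<And>p. p \<in> closure \<Omega> \<Longrightarrow> R p > 0"
  obtains P \<theta> h h' where "finite P" "P \<subseteq> closure \<Omega>"
    "\<And>p. p \<in> P \<Longrightarrow> C1_closure \<Omega> (h p) (h' p)"
    "\<And>p x. p \<in> P \<Longrightarrow> x \<in> closure \<Omega> \<Longrightarrow> x \<notin> ball p (R p) \<Longrightarrow> h p x = 0 \<and> h' p x = (\<lambda>_. 0)"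
    "\<And>p x. p \<in> P \<Longrightarrow> x \<in> closure \<Omega> \<Longrightarrow> h p x = \<theta> p x *\<^sub>R f x \<and> \<theta> p x \<ge> (0::real)"
    "\<And>x. x \<in> closure \<Omega> \<Longrightarrow> f x = (\<Sum>p\<in>P. h p x)"
    "\<And>x v. x \<in> \<Omega> \<Longrightarrow> f' x v = (\<Sum>p\<in>P. h' p x v)"
proof -
  have "compact (closure \<Omega>)" using bd by (simp add: compact_closure)
  moreover have "closure \<Omega> \<subseteq> (\<Union>p\<in>closure \<Omega>. ball p (R p))" using R by force
  ultimately obtain P where P: "P \<subseteq> closure \<Omega>" "finite P" "closure \<Omega> \<subseteq> (\<Union>p\<in>P. ball p (R p))"
    by (rule compactE_image[OF _ open_ball])
  let ?b = "\<lambda>p. bump p (R p)" and ?b' = "\<lambda>p. bump' p (R p)"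
  define S where "S = (\<lambda>x. \<Sum>p\<in>P. ?b p x)"
  define S' where "S' = (\<lambda>x v. \<Sum>p\<in>P. ?b' p x v)"
  have S: "C1_closure \<Omega> S S'" unfolding S_def S'_def using P(2) C1_closure_bump by (rule C1_closure_sum)
  have Spos: "S x > 0" if "x \<in> closure \<Omega>" for x
  proof -
    obtain p where "p \<in> P" "x \<in> ball p (R p)" using P(3) \<open>x \<in> closure \<Omega>\<close> by blast
    then show ?thesis unfolding S_def using P(2) bump_pos by (intro sum_pos2[of P p]) auto
  qed
  \<comment> \<open>The division by the sum of bumps is carried out once; each piece is then a bump
    times the same C1 function q.\<close>
  define q where "q = (\<lambda>x. inverse (S x) *\<^sub>R f x)"
  obtain q' where q: "C1_closure \<Omega> q q'"
    unfolding q_def using C1_closure_scaleR[OF C1_closure_inverse[OF S Spos] f] by blast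
  define h where "h = (\<lambda>p x. ?b p x *\<^sub>R q x)"
  define h' where "h' = (\<lambda>p x v. ?b p x *\<^sub>R q' x v + ?b' p x v *\<^sub>R q x)"
  have h: "C1_closure \<Omega> (h p) (h' p)" for p
    unfolding h_def h'_def by (rule C1_closure_scaleR[OF C1_closure_bump q])
  have sum: "f x = (\<Sum>p\<in>P. h p x)" if "x \<in> closure \<Omega>" for x
  proof -
    have "(\<Sum>p\<in>P. h p x) = S x *\<^sub>R q x" by (simp add: h_def S_def scaleR_sum_left)
    also have "\<dots> = f x" using Spos[OF that] by (simp add: q_def)
    finally show ?thesis by simp
  qed
  have cl: "x \<in> closure \<Omega>" if "x \<in> \<Omega>" for x using that closure_subset by blast
  \<comment> \<open>Uniqueness of derivatives, available at points of the open set. For bulk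
    integrals the identity on \<Omega> is enough.\<close>
  have sum': "f' x v = (\<Sum>p\<in>P. h' p x v)" if x: "x \<in> \<Omega>" for x v
  proof -
    have "((\<lambda>x. \<Sum>p\<in>P. h p x) has_derivative (\<lambda>v. \<Sum>p\<in>P. h' p x v)) (at x)"
      using C1_closureD(4)[OF h x] by (intro has_derivative_sum)
    then have "(f has_derivative (\<lambda>v. \<Sum>p\<in>P. h' p x v)) (at x)"
      by (rule has_derivative_transform_within_open[OF _ op x]) (use sum cl in auto)
    then have "f' x = (\<lambda>v. \<Sum>p\<in>P. h' p x v)" by (rule has_derivative_unique[OF C1_closureD(4)[OF f x]])
    then show ?thesis by (rule fun_cong)
  qed
  show ?thesis
  proof (rule that[of P h h' "\<lambda>p x. ?b p x * inverse (S x)"])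
    fix p x assume p: "p \<in> P" and x: "x \<in> closure \<Omega>"
    show "h p x = (?b p x * inverse (S x)) *\<^sub>R f x \<and> ?b p x * inverse (S x) \<ge> 0"
      using Spos[OF x] bump_pos(1)[of p "R p" x] by (simp add: h_def q_def)
    have "R p > 0" using R P(1) p by blast
    then show "h p x = 0 \<and> h' p x = (\<lambda>_. 0)" if "x \<notin> ball p (R p)"
      using bump_zero[OF _ that] by (simp add: h_def h'_def)
  qed (use P h sum sum' in auto)
qed

section \<open>The divergence theorem\<close>

text \<open>The interface between C2 domains and the divergence theorem: a continuous unit field on
  the frontier for which cones of every opening \<epsilon> > 0 exist at small scales. In particular
  the frontier is locally a Lipschitz graph with arbitrarily small constant over the plane
  orthogonal to \<open>\<nu> p\<close>.\<close>

locale cone_domain =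
  fixes \<Omega> :: "(real^'n) set" and \<nu> :: "real^'n \<Rightarrow> real^'n"
  assumes op: "open \<Omega>" and bd: "bounded \<Omega>" and card: "CARD('n) \<noteq> 1"
    and norm_\<nu>: "\<And>x. x \<in> frontier \<Omega> \<Longrightarrow> norm (\<nu> x) = 1"
    and \<nu>_cont: "continuous_on (frontier \<Omega>) \<nu>"
    and cone: "\<And>p \<epsilon>. p \<in> frontier \<Omega> \<Longrightarrow> \<epsilon> > 0 \<Longrightarrow> \<exists>r>0. cone_at \<Omega> p r (\<nu> p) \<epsilon>"
begin

abbreviation "\<sigma> \<equiv> surface_measure (frontier \<Omega>)"

lemma dim_drop: "real DIM(real^'n drop_one) = real CARD('n) - 1"
  using CARD_drop_one[OF card] by (simp add: algebra_simps flip: of_nat_Suc)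

lemma line_chart_exists:
  assumes "norm v = 1" "cone_at \<Omega> p r v \<epsilon>" "0 \<le> \<epsilon>" "\<epsilon> < 1" "r' < r"
  obtains T :: "(real^'n drop_one) \<times> real \<Rightarrow> real^'n" where "line_chart \<Omega> T p r r' \<epsilon> v"
proof -
  have dim: "DIM(real^'n drop_one) + 1 = DIM(real^'n)" using CARD_drop_one[OF card] by simp
  obtain T :: "(real^'n drop_one) \<times> real \<Rightarrow> real^'n"
    where T: "linear T" "\<And>z. norm (T z) = norm z" "surj T" "T (0, 1) = v"
    using exists_coordinates[OF dim assms(1)] by blast
  show ?thesis
    by (rule that[OF line_chart.intro[OF op bd T(1-3) T(4)[symmetric] dim assms(2-5)]])
qed

lemma compact_closure_\<Omega>: "compact (closure \<Omega>)" and compact_frontier_\<Omega>: "compact (frontier \<Omega>)"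
  using bd by (auto simp: compact_closure compact_frontier_bounded)

lemma frontier_sub: "frontier \<Omega> \<subseteq> closure \<Omega>"
  by (auto simp: frontier_def)

lemma \<Omega>_sub: "x \<in> \<Omega> \<Longrightarrow> x \<in> closure \<Omega>"
  using closure_subset by blast

lemma closure_cases: "x \<in> closure \<Omega> \<Longrightarrow> x \<in> \<Omega> \<or> x \<in> frontier \<Omega>"
  using op by (auto simp: frontier_def interior_open)

lemma space_\<sigma> [simp]: "space \<sigma> = frontier \<Omega>"
  by (simp add: surface_measure_def space_restrict_space)

lemma hausdorff_frontier_finite: "hausdorff_outer (real CARD('n) - 1) (frontier \<Omega>) < \<infinity>"
proof -
  let ?m = "real CARD('n) - 1"
  have "\<exists>s>0. hausdorff_outer ?m (frontier \<Omega> \<inter> cball p s) < \<infinity>" if p: "p \<in> frontier \<Omega>" for p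
  proof -
    obtain r where r: "r > 0" "cone_at \<Omega> p r (\<nu> p) (1/2)" using cone[OF p, of "1/2"] by auto
    obtain T :: "(real^'n drop_one) \<times> real \<Rightarrow> real^'n" where "line_chart \<Omega> T p r (r/2) (1/2) (\<nu> p)"
      by (rule line_chart_exists[OF norm_\<nu>[OF p] r(2), of "r/2"]; use r(1) in simp)
    from line_chart.hausdorff_K_finite[OF this] show ?thesis
      using r(1) unfolding dim_drop by (intro exI[of _ "r/2"]) auto
  qed
  then obtain s where s: "\<And>p. p \<in> frontier \<Omega> \<Longrightarrow> s p > 0"
    "\<And>p. p \<in> frontier \<Omega> \<Longrightarrow> hausdorff_outer ?m (frontier \<Omega> \<inter> cball p (s p)) < \<infinity>" by metis
  have "frontier \<Omega> \<subseteq> (\<Union>p\<in>frontier \<Omega>. ball p (s p))" using s(1) by force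
  then obtain P where P: "P \<subseteq> frontier \<Omega>" "finite P" "frontier \<Omega> \<subseteq> (\<Union>p\<in>P. ball p (s p))"
    by (rule compactE_image[OF compact_frontier_\<Omega> open_ball])
  have fin: "hausdorff_outer ?m (\<Union>p\<in>P. frontier \<Omega> \<inter> cball p (s p)) < \<infinity>"
    using P(2,1)
  proof (induction rule: finite_induct)
    case (insert p P)
    then show ?case
      using hausdorff_outer_Un[of ?m "frontier \<Omega> \<inter> cball p (s p)" "\<Union>p\<in>P. frontier \<Omega> \<inter> cball p (s p)"] s(2)[of p]
      by (auto simp: ennreal_add_less_top intro: le_less_trans)
  qed simp
  have "frontier \<Omega> \<subseteq> (\<Union>p\<in>P. frontier \<Omega> \<inter> cball p (s p))"
  proof
    fix x assume "x \<in> frontier \<Omega>"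
    moreover then obtain p where "p \<in> P" "x \<in> ball p (s p)" using P(3) by blast
    ultimately show "x \<in> (\<Union>p\<in>P. frontier \<Omega> \<inter> cball p (s p))" by (intro UN_I[of p]) auto
  qed
  then show ?thesis using fin by (meson hausdorff_outer_mono order_le_less_trans)
qed

lemma finite_measure_\<sigma>: "finite_measure \<sigma>"
proof
  have "emeasure \<sigma> (frontier \<Omega>) = hausdorff_outer (real CARD('n) - 1) (frontier \<Omega>)"
    by (simp add: surface_measure_def emeasure_restrict_space emeasure_hausdorff_measure)
  then show "emeasure \<sigma> (space \<sigma>) \<noteq> \<infinity>" using hausdorff_frontier_finite by simp
qed

lemma measurable_\<sigma>:
  fixes f :: "real^'n \<Rightarrow> 'b::euclidean_space"
  assumes "continuous_on (frontier \<Omega>) f"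
  shows "f \<in> borel_measurable \<sigma>"
  using borel_measurable_continuous_on_restrict[OF assms]
  by (simp add: surface_measure_def cong: measurable_cong_sets sets_restrict_space_cong)

lemma integrable_\<sigma>:
  fixes f :: "real^'n \<Rightarrow> 'b::euclidean_space"
  assumes f: "continuous_on (frontier \<Omega>) f"
  shows "integrable \<sigma> f"
proof -
  have "bounded (f ` frontier \<Omega>)"
    by (intro compact_imp_bounded compact_continuous_image f compact_frontier_\<Omega>)
  then obtain B where "\<And>x. x \<in> frontier \<Omega> \<Longrightarrow> norm (f x) \<le> B" by (auto simp: bounded_iff)
  then show ?thesis
    by (intro finite_measure.integrable_const_bound[OF finite_measure_\<sigma>, of _ B] measurable_\<sigma> f AE_I2) simp
qed

lemma C1_integrable_\<sigma>: "C1_closure \<Omega> f f' \<Longrightarrow> integrable \<sigma> (f :: _ \<Rightarrow> 'b::euclidean_space)"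
  by (intro integrable_\<sigma> continuous_on_subset[OF C1_closureD(1) frontier_sub])

lemma flux_surface:
  fixes f :: "real^'n \<Rightarrow> real"
  assumes v: "norm v = 1" and c: "cone_at \<Omega> p r v \<epsilon>" "0 \<le> \<epsilon>" "\<epsilon> < 1" and r: "r' < r"
    and f: "C1_closure \<Omega> f f'"
    and supp: "\<And>x. x \<in> closure \<Omega> \<Longrightarrow> x \<notin> ball p r' \<Longrightarrow> f x = 0 \<and> f' x = (\<lambda>_. 0)"
    and pos: "\<And>x. x \<in> closure \<Omega> \<Longrightarrow> f x \<ge> 0"
  shows "(LINT x:\<Omega>|lborel. f' x v) \<le> (\<integral>x. f x \<partial>\<sigma>)"
    and "(\<integral>x. f x \<partial>\<sigma>) \<le> (1 / sqrt (1 - \<epsilon>\<^sup>2)) ^ (CARD('n) - 1) * (LINT x:\<Omega>|lborel. f' x v)"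
proof -
  obtain T :: "(real^'n drop_one) \<times> real \<Rightarrow> real^'n" where "line_chart \<Omega> T p r r' \<epsilon> v"
    by (rule line_chart_exists[OF v c r])
  then interpret line_chart \<Omega> T p r r' \<epsilon> v .
  have pos': "x \<in> frontier \<Omega> \<Longrightarrow> f x \<ge> 0" for x using pos frontier_sub by auto
  have "(\<integral>\<^sup>+x. ennreal (indicator (frontier \<Omega>) x * f x) \<partial>hausdorff_measure (real CARD('n) - 1))
      = (\<integral>\<^sup>+x. ennreal (f x) * indicator (frontier \<Omega>) x \<partial>hausdorff_measure (real CARD('n) - 1))"
    by (intro nn_integral_cong) (simp add: indicator_def)
  also have "\<dots> = (\<integral>\<^sup>+x. ennreal (f x) \<partial>\<sigma>)"
    by (simp add: surface_measure_def nn_integral_restrict_space)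
  also have "\<dots> = ennreal (\<integral>x. f x \<partial>\<sigma>)"
    using C1_integrable_\<sigma>[OF f] pos' by (intro nn_integral_eq_integral AE_I2) auto
  finally have J: "(\<integral>\<^sup>+x. ennreal (indicator (frontier \<Omega>) x * f x)
      \<partial>hausdorff_measure DIM(real^'n drop_one)) = ennreal (\<integral>x. f x \<partial>\<sigma>)"
    by (simp only: dim_drop)
  have J0: "0 \<le> (\<integral>x. f x \<partial>\<sigma>)" using pos' by (intro integral_nonneg_AE AE_I2) simp
  have I0: "0 \<le> (LINT x:\<Omega>|lborel. f' x v)" by (rule flux_bounds(1)[OF f supp pos'])
  have "ennreal (LINT x:\<Omega>|lborel. f' x v) \<le> ennreal (\<integral>x. f x \<partial>\<sigma>)"
    unfolding J[symmetric] by (rule flux_bounds(2)[OF f supp pos'])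
  then show "(LINT x:\<Omega>|lborel. f' x v) \<le> (\<integral>x. f x \<partial>\<sigma>)" using J0 by simp
  have "ennreal (\<integral>x. f x \<partial>\<sigma>) \<le> ennreal ((1 / sqrt (1 - \<epsilon>\<^sup>2)) powr DIM(real^'n drop_one) * (LINT x:\<Omega>|lborel. f' x v))"
    unfolding J[symmetric] by (rule flux_bounds(3)[OF f supp pos'])
  then have "(\<integral>x. f x \<partial>\<sigma>) \<le> (1 / sqrt (1 - \<epsilon>\<^sup>2)) powr DIM(real^'n drop_one) * (LINT x:\<Omega>|lborel. f' x v)"
    using I0 by (subst (asm) ennreal_le_iff) auto
  moreover have "DIM(real^'n drop_one) = CARD('n) - 1" using CARD_drop_one[OF card] by simp
  then have "(1 / sqrt (1 - \<epsilon>\<^sup>2)) powr DIM(real^'n drop_one) = (1 / sqrt (1 - \<epsilon>\<^sup>2)) ^ (CARD('n) - 1)"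
    using sqrt_pos by (simp only: powr_realpow zero_less_divide_1_iff)
  ultimately show "(\<integral>x. f x \<partial>\<sigma>) \<le> (1 / sqrt (1 - \<epsilon>\<^sup>2)) ^ (CARD('n) - 1) * (LINT x:\<Omega>|lborel. f' x v)"
    by simp
qed

lemma C1_set_integrable:
  "C1_closure \<Omega> f f' \<Longrightarrow> set_integrable lborel \<Omega> (\<lambda>x. f' x v :: 'b::euclidean_space)"
  by (intro set_integrable_continuous_closure op bd C1_closureD(2))

lemma flux_linear:
  assumes f: "C1_closure \<Omega> f (f' :: _ \<Rightarrow> _ \<Rightarrow> real)"
  shows "(LINT x:\<Omega>|lborel. f' x (a *\<^sub>R v + b *\<^sub>R w))
      = a * (LINT x:\<Omega>|lborel. f' x v) + b * (LINT x:\<Omega>|lborel. f' x w)"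
proof -
  have "(LINT x:\<Omega>|lborel. f' x (a *\<^sub>R v + b *\<^sub>R w)) = (LINT x:\<Omega>|lborel. a * f' x v + b * f' x w)"
    using C1_closureD(3)[OF f \<Omega>_sub] op
    by (intro set_lebesgue_integral_cong) (auto simp: linear_add linear_scale)
  also have "\<dots> = a * (LINT x:\<Omega>|lborel. f' x v) + b * (LINT x:\<Omega>|lborel. f' x w)"
    using C1_set_integrable[OF f] by simp
  finally show ?thesis .
qed

text \<open>The upper bound for the flux is used in the tilted direction \<nu>0 + s z, normalised,
  and the lower bound in the direction \<nu>0; the difference isolates the flux in direction z up to
  the error \<eta>/s + s/2.\<close>

lemma flux_normal_tilt:
  fixes f :: "real^'n \<Rightarrow> real"
  assumes p: "norm \<nu>0 = 1" and c: "cone_at \<Omega> p r \<nu>0 \<epsilon>" "0 \<le> \<epsilon>" "\<epsilon> \<le> 1/4" and r: "r' < r"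
    and f: "C1_closure \<Omega> f f'"
    and supp: "\<And>x. x \<in> closure \<Omega> \<Longrightarrow> x \<notin> ball p r' \<Longrightarrow> f x = 0 \<and> f' x = (\<lambda>_. 0)"
    and pos: "\<And>x. x \<in> closure \<Omega> \<Longrightarrow> f x \<ge> 0"
    and z: "norm z = 1" and s: "0 < s" "s \<le> 1/4"
    and \<eta>: "1 - \<eta> \<le> sqrt (1 - \<epsilon>\<^sup>2) ^ (CARD('n) - 1)"
  shows "(LINT x:\<Omega>|lborel. f' x z) - (\<nu>0 \<bullet> z) * (\<integral>x. f x \<partial>\<sigma>) \<le> (\<eta> / s + s / 2) * (\<integral>x. f x \<partial>\<sigma>)"
proof -
  let ?I = "\<lambda>v. LINT x:\<Omega>|lborel. f' x v"
  define J where "J = (\<integral>x. f x \<partial>\<sigma>)"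
  have J0: "0 \<le> J" unfolding J_def using pos frontier_sub by (intro integral_nonneg_AE AE_I2) auto
  \<comment> \<open>Chosen so that |w|^2 = 1 + 2a, whence |w| \<le> 1 + a.\<close>
  define a where "a = s * (\<nu>0 \<bullet> z) + s\<^sup>2 / 2"
  define w where "w = \<nu>0 + s *\<^sub>R z"
  have cz: "\<bar>\<nu>0 \<bullet> z\<bar> \<le> 1" using Cauchy_Schwarz_ineq2[of \<nu>0 z] p z by simp
  have "s * \<bar>\<nu>0 \<bullet> z\<bar> \<le> (1/4) * 1" using cz s by (intro mult_mono) auto
  then have "\<bar>s * (\<nu>0 \<bullet> z)\<bar> \<le> 1/4" using s by (simp add: abs_mult)
  then have a: "a \<ge> -1" using zero_le_power2[of s] unfolding a_def by linarith
  have "(norm w)\<^sup>2 = 1 + 2 * a"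
    using p z unfolding power2_norm_eq_inner w_def a_def
    by (simp add: inner_add_left inner_add_right inner_commute norm_eq_1 power2_eq_square algebra_simps)
  also have "\<dots> \<le> (1 + a)\<^sup>2" by (simp add: power2_eq_square algebra_simps)
  finally have w_le: "norm w \<le> 1 + a" by (rule power2_le_imp_le) (use a in simp)
  have "norm \<nu>0 \<le> norm w + norm (s *\<^sub>R z)" using norm_triangle_ineq4[of w "s *\<^sub>R z"] by (simp add: w_def)
  then have w_ge: "norm w \<ge> 3/4" using p z s by simp
  define v where "v = w /\<^sub>R norm w"
  have "norm w \<noteq> 0" using w_ge by linarith
  then have v: "norm v = 1" "w = norm w *\<^sub>R v" by (simp_all add: v_def)
  \<comment> \<open>Since |w| \<ge> 3/4 and s \<le> 1/4, the component of x - y along \<nu>0 exceeds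
    (9/16 - 1/4)|x - y|, which is at least \<epsilon>|x - y|.\<close>
  have "cone_at \<Omega> p r v (3/4)"
    unfolding cone_at_def
  proof (intro ballI impI)
    fix x y assume x: "x \<in> closure \<Omega> \<inter> ball p r" and y: "y \<in> ball p r"
      and xy: "3/4 * norm (x - y) < (x - y) \<bullet> v"
    have "\<epsilon> * norm (x - y) \<le> 1/4 * norm (x - y)" using c by (intro mult_right_mono) auto
    also have "\<dots> \<le> 3/4 * (3/4 * norm (x - y)) - s * norm (x - y)"
      using mult_right_mono[OF s(2) norm_ge_zero, of "x - y"] norm_ge_zero[of "x - y"] by linarith
    also have "\<dots> \<le> norm w * (3/4 * norm (x - y)) - s * norm (x - y)"
      using mult_right_mono[OF w_ge, of "3/4 * norm (x - y)"] by simp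
    also have "\<dots> < norm w * ((x - y) \<bullet> v) - s * norm (x - y)"
    proof -
      have "norm w > 0" using w_ge by linarith
      from mult_strict_left_mono[OF xy this] show ?thesis by linarith
    qed
    also have "norm w * ((x - y) \<bullet> v) = (x - y) \<bullet> w" using v(2) by (metis inner_scaleR_right)
    also have "\<dots> = (x - y) \<bullet> \<nu>0 + s * ((x - y) \<bullet> z)" by (simp add: w_def inner_add_right)
    also have "s * ((x - y) \<bullet> z) \<le> s * norm (x - y)"
      using norm_cauchy_schwarz[of "x - y" z] z s by (intro mult_left_mono) auto
    finally have "\<epsilon> * norm (x - y) < (x - y) \<bullet> \<nu>0" by linarith
    then show "y \<in> \<Omega>" using c(1) x y unfolding cone_at_def by blast
  qed
  then have Iv: "?I v \<le> J"
    unfolding J_def by (rule flux_surface(1)[OF v(1) _ _ _ r f supp pos]) auto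
  have "?I \<nu>0 + s * ?I z = norm w * ?I v"
    using flux_linear[OF f, of 1 \<nu>0 s z] flux_linear[OF f, of "norm w" v 0 0] v(2) by (simp add: w_def)
  also have "\<dots> \<le> (1 + a) * J"
    using mult_left_mono[OF Iv, of "norm w"] mult_right_mono[OF w_le J0] by simp
  finally have 1: "?I \<nu>0 + s * ?I z \<le> (1 + a) * J" .
  have J_le: "J \<le> (1 / sqrt (1 - \<epsilon>\<^sup>2)) ^ (CARD('n) - 1) * ?I \<nu>0"
    unfolding J_def by (rule flux_surface(2)[OF p c(1,2) _ r f supp pos]) (use c in auto)
  have sq: "sqrt (1 - \<epsilon>\<^sup>2) > 0" using c by (simp add: abs_square_less_1)
  have "(1 - \<eta>) * J \<le> sqrt (1 - \<epsilon>\<^sup>2) ^ (CARD('n) - 1) * J" using \<eta> J0 by (rule mult_right_mono)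
  also have "\<dots> \<le> sqrt (1 - \<epsilon>\<^sup>2) ^ (CARD('n) - 1) * ((1 / sqrt (1 - \<epsilon>\<^sup>2)) ^ (CARD('n) - 1) * ?I \<nu>0)"
    using sq by (intro mult_left_mono J_le) auto
  also have "\<dots> = ?I \<nu>0" using sq by (simp add: power_one_over)
  finally have "s * ?I z \<le> (a + \<eta>) * J" using 1 by (simp add: algebra_simps)
  then have "s * (?I z - (\<nu>0 \<bullet> z) * J) \<le> s * ((\<eta> / s + s / 2) * J)"
    using s by (simp add: a_def algebra_simps power2_eq_square)
  then show ?thesis using s unfolding J_def by simp
qed

text \<open>The radius depends on p and \<kappa> only, not on f or z, so that it can be fixed before
  the partition of unity is chosen.\<close>

lemma local_flux:
  assumes p: "p \<in> closure \<Omega>" and \<kappa>: "\<kappa> > 0"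
  shows "\<exists>R>0. \<forall>(f :: real^'n \<Rightarrow> real) f' (z :: real^'n). C1_closure \<Omega> f f' \<longrightarrow>
     (\<forall>x\<in>closure \<Omega>. x \<notin> ball p R \<longrightarrow> f x = 0 \<and> f' x = (\<lambda>_. 0)) \<longrightarrow> (\<forall>x\<in>closure \<Omega>. f x \<ge> 0) \<longrightarrow> norm z = 1 \<longrightarrow>
     (LINT x:\<Omega>|lborel. f' x z) - (\<integral>x. f x * (\<nu> x \<bullet> z) \<partial>\<sigma>) \<le> \<kappa> * (\<integral>x. f x \<partial>\<sigma>)"
proof (cases "p \<in> \<Omega>")
  case True
  then obtain r where r: "r > 0" "ball p r \<subseteq> \<Omega>" using op open_contains_ball by blast
  show ?thesis
  proof (intro exI[of _ "r/2"] conjI allI impI)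
    fix f :: "real^'n \<Rightarrow> real" and f' and z :: "real^'n"
    assume f: "C1_closure \<Omega> f f'" and supp: "\<forall>x\<in>closure \<Omega>. x \<notin> ball p (r/2) \<longrightarrow> f x = 0 \<and> f' x = (\<lambda>_. 0)"
      and pos: "\<forall>x\<in>closure \<Omega>. f x \<ge> 0" and z: "norm z = 1"
    have "f x = 0" if "x \<in> frontier \<Omega>" for x
    proof -
      have "x \<notin> \<Omega>" using that op by (simp add: frontier_def interior_open)
      then have "x \<notin> ball p (r/2)" using subsetD[OF r(2), of x] r(1) by auto
      then show ?thesis using supp that frontier_sub by auto
    qed
    then have "(\<integral>x. f x * (\<nu> x \<bullet> z) \<partial>\<sigma>) = 0" "(\<integral>x. f x \<partial>\<sigma>) = 0"
      by (auto intro!: integral_eq_zero_AE AE_I2)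
    \<comment> \<open>In a ball inside \<Omega> the cone condition holds for every direction, even
      with \<epsilon> = 0.\<close>
    moreover have "(LINT x:\<Omega>|lborel. f' x z) \<le> (\<integral>x. f x \<partial>\<sigma>)"
      by (rule flux_surface(1)[of z p r 0 "r/2" f f']) (use r f supp pos z in \<open>auto simp: cone_at_def\<close>)
    ultimately show "(LINT x:\<Omega>|lborel. f' x z) - (\<integral>x. f x * (\<nu> x \<bullet> z) \<partial>\<sigma>) \<le> \<kappa> * (\<integral>x. f x \<partial>\<sigma>)"
      by simp
  qed (use r in simp)
next
  case False
  then have pf: "p \<in> frontier \<Omega>" using p closure_cases by blast
  \<comment> \<open>Half of \<kappa> is spent on the tilt, where \<eta>/s = \<kappa>/4 and s/2 \<le>
    \<kappa>/4, and half on the oscillation of \<nu> near p.\<close>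
  define s where "s = min (1/4) (\<kappa>/2)"
  have s: "s > 0" "s \<le> 1/4" "s \<le> \<kappa>/2" using \<kappa> by (auto simp: s_def)
  let ?m = "CARD('n) - 1"
  \<comment> \<open>Makes (n - 1) \<epsilon>^2 \<le> \<eta>, which is what Bernoulli's inequality
    asks for; \<open>Suc\<close> keeps the denominator visibly positive.\<close>
  define \<epsilon> where "\<epsilon> = min (1/4) (s * \<kappa> / (4 * real (Suc ?m)))"
  have \<epsilon>: "\<epsilon> > 0" "\<epsilon> \<le> 1/4" using s \<kappa> by (auto simp: \<epsilon>_def)
  define \<eta> where "\<eta> = s * \<kappa> / 4"
  have \<eta>: "1 - \<eta> \<le> sqrt (1 - \<epsilon>\<^sup>2) ^ ?m"
  proof -
    have e2: "\<epsilon>\<^sup>2 \<le> \<epsilon>" using \<epsilon> mult_right_mono[of \<epsilon> 1 \<epsilon>] by (simp add: power2_eq_square)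
    have "real ?m * \<epsilon>\<^sup>2 \<le> real (Suc ?m) * (s * \<kappa> / (4 * real (Suc ?m)))"
      using e2 \<epsilon> by (intro mult_mono) (auto simp: \<epsilon>_def)
    also have "\<dots> = \<eta>" by (simp add: \<eta>_def)
    finally have "1 - \<eta> \<le> 1 + real ?m * (- \<epsilon>\<^sup>2)" by simp
    also have "\<dots> \<le> (1 + (- \<epsilon>\<^sup>2)) ^ ?m" using e2 \<epsilon> by (intro Bernoulli_inequality) auto
    also have "\<dots> \<le> sqrt (1 - \<epsilon>\<^sup>2) ^ ?m"
    proof (intro power_mono)
      show "1 + (- \<epsilon>\<^sup>2) \<le> sqrt (1 - \<epsilon>\<^sup>2)"
        using e2 \<epsilon> mult_left_le[of "1 - \<epsilon>\<^sup>2" "1 - \<epsilon>\<^sup>2"]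
        by (intro real_le_rsqrt) (simp add: power2_eq_square[of "1 - \<epsilon>\<^sup>2"])
    qed (use e2 \<epsilon> in auto)
    finally show ?thesis .
  qed
  obtain r where r: "r > 0" "cone_at \<Omega> p r (\<nu> p) \<epsilon>" using cone[OF pf \<epsilon>(1)] by auto
  obtain d where d: "d > 0" "\<And>x. x \<in> frontier \<Omega> \<Longrightarrow> dist x p < d \<Longrightarrow> dist (\<nu> x) (\<nu> p) < \<kappa>/2"
    using \<nu>_cont pf \<kappa> unfolding continuous_on_iff by (metis half_gt_zero)
  define R where "R = min (r/2) d"
  show ?thesis
  proof (intro exI[of _ R] conjI allI impI)
    fix f :: "real^'n \<Rightarrow> real" and f' and z :: "real^'n"
    assume f: "C1_closure \<Omega> f f'" and supp: "\<forall>x\<in>closure \<Omega>. x \<notin> ball p R \<longrightarrow> f x = 0 \<and> f' x = (\<lambda>_. 0)"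
      and pos: "\<forall>x\<in>closure \<Omega>. f x \<ge> 0" and z: "norm z = 1"
    let ?J = "\<integral>x. f x \<partial>\<sigma>"
    have J0: "0 \<le> ?J" using pos frontier_sub by (intro integral_nonneg_AE AE_I2) auto
    have 1: "(LINT x:\<Omega>|lborel. f' x z) - (\<nu> p \<bullet> z) * ?J \<le> (\<eta> / s + s / 2) * ?J"
      by (rule flux_normal_tilt[OF norm_\<nu>[OF pf] r(2) _ \<epsilon>(2) _ f _ _ z s(1,2) \<eta>, of R])
         (use \<epsilon> r supp pos in \<open>auto simp: R_def\<close>)
    have "\<eta> / s + s / 2 \<le> \<kappa> / 2" using s by (simp add: \<eta>_def)
    from mult_right_mono[OF this J0] 1
    have 1: "(LINT x:\<Omega>|lborel. f' x z) - (\<nu> p \<bullet> z) * ?J \<le> \<kappa> / 2 * ?J" by linarith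
    have fc: "continuous_on (frontier \<Omega>) f"
      by (rule continuous_on_subset[OF C1_closureD(1)[OF f] frontier_sub])
    have "(\<nu> p \<bullet> z) * ?J - (\<integral>x. f x * (\<nu> x \<bullet> z) \<partial>\<sigma>) = (\<integral>x. (\<nu> p \<bullet> z) * f x - f x * (\<nu> x \<bullet> z) \<partial>\<sigma>)"
      using fc \<nu>_cont by (subst Bochner_Integration.integral_diff) (auto intro!: integrable_\<sigma> continuous_intros)
    also have "\<dots> \<le> (\<integral>x. \<kappa> / 2 * f x \<partial>\<sigma>)"
    proof (rule integral_mono)
      fix x assume "x \<in> space \<sigma>"
      then have x: "x \<in> frontier \<Omega>" by simp
      show "(\<nu> p \<bullet> z) * f x - f x * (\<nu> x \<bullet> z) \<le> \<kappa> / 2 * f x"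
      proof (cases "x \<in> ball p R")
        case True
        then have "dist (\<nu> x) (\<nu> p) < \<kappa>/2" using d(2)[OF x] by (simp add: R_def dist_commute)
        then have "(\<nu> p - \<nu> x) \<bullet> z \<le> \<kappa>/2"
          using norm_cauchy_schwarz[of "\<nu> p - \<nu> x" z] z by (simp add: dist_norm norm_minus_commute)
        from mult_right_mono[OF this, of "f x"] show ?thesis
          using pos x frontier_sub by (auto simp: inner_diff_left algebra_simps)
      next
        case False
        then show ?thesis using supp x frontier_sub by auto
      qed
    qed (use fc \<nu>_cont in \<open>auto intro!: integrable_\<sigma> continuous_intros\<close>)
    also have "\<dots> = \<kappa> / 2 * ?J" by simp
    finally show "(LINT x:\<Omega>|lborel. f' x z) - (\<integral>x. f x * (\<nu> x \<bullet> z) \<partial>\<sigma>) \<le> \<kappa> * ?J"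
      using 1 by (simp add: algebra_simps)
  qed (use r d in \<open>auto simp: R_def\<close>)
qed

end

context cone_domain
begin

text \<open>The errors of the pieces are \<kappa> times their surface integrals. As the pieces are
  nonnegative multiples of f and add up to f, the total error is \<kappa> times the integral of f,
  however many pieces there are.\<close>

lemma flux_le:
  fixes f :: "real^'n \<Rightarrow> real"
  assumes f: "C1_closure \<Omega> f f'" and pos: "\<And>x. x \<in> closure \<Omega> \<Longrightarrow> f x \<ge> 0" and z: "norm z = 1"
  shows "(LINT x:\<Omega>|lborel. f' x z) \<le> (\<integral>x. f x * (\<nu> x \<bullet> z) \<partial>\<sigma>)"
proof -
  have step: "(LINT x:\<Omega>|lborel. f' x z) - (\<integral>x. f x * (\<nu> x \<bullet> z) \<partial>\<sigma>) \<le> \<kappa> * (\<integral>x. f x \<partial>\<sigma>)" if "\<kappa> > 0" for \<kappa>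
  proof -
    have "\<forall>p\<in>closure \<Omega>. \<exists>R. R > 0 \<and> (\<forall>(f :: real^'n \<Rightarrow> real) f' (z :: real^'n). C1_closure \<Omega> f f' \<longrightarrow>
       (\<forall>x\<in>closure \<Omega>. x \<notin> ball p R \<longrightarrow> f x = 0 \<and> f' x = (\<lambda>_. 0)) \<longrightarrow> (\<forall>x\<in>closure \<Omega>. f x \<ge> 0) \<longrightarrow> norm z = 1 \<longrightarrow>
       (LINT x:\<Omega>|lborel. f' x z) - (\<integral>x. f x * (\<nu> x \<bullet> z) \<partial>\<sigma>) \<le> \<kappa> * (\<integral>x. f x \<partial>\<sigma>))"
      using local_flux that by (intro ballI)
    from bchoice[OF this] obtain R where *: "\<forall>p\<in>closure \<Omega>. R p > 0 \<and> (\<forall>(f :: real^'n \<Rightarrow> real) f' (z :: real^'n). C1_closure \<Omega> f f' \<longrightarrow>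
       (\<forall>x\<in>closure \<Omega>. x \<notin> ball p (R p) \<longrightarrow> f x = 0 \<and> f' x = (\<lambda>_. 0)) \<longrightarrow> (\<forall>x\<in>closure \<Omega>. f x \<ge> 0) \<longrightarrow> norm z = 1 \<longrightarrow>
       (LINT x:\<Omega>|lborel. f' x z) - (\<integral>x. f x * (\<nu> x \<bullet> z) \<partial>\<sigma>) \<le> \<kappa> * (\<integral>x. f x \<partial>\<sigma>))"
      by (elim exE)
    note R = bspec[OF *, THEN conjunct1]
    note flux = bspec[OF *, THEN conjunct2, rule_format]
    obtain P \<theta> h h' where P: "finite P" "P \<subseteq> closure \<Omega>"
      and h: "\<And>p. p \<in> P \<Longrightarrow> C1_closure \<Omega> (h p) (h' p)"
      and supp: "\<And>p x. p \<in> P \<Longrightarrow> x \<in> closure \<Omega> \<Longrightarrow> x \<notin> ball p (R p) \<Longrightarrow> h p x = 0 \<and> h' p x = (\<lambda>_. 0)"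
      and h_eq: "\<And>p x. p \<in> P \<Longrightarrow> x \<in> closure \<Omega> \<Longrightarrow> h p x = \<theta> p x *\<^sub>R f x \<and> \<theta> p x \<ge> (0::real)"
      and sum: "\<And>x. x \<in> closure \<Omega> \<Longrightarrow> f x = (\<Sum>p\<in>P. h p x)"
      and sum': "\<And>x v. x \<in> \<Omega> \<Longrightarrow> f' x v = (\<Sum>p\<in>P. h' p x v)"
      by (rule C1_closure_localize[where R=R, OF op bd f]) (erule R, rule that, assumption+)
    have hc: "continuous_on (frontier \<Omega>) (h p)" if "p \<in> P" for p
      by (rule continuous_on_subset[OF C1_closureD(1)[OF h[OF that]] frontier_sub])
    have "(LINT x:\<Omega>|lborel. f' x z) = (LINT x:\<Omega>|lborel. \<Sum>p\<in>P. h' p x z)"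
      using op sum' by (intro set_lebesgue_integral_cong) auto
    also have "\<dots> = (\<Sum>p\<in>P. LINT x:\<Omega>|lborel. h' p x z)"
      unfolding set_lebesgue_integral_def scaleR_sum_right
      using C1_set_integrable[OF h] by (intro Bochner_Integration.integral_sum) (auto simp: set_integrable_def)
    finally have 1: "(LINT x:\<Omega>|lborel. f' x z) = (\<Sum>p\<in>P. LINT x:\<Omega>|lborel. h' p x z)" .
    have 2: "(\<integral>x. f x * (\<nu> x \<bullet> z) \<partial>\<sigma>) = (\<Sum>p\<in>P. \<integral>x. h p x * (\<nu> x \<bullet> z) \<partial>\<sigma>)"
    proof -
      have "(\<integral>x. f x * (\<nu> x \<bullet> z) \<partial>\<sigma>) = (\<integral>x. (\<Sum>p\<in>P. h p x * (\<nu> x \<bullet> z)) \<partial>\<sigma>)"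
        using sum frontier_sub by (intro Bochner_Integration.integral_cong) (auto simp: sum_distrib_right)
      also have "\<dots> = (\<Sum>p\<in>P. \<integral>x. h p x * (\<nu> x \<bullet> z) \<partial>\<sigma>)"
        using hc \<nu>_cont
        by (intro Bochner_Integration.integral_sum integrable_\<sigma>) (auto intro!: continuous_intros)
      finally show ?thesis .
    qed
    have 3: "(\<integral>x. f x \<partial>\<sigma>) = (\<Sum>p\<in>P. \<integral>x. h p x \<partial>\<sigma>)"
    proof -
      have "(\<integral>x. f x \<partial>\<sigma>) = (\<integral>x. (\<Sum>p\<in>P. h p x) \<partial>\<sigma>)"
        using sum frontier_sub by (intro Bochner_Integration.integral_cong) auto
      also have "\<dots> = (\<Sum>p\<in>P. \<integral>x. h p x \<partial>\<sigma>)"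
        using hc by (intro Bochner_Integration.integral_sum integrable_\<sigma>) auto
      finally show ?thesis .
    qed
    have "(LINT x:\<Omega>|lborel. h' p x z) - (\<integral>x. h p x * (\<nu> x \<bullet> z) \<partial>\<sigma>) \<le> \<kappa> * (\<integral>x. h p x \<partial>\<sigma>)" if p: "p \<in> P" for p
    proof (rule flux[of p])
      show "h p x = 0 \<and> h' p x = (\<lambda>_. 0)" if "x \<in> closure \<Omega>" "x \<notin> ball p (R p)" for x
        by (rule supp[OF p that])
      show "0 \<le> h p x" if "x \<in> closure \<Omega>" for x using h_eq[OF p that] pos[OF that] by simp
    qed (use p P h z in auto)
    then have "(\<Sum>p\<in>P. (LINT x:\<Omega>|lborel. h' p x z) - (\<integral>x. h p x * (\<nu> x \<bullet> z) \<partial>\<sigma>)) \<le> (\<Sum>p\<in>P. \<kappa> * (\<integral>x. h p x \<partial>\<sigma>))"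
      by (rule sum_mono)
    then show ?thesis by (simp only: 1 2 3 sum_subtractf sum_distrib_left)
  qed
  have J0: "0 \<le> (\<integral>x. f x \<partial>\<sigma>)" using pos frontier_sub by (intro integral_nonneg_AE AE_I2) auto
  have "(LINT x:\<Omega>|lborel. f' x z) - (\<integral>x. f x * (\<nu> x \<bullet> z) \<partial>\<sigma>) \<le> 0"
  proof (rule field_le_epsilon)
    fix e :: real assume e: "e > 0"
    let ?J = "\<integral>x. f x \<partial>\<sigma>"
    have "(LINT x:\<Omega>|lborel. f' x z) - (\<integral>x. f x * (\<nu> x \<bullet> z) \<partial>\<sigma>) \<le> e / (?J + 1) * ?J"
      using e J0 by (intro step) simp
    also have "\<dots> \<le> e" using e J0 by (simp add: field_simps)
    finally show "(LINT x:\<Omega>|lborel. f' x z) - (\<integral>x. f x * (\<nu> x \<bullet> z) \<partial>\<sigma>) \<le> 0 + e" by simp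
  qed
  then show ?thesis by simp
qed

text \<open>For nonnegative f the opposite inequality is \<open>flux_le\<close> for -z. A general f
  is made nonnegative by adding a constant.\<close>

theorem divergence_theorem:
  fixes f :: "real^'n \<Rightarrow> real"
  assumes f: "C1_closure \<Omega> f f'" and z: "norm z = 1"
  shows "(LINT x:\<Omega>|lborel. f' x z) = (\<integral>x. f x * (\<nu> x \<bullet> z) \<partial>\<sigma>)"
proof -
  have nonneg: "(LINT x:\<Omega>|lborel. f' x z) = (\<integral>x. f x * (\<nu> x \<bullet> z) \<partial>\<sigma>)"
    if f: "C1_closure \<Omega> f f'" and pos: "\<And>x. x \<in> closure \<Omega> \<Longrightarrow> f x \<ge> 0" for f :: "real^'n \<Rightarrow> real" and f'
  proof (rule antisym)
    have "(LINT x:\<Omega>|lborel. f' x (- z)) \<le> (\<integral>x. f x * (\<nu> x \<bullet> (- z)) \<partial>\<sigma>)"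
      using z by (intro flux_le f pos) auto
    moreover have "(LINT x:\<Omega>|lborel. f' x (- z)) = - (LINT x:\<Omega>|lborel. f' x z)"
      using flux_linear[OF f, of "-1" z 0 0] by simp
    ultimately show "(\<integral>x. f x * (\<nu> x \<bullet> z) \<partial>\<sigma>) \<le> (LINT x:\<Omega>|lborel. f' x z)" by simp
  qed (rule flux_le[OF f pos z])
  have "bounded (f ` closure \<Omega>)"
    by (intro compact_imp_bounded compact_continuous_image C1_closureD(1)[OF f] compact_closure_\<Omega>)
  then obtain B where B: "\<And>x. x \<in> closure \<Omega> \<Longrightarrow> \<bar>f x\<bar> \<le> B" by (auto simp: bounded_iff)
  have fc: "continuous_on (frontier \<Omega>) f"
    by (rule continuous_on_subset[OF C1_closureD(1)[OF f] frontier_sub])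
  have "(LINT x:\<Omega>|lborel. f' x z) = (LINT x:\<Omega>|lborel. f' x z + 0)" by simp
  also have "\<dots> = (\<integral>x. (f x + B) * (\<nu> x \<bullet> z) \<partial>\<sigma>)"
    by (rule nonneg[OF C1_closure_add[OF f C1_closure_const[of _ B]]])
       (use B in \<open>force simp: abs_le_iff\<close>)
  also have "\<dots> = (\<integral>x. f x * (\<nu> x \<bullet> z) + B * (1 * (\<nu> x \<bullet> z)) \<partial>\<sigma>)" by (simp add: algebra_simps)
  also have "\<dots> = (\<integral>x. f x * (\<nu> x \<bullet> z) \<partial>\<sigma>) + B * (\<integral>x. 1 * (\<nu> x \<bullet> z) \<partial>\<sigma>)"
    using fc \<nu>_cont by (subst Bochner_Integration.integral_add) (auto intro!: integrable_\<sigma> continuous_intros)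
  \<comment> \<open>The nonnegative case for the constant 1, whose derivative is zero, removes the
    contribution of B.\<close>
  also have "(\<integral>x. 1 * (\<nu> x \<bullet> z) \<partial>\<sigma>) = 0"
    using nonneg[OF C1_closure_const[of _ 1]] by simp
  finally show ?thesis by simp
qed

end

section \<open>Averages of C1 functions along paths\<close>

lemma norm_integral_diff_le:
  fixes F :: "real \<Rightarrow> 'b::euclidean_space"
  assumes F: "continuous_on {0..1} F" and bnd: "\<And>t. t \<in> {0..1} \<Longrightarrow> norm (F t - c) \<le> e"
  shows "norm (integral {0..1} F - c) \<le> e"
proof -
  have "integral {0..1} F - c = integral {0..1} (\<lambda>t. F t - c)"
    using integrable_continuous_real[OF F] by (subst integral_diff) auto
  also have "norm \<dots> \<le> e * (1 - 0)"
    by (rule integral_bound) (use F bnd in \<open>auto intro!: continuous_intros\<close>)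
  finally show ?thesis by simp
qed

text \<open>The path translates points of the closure into \<Omega>, so at frontier points too the
  average samples h only where it is differentiable. The derivative is taken under the integral
  sign.\<close>

lemma path_average:
  fixes h :: "'a::euclidean_space \<Rightarrow> 'b::euclidean_space" and \<gamma> :: "real \<Rightarrow> 'a"
  assumes op: "open \<Omega>" and h: "C1_closure \<Omega> h h'" and U: "open U" and \<gamma>: "continuous_on {0..1} \<gamma>"
    and inw: "\<And>x t. x \<in> closure \<Omega> \<inter> U \<Longrightarrow> t \<in> {0..1} \<Longrightarrow> x + \<gamma> t \<in> \<Omega>"
  defines "M \<equiv> \<lambda>x. integral {0..1} (\<lambda>t. h (x + \<gamma> t))"
    and "M' \<equiv> \<lambda>x v. integral {0..1} (\<lambda>t. h' (x + \<gamma> t) v)"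
  shows "continuous_on (closure \<Omega> \<inter> U) M" "continuous_on (closure \<Omega> \<inter> U) (\<lambda>x. M' x v)"
    "x \<in> closure \<Omega> \<inter> U \<Longrightarrow> linear (M' x)"
    "x \<in> \<Omega> \<inter> U \<Longrightarrow> (M has_derivative M' x) (at x)"
proof -
  let ?Z = "closure \<Omega> \<inter> U"
  have cl: "x \<in> closure \<Omega>" if "x \<in> \<Omega>" for x using that closure_subset by blast
  have comp: "continuous_on (?Z \<times> {0..1}) (\<lambda>(x, t). F (x + \<gamma> t))"
    if "continuous_on (closure \<Omega>) F" for F :: "'a \<Rightarrow> 'c::topological_space"
  proof -
    have 1: "continuous_on (?Z \<times> {0..1}) (\<lambda>z. fst z + \<gamma> (snd z))"
      by (intro continuous_intros continuous_on_compose2[OF \<gamma>]) auto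
    have "continuous_on (?Z \<times> {0..1}) (\<lambda>z. F (fst z + \<gamma> (snd z)))"
      by (rule continuous_on_compose2[OF that 1]) (use inw cl in auto)
    then show ?thesis by (simp add: case_prod_beta)
  qed
  have comp1: "continuous_on {0..1} (\<lambda>t. F (x + \<gamma> t))"
    if "continuous_on (closure \<Omega>) F" "x \<in> ?Z" for F :: "'a \<Rightarrow> 'b" and x
    by (rule continuous_on_compose2[OF that(1)]) (use \<gamma> inw[OF that(2)] cl in \<open>auto intro!: continuous_intros\<close>)
  show "continuous_on ?Z M"
    unfolding M_def using comp[OF C1_closureD(1)[OF h]]
    by (intro integral_continuous_on_param[of _ 0 "1::real", unfolded cbox_interval])
  show "continuous_on ?Z (\<lambda>x. M' x v)" for v
    unfolding M'_def using comp[OF C1_closureD(2)[OF h, of v]]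
    by (intro integral_continuous_on_param[of _ 0 "1::real", unfolded cbox_interval])
  have int': "(\<lambda>t. h' (x + \<gamma> t) v) integrable_on {0..1}" if "x \<in> ?Z" for x v
    by (intro integrable_continuous_real comp1 C1_closureD(2)[OF h] that)
  show lin: "linear (M' x)" if x: "x \<in> ?Z" for x
  proof (rule linearI)
    have l: "linear (h' (x + \<gamma> t))" if "t \<in> {0..1}" for t
      using C1_closureD(3)[OF h cl[OF inw[OF x that]]] .
    show "M' x (v + w) = M' x v + M' x w" for v w
      unfolding M'_def integral_add[OF int'[OF x] int'[OF x], symmetric]
      by (rule integral_cong) (simp add: linear_add[OF l])
    show "M' x (c *\<^sub>R v) = c *\<^sub>R M' x v" for c v
      unfolding M'_def integral_cmul[symmetric]
      by (rule integral_cong) (simp add: linear_scale[OF l])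
  qed
  show "(M has_derivative M' x) (at x)" if x: "x \<in> \<Omega> \<inter> U" for x
  proof -
    obtain e where e: "e > 0" "ball x e \<subseteq> \<Omega> \<inter> U"
      using openE[OF open_Int[OF op U] x] by blast
    have sub: "y \<in> ?Z" if "y \<in> ball x e" for y using subsetD[OF e(2) that] cl by blast
    \<comment> \<open>The Leibniz rule asks for a continuous family of bounded linear maps, so the
      directionwise derivative is packaged accordingly.\<close>
    define fx where "fx = (\<lambda>y t. Blinfun (h' (y + \<gamma> t)))"
    have fx: "blinfun_apply (fx y t) = h' (y + \<gamma> t)" if "y \<in> ball x e" "t \<in> {0..1}" for y t
      unfolding fx_def
      using C1_closureD(3)[OF h cl[OF inw[OF sub[OF that(1)] that(2)]]]
      by (intro bounded_linear_Blinfun_apply) (simp add: linear_conv_bounded_linear)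
    have "(M has_derivative blinfun_apply (integral (cbox 0 1) (fx x))) (at x within ball x e)"
      unfolding M_def cbox_interval[symmetric]
    proof (rule leibniz_rule)
      fix y and t :: real assume y: "y \<in> ball x e" and t: "t \<in> cbox 0 1"
      have "(h has_derivative h' (y + \<gamma> t)) (at (y + \<gamma> t))"
        using C1_closureD(4)[OF h inw[OF sub[OF y]]] t by auto
      moreover have "((\<lambda>y. y + \<gamma> t) has_derivative (\<lambda>v. v)) (at y within ball x e)"
        by (auto intro!: derivative_eq_intros)
      ultimately have "((\<lambda>y. h (y + \<gamma> t)) has_derivative (\<lambda>v. h' (y + \<gamma> t) v)) (at y within ball x e)"
        using has_derivative_compose by blast
      then show "((\<lambda>y. h (y + \<gamma> t)) has_derivative blinfun_apply (fx y t)) (at y within ball x e)"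
        using fx[OF y, of t] t by simp
    next
      fix y assume y: "y \<in> ball x e"
      show "(\<lambda>t. h (y + \<gamma> t)) integrable_on cbox 0 1"
        using integrable_continuous_real[OF comp1[OF C1_closureD(1)[OF h] sub[OF y]]] by simp
    next
      show "continuous_on (ball x e \<times> cbox 0 1) (\<lambda>(y, t). fx y t)"
      proof (rule continuous_on_blinfun_componentwise)
        fix i :: 'a
        have "continuous_on (ball x e \<times> {0..1}) (\<lambda>(y, t). h' (y + \<gamma> t) i)"
          by (rule continuous_on_subset[OF comp[OF C1_closureD(2)[OF h]]]) (use sub in auto)
        moreover have "(case z of (y, t) \<Rightarrow> h' (y + \<gamma> t) i) = blinfun_apply (case z of (y, t) \<Rightarrow> fx y t) i"
          if "z \<in> ball x e \<times> {0..1}" for z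
          using that fx by (cases z) auto
        ultimately show "continuous_on (ball x e \<times> cbox 0 1) (\<lambda>z. blinfun_apply (case z of (y, t) \<Rightarrow> fx y t) i)"
          by (simp cong: continuous_on_cong)
      qed
    qed (use e in auto)
    moreover have "blinfun_apply (integral (cbox 0 1) (fx x)) = M' x"
    proof
      fix v
      have x': "x \<in> ball x e" using e by simp
      have "continuous_on {0..1} (fx x)"
      proof (rule continuous_on_blinfun_componentwise)
        fix i :: 'a
        show "continuous_on {0..1} (\<lambda>t. blinfun_apply (fx x t) i)"
          by (rule continuous_on_eq[OF comp1[OF C1_closureD(2)[OF h, of i] sub[OF x']]]) (simp add: fx[OF x'])
      qed
      then have "fx x integrable_on {0..1}" by (rule integrable_continuous_real)
      then have "blinfun_apply (integral {0..1} (fx x)) v = integral {0..1} (\<lambda>t. blinfun_apply (fx x t) v)"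
        using integral_linear[of "fx x" "{0..1}" "\<lambda>B. blinfun_apply B v"] blinfun.bounded_linear_left
        by (simp add: o_def)
      also have "\<dots> = M' x v" unfolding M'_def by (rule integral_cong) (simp add: fx[OF x'])
      finally show "blinfun_apply (integral (cbox 0 1) (fx x)) v = M' x v" by simp
    qed
    ultimately show ?thesis using e by (simp add: at_within_open[of x "ball x e"])
  qed
qed

section \<open>The null Lagrangian identity\<close>

text \<open>The difference quotient of \<open>h\<close> in direction \<open>e\<^sub>2\<close> with step \<open>\<delta>\<close>, averaged over a segment of
  length \<open>\<delta>\<close> in direction \<open>e\<^sub>1\<close>: the derivative in direction \<open>e\<^sub>1\<close> is then symmetric in \<open>e\<^sub>1\<close>
  and \<open>e\<^sub>2\<close>, although \<open>h\<close> need not have second derivatives.\<close>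
definition steklov :: "('a::real_vector \<Rightarrow> 'b::euclidean_space) \<Rightarrow> real \<Rightarrow> 'a \<Rightarrow> 'a \<Rightarrow> 'a \<Rightarrow> 'a \<Rightarrow> 'b" where
  "steklov h \<delta> w e1 e2 x = (1 / \<delta>) *\<^sub>R
     (integral {0..1} (\<lambda>a. h (x + (w + (a * \<delta>) *\<^sub>R e1 + \<delta> *\<^sub>R e2)))
      - integral {0..1} (\<lambda>a. h (x + (w + (a * \<delta>) *\<^sub>R e1))))"

lemma segment_ftc:
  fixes h :: "'a::euclidean_space \<Rightarrow> 'b::euclidean_space"
  assumes h: "C1_closure \<Omega> h h'" and \<delta>: "\<delta> > 0"
    and inw: "\<And>a. a \<in> {0..1} \<Longrightarrow> y + (a * \<delta>) *\<^sub>R e \<in> \<Omega>"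
  shows "integral {0..1} (\<lambda>a. h' (y + (a * \<delta>) *\<^sub>R e) e) = (1 / \<delta>) *\<^sub>R (h (y + \<delta> *\<^sub>R e) - h y)"
proof -
  have cl: "x \<in> closure \<Omega>" if "x \<in> \<Omega>" for x using that closure_subset by blast
  have "((\<lambda>a. \<delta> *\<^sub>R h' (y + (a * \<delta>) *\<^sub>R e) e) has_integral (h (y + (1 * \<delta>) *\<^sub>R e) - h (y + (0 * \<delta>) *\<^sub>R e))) {0..1}"
  proof (rule fundamental_theorem_of_calculus)
    fix a :: real assume a: "a \<in> {0..1}"
    have "((\<lambda>a. y + (a * \<delta>) *\<^sub>R e) has_derivative (\<lambda>t. (t * \<delta>) *\<^sub>R e)) (at a within {0..1})"
      by (auto intro!: derivative_eq_intros)
    from has_derivative_compose[OF this C1_closureD(4)[OF h inw[OF a]]]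
    have "((\<lambda>a. h (y + (a * \<delta>) *\<^sub>R e)) has_derivative (\<lambda>t. h' (y + (a * \<delta>) *\<^sub>R e) ((t * \<delta>) *\<^sub>R e))) (at a within {0..1})" .
    then show "((\<lambda>a. h (y + (a * \<delta>) *\<^sub>R e)) has_vector_derivative \<delta> *\<^sub>R h' (y + (a * \<delta>) *\<^sub>R e) e) (at a within {0..1})"
      using C1_closureD(3)[OF h cl[OF inw[OF a]]] by (simp add: has_vector_derivative_def linear_scale)
  qed simp
  then have "((\<lambda>a. (1 / \<delta>) *\<^sub>R \<delta> *\<^sub>R h' (y + (a * \<delta>) *\<^sub>R e) e) has_integral (1 / \<delta>) *\<^sub>R (h (y + \<delta> *\<^sub>R e) - h y)) {0..1}"
    by (intro has_integral_cmul) simp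
  then show ?thesis using \<delta> by (simp add: integral_unique)
qed

text \<open>By the fundamental theorem in direction e2 the average is a mean of
  \<open>h' _ e2\<close> over a parallelogram, hence close to \<open>h' x e2\<close>. By the same
  theorem in direction e1 its derivative along e1 is a second difference of h, which is symmetric in
  e1 and e2.\<close>

lemma steklov_properties:
  fixes h :: "'a::euclidean_space \<Rightarrow> 'b::euclidean_space"
  assumes op: "open \<Omega>" and h: "C1_closure \<Omega> h h'" and U: "open U" and \<delta>: "\<delta> > 0"
    and inw: "\<And>x a b. x \<in> closure \<Omega> \<inter> U \<Longrightarrow> a \<in> {0..1} \<Longrightarrow> b \<in> {0..1} \<Longrightarrow>
                x + (w + (a * \<delta>) *\<^sub>R e1 + (b * \<delta>) *\<^sub>R e2) \<in> \<Omega>"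
    and unif: "\<And>x a b. x \<in> closure \<Omega> \<inter> U \<Longrightarrow> a \<in> {0..1} \<Longrightarrow> b \<in> {0..1} \<Longrightarrow>
                norm (h' (x + (w + (a * \<delta>) *\<^sub>R e1 + (b * \<delta>) *\<^sub>R e2)) e2 - h' x e2) \<le> e"
  obtains k' where "continuous_on (closure \<Omega> \<inter> U) (steklov h \<delta> w e1 e2)"
    "\<And>v. continuous_on (closure \<Omega> \<inter> U) (\<lambda>x. k' x v)"
    "\<And>x. x \<in> closure \<Omega> \<inter> U \<Longrightarrow> linear (k' x)"
    "\<And>x. x \<in> \<Omega> \<inter> U \<Longrightarrow> (steklov h \<delta> w e1 e2 has_derivative k' x) (at x)"
    "\<And>x. x \<in> closure \<Omega> \<inter> U \<Longrightarrow> k' x e1 = (1 / \<delta>\<^sup>2) *\<^sub>R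
        (h (x + w + \<delta> *\<^sub>R e1 + \<delta> *\<^sub>R e2) - h (x + w + \<delta> *\<^sub>R e2) - (h (x + w + \<delta> *\<^sub>R e1) - h (x + w)))"
    "\<And>x. x \<in> closure \<Omega> \<inter> U \<Longrightarrow> norm (steklov h \<delta> w e1 e2 x - h' x e2) \<le> e"
proof -
  have cl: "x \<in> closure \<Omega>" if "x \<in> \<Omega>" for x using that closure_subset by blast
  define \<gamma>1 where "\<gamma>1 = (\<lambda>a. w + (a * \<delta>) *\<^sub>R e1 + \<delta> *\<^sub>R e2)"
  define \<gamma>0 where "\<gamma>0 = (\<lambda>a. w + (a * \<delta>) *\<^sub>R e1)"
  have c1: "continuous_on S \<gamma>1" and c0: "continuous_on S \<gamma>0" for S
    unfolding \<gamma>1_def \<gamma>0_def by (intro continuous_intros)+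
  have i1: "x + \<gamma>1 a \<in> \<Omega>" if "x \<in> closure \<Omega> \<inter> U" "a \<in> {0..1}" for x a
    using inw[OF that, of 1] by (simp add: \<gamma>1_def)
  have i0: "x + \<gamma>0 a \<in> \<Omega>" if "x \<in> closure \<Omega> \<inter> U" "a \<in> {0..1}" for x a
    using inw[OF that, of 0] by (simp add: \<gamma>0_def)
  note A1 = path_average[OF op h U c1 i1]
  note A0 = path_average[OF op h U c0 i0]
  have k_eq: "steklov h \<delta> w e1 e2 = (\<lambda>x. (1 / \<delta>) *\<^sub>R
      (integral {0..1} (\<lambda>a. h (x + \<gamma>1 a)) - integral {0..1} (\<lambda>a. h (x + \<gamma>0 a))))"
    by (rule ext) (simp add: steklov_def \<gamma>1_def \<gamma>0_def)
  define k' where "k' = (\<lambda>x v. (1 / \<delta>) *\<^sub>R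
      (integral {0..1} (\<lambda>a. h' (x + \<gamma>1 a) v) - integral {0..1} (\<lambda>a. h' (x + \<gamma>0 a) v)))"
  show ?thesis
  proof (rule that[of k'])
    show "continuous_on (closure \<Omega> \<inter> U) (steklov h \<delta> w e1 e2)"
      unfolding k_eq by (intro continuous_on_scaleR continuous_on_const continuous_on_diff A1(1) A0(1))
    show "continuous_on (closure \<Omega> \<inter> U) (\<lambda>x. k' x v)" for v
      unfolding k'_def by (intro continuous_on_scaleR continuous_on_const continuous_on_diff A1(2) A0(2))
    show "linear (k' x)" if "x \<in> closure \<Omega> \<inter> U" for x
      unfolding k'_def by (intro linear_compose_scale_right linear_compose_sub A1(3) A0(3) that)
    show "(steklov h \<delta> w e1 e2 has_derivative k' x) (at x)" if "x \<in> \<Omega> \<inter> U" for x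
      unfolding k_eq k'_def by (intro has_derivative_scaleR_right has_derivative_diff A1(4) A0(4) that)
    fix x assume x: "x \<in> closure \<Omega> \<inter> U"
    have "integral {0..1} (\<lambda>a. h' ((x + w + \<delta> *\<^sub>R e2) + (a * \<delta>) *\<^sub>R e1) e1)
        = (1 / \<delta>) *\<^sub>R (h ((x + w + \<delta> *\<^sub>R e2) + \<delta> *\<^sub>R e1) - h (x + w + \<delta> *\<^sub>R e2))"
      using i1[OF x] by (intro segment_ftc[OF h \<delta>]) (simp add: \<gamma>1_def algebra_simps)
    moreover have "integral {0..1} (\<lambda>a. h' ((x + w) + (a * \<delta>) *\<^sub>R e1) e1)
        = (1 / \<delta>) *\<^sub>R (h ((x + w) + \<delta> *\<^sub>R e1) - h (x + w))"
      using i0[OF x] by (intro segment_ftc[OF h \<delta>]) (simp add: \<gamma>0_def algebra_simps)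
    moreover have "(\<lambda>a. h' (x + \<gamma>1 a) e1) = (\<lambda>a. h' ((x + w + \<delta> *\<^sub>R e2) + (a * \<delta>) *\<^sub>R e1) e1)"
      "(\<lambda>a. h' (x + \<gamma>0 a) e1) = (\<lambda>a. h' ((x + w) + (a * \<delta>) *\<^sub>R e1) e1)"
      by (simp_all add: \<gamma>1_def \<gamma>0_def add_ac)
    ultimately have "k' x e1 = (1 / \<delta>) *\<^sub>R ((1 / \<delta>) *\<^sub>R (h ((x + w + \<delta> *\<^sub>R e2) + \<delta> *\<^sub>R e1) - h (x + w + \<delta> *\<^sub>R e2))
        - (1 / \<delta>) *\<^sub>R (h ((x + w) + \<delta> *\<^sub>R e1) - h (x + w)))"
      by (simp only: k'_def)
    then show "k' x e1 = (1 / \<delta>\<^sup>2) *\<^sub>R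
        (h (x + w + \<delta> *\<^sub>R e1 + \<delta> *\<^sub>R e2) - h (x + w + \<delta> *\<^sub>R e2) - (h (x + w + \<delta> *\<^sub>R e1) - h (x + w)))"
      by (simp add: scaleR_diff_right[symmetric] power2_eq_square add_ac)
    \<comment> \<open>For fixed a the difference quotient is again an average over b, so the
      estimate for averages is applied twice, first in a and then in b.\<close>
    define D where "D = (\<lambda>a. (1 / \<delta>) *\<^sub>R (h (x + \<gamma>1 a) - h (x + \<gamma>0 a)))"
    have hc: "continuous_on {0..1} (\<lambda>a. h (x + \<gamma>1 a))" "continuous_on {0..1} (\<lambda>a. h (x + \<gamma>0 a))"
      by (rule continuous_on_compose2[OF C1_closureD(1)[OF h]];
          use c1 c0 i1[OF x] i0[OF x] cl in \<open>auto intro!: continuous_intros\<close>)+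
    have "steklov h \<delta> w e1 e2 x = integral {0..1} D"
      unfolding k_eq D_def using integral_diff[OF hc[THEN integrable_continuous_real]] by simp
    also have "norm (\<dots> - h' x e2) \<le> e"
    proof (rule norm_integral_diff_le)
      show "continuous_on {0..1} D" unfolding D_def using hc by (intro continuous_intros)
      fix a :: real assume a: "a \<in> {0..1}"
      have inw': "(x + \<gamma>0 a) + (b * \<delta>) *\<^sub>R e2 \<in> \<Omega>" if "b \<in> {0..1}" for b
        using inw[OF x a that] by (simp add: \<gamma>0_def add_ac)
      have "D a = integral {0..1} (\<lambda>b. h' ((x + \<gamma>0 a) + (b * \<delta>) *\<^sub>R e2) e2)"
      proof -
        have "integral {0..1} (\<lambda>b. h' ((x + \<gamma>0 a) + (b * \<delta>) *\<^sub>R e2) e2)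
            = (1 / \<delta>) *\<^sub>R (h ((x + \<gamma>0 a) + \<delta> *\<^sub>R e2) - h (x + \<gamma>0 a))"
          by (rule segment_ftc[OF h \<delta> inw'])
        then show ?thesis by (simp add: D_def \<gamma>0_def \<gamma>1_def add.assoc)
      qed
      also have "norm (\<dots> - h' x e2) \<le> e"
      proof (rule norm_integral_diff_le)
        show "continuous_on {0..1} (\<lambda>b. h' ((x + \<gamma>0 a) + (b * \<delta>) *\<^sub>R e2) e2)"
          by (rule continuous_on_compose2[OF C1_closureD(2)[OF h, of e2]])
             (use inw' cl in \<open>auto intro!: continuous_intros\<close>)
        show "norm (h' ((x + \<gamma>0 a) + (b * \<delta>) *\<^sub>R e2) e2 - h' x e2) \<le> e" if "b \<in> {0..1}" for b
          using unif[OF x a that] by (simp add: \<gamma>0_def add_ac)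
      qed
      finally show "norm (D a - h' x e2) \<le> e" .
    qed
    finally show "norm (steklov h \<delta> w e1 e2 x - h' x e2) \<le> e" .
  qed
qed

context cone_domain
begin

text \<open>If h were C2, the integrand would be the derivative along e1 of <f, d_e2 h> minus the
  derivative along e2 of <f, d_e1 h>; \<open>skew_boundary\<close> is the corresponding boundary
  integral.\<close>

definition skew_bulk :: "(real^'n \<Rightarrow> real^'n \<Rightarrow> 'b::euclidean_space) \<Rightarrow> (real^'n \<Rightarrow> real^'n \<Rightarrow> 'b) \<Rightarrow> real^'n \<Rightarrow> real^'n \<Rightarrow> real" where
  "skew_bulk f' h' e1 e2 = (LINT x:\<Omega>|lborel. f' x e1 \<bullet> h' x e2 - f' x e2 \<bullet> h' x e1)"

definition skew_boundary :: "(real^'n \<Rightarrow> 'b::euclidean_space) \<Rightarrow> (real^'n \<Rightarrow> real^'n \<Rightarrow> 'b) \<Rightarrow> real^'n \<Rightarrow> real^'n \<Rightarrow> real" where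
  "skew_boundary f h' e1 e2 = (\<integral>x. f x \<bullet> ((\<nu> x \<bullet> e1) *\<^sub>R h' x e2 - (\<nu> x \<bullet> e2) *\<^sub>R h' x e1) \<partial>\<sigma>)"

text \<open>The inward shift by 4 \<delta> dominates two edges of length at most \<delta>: the
  displacement is at most 6 \<delta>, its component along -\<nu>0 at least 2 \<delta> > (1/4) 6
  \<delta>. With \<delta> \<le> r/24 a point within 3r/4 of p stays within r.\<close>

lemma cone_at_inward:
  assumes c: "cone_at \<Omega> p r \<nu>0 (1/4)" and "norm \<nu>0 = 1" "norm e1 = 1" "norm e2 = 1"
    and x: "x \<in> closure \<Omega>" "x \<in> ball p (3 * r / 4)" and \<delta>: "0 < \<delta>" "\<delta> \<le> r / 24"
    and ab: "a \<in> {0..1}" "b \<in> {0..1}"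
  defines "y \<equiv> x + ((- 4 * \<delta>) *\<^sub>R \<nu>0 + (a * \<delta>) *\<^sub>R e1 + (b * \<delta>) *\<^sub>R e2)"
  shows "y \<in> \<Omega>" "dist y x \<le> 6 * \<delta>"
proof -
  have xy: "x - y = (4 * \<delta>) *\<^sub>R \<nu>0 - (a * \<delta>) *\<^sub>R e1 - (b * \<delta>) *\<^sub>R e2" by (simp add: y_def)
  have "norm (x - y) \<le> norm ((4 * \<delta>) *\<^sub>R \<nu>0) + norm ((a * \<delta>) *\<^sub>R e1) + norm ((b * \<delta>) *\<^sub>R e2)"
    unfolding xy using norm_triangle_ineq4[of "(4 * \<delta>) *\<^sub>R \<nu>0 - (a * \<delta>) *\<^sub>R e1" "(b * \<delta>) *\<^sub>R e2"]
      norm_triangle_ineq4[of "(4 * \<delta>) *\<^sub>R \<nu>0" "(a * \<delta>) *\<^sub>R e1"] by linarith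
  also have "\<dots> = 4 * \<delta> + a * \<delta> + b * \<delta>" using assms by (simp add: abs_mult)
  also have "\<dots> \<le> 4 * \<delta> + 1 * \<delta> + 1 * \<delta>" using ab \<delta> by (intro add_mono mult_right_mono) auto
  finally have n: "norm (x - y) \<le> 6 * \<delta>" by simp
  then show "dist y x \<le> 6 * \<delta>" by (simp add: dist_norm norm_minus_commute)
  have inn: "u \<bullet> \<nu>0 \<le> 1" if "norm u = 1" for u
    using norm_cauchy_schwarz[of u \<nu>0] that assms(2) by simp
  have "(a * \<delta>) * (e1 \<bullet> \<nu>0) \<le> \<delta>" "(b * \<delta>) * (e2 \<bullet> \<nu>0) \<le> \<delta>"
  proof -
    have *: "(t * \<delta>) * q \<le> \<delta>" if "t \<in> {0..1}" "q \<le> 1" for t q :: real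
    proof -
      have "(t * \<delta>) * q \<le> (t * \<delta>) * 1" using that \<delta> by (intro mult_left_mono) auto
      also have "\<dots> \<le> 1 * \<delta>" using that \<delta> by (simp add: mult_right_le_one_le mult_left_le_one_le)
      finally show ?thesis by simp
    qed
    show "(a * \<delta>) * (e1 \<bullet> \<nu>0) \<le> \<delta>" "(b * \<delta>) * (e2 \<bullet> \<nu>0) \<le> \<delta>"
      using * ab inn assms(3,4) by blast+
  qed
  moreover have "(x - y) \<bullet> \<nu>0 = 4 * \<delta> - (a * \<delta>) * (e1 \<bullet> \<nu>0) - (b * \<delta>) * (e2 \<bullet> \<nu>0)"
    using assms(2) by (simp add: xy inner_diff_left norm_eq_1)
  ultimately have "1/4 * norm (x - y) < (x - y) \<bullet> \<nu>0" using n \<delta> by linarith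
  moreover have "x \<in> ball p r" using x(2) \<delta> by auto
  moreover have "y \<in> ball p r"
    using dist_triangle[of p y x] x(2) n \<delta> by (simp add: dist_norm)
  ultimately show "y \<in> \<Omega>" using c x(1) unfolding cone_at_def by blast
qed

text \<open>The derivatives of h along e2 and e1 are replaced by averages \<open>k2\<close> and
  \<open>k1\<close> with equal mixed derivatives. For these the divergence theorem applies to <f,
  k2> and <f, k1>, and the terms containing derivatives of the averages cancel. The replacement
  costs \<epsilon> (A + B), where A and B depend on f only.\<close>

lemma skew_local:
  fixes h :: "real^'n \<Rightarrow> 'b::euclidean_space"
  assumes h: "C1_closure \<Omega> h h'" and p: "p \<in> closure \<Omega>" and e: "norm e1 = 1" "norm e2 = 1"
  shows "\<exists>R>0. \<forall>f f'. C1_closure \<Omega> f f' \<longrightarrow> (\<forall>x\<in>closure \<Omega>. x \<notin> ball p R \<longrightarrow> f x = 0 \<and> f' x = (\<lambda>_. 0)) \<longrightarrow>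
     skew_bulk f' h' e1 e2 = skew_boundary f h' e1 e2"
proof -
  obtain r \<nu>0 where r: "r > 0" "norm \<nu>0 = 1" "cone_at \<Omega> p r \<nu>0 (1/4)"
  proof (cases "p \<in> \<Omega>")
    case True
    then obtain r where "r > 0" "ball p r \<subseteq> \<Omega>" using op open_contains_ball by blast
    \<comment> \<open>Inside \<Omega> the shift may go in any direction; e1 serves as a unit vector
      at hand.\<close>
    then show ?thesis using that[of r e1] e by (auto simp: cone_at_def)
  next
    case False
    then have "p \<in> frontier \<Omega>" using p closure_cases by blast
    then show ?thesis using cone[of p "1/4"] norm_\<nu> that by auto
  qed
  show ?thesis
  proof (intro exI[of _ "r/2"] conjI allI impI)
    fix f :: "real^'n \<Rightarrow> 'b" and f'
    assume f: "C1_closure \<Omega> f f'"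
      and supp: "\<forall>x\<in>closure \<Omega>. x \<notin> ball p (r/2) \<longrightarrow> f x = 0 \<and> f' x = (\<lambda>_. 0)"
    \<comment> \<open>Between the support radius r/2 and the cone radius r: room for extending by
      zero on one side and for the translations on the other.\<close>
    define U where "U = ball p (3 * r / 4)"
    have U: "open U" "cball p (r/2) \<subseteq> U" using r by (auto simp: U_def)
    have suppC: "f x = 0 \<and> f' x = (\<lambda>_. 0)" if "x \<in> closure \<Omega>" "x \<notin> cball p (r/2)" for x
      using supp that by auto
    have suppU: "f x = 0 \<and> f' x = (\<lambda>_. 0)" if "x \<in> closure \<Omega>" "x \<notin> U" for x
      using suppC[OF that(1)] that(2) U(2) by blast
    have fc: "continuous_on (frontier \<Omega>) f"
      by (rule continuous_on_subset[OF C1_closureD(1)[OF f] frontier_sub])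
    have h'c: "continuous_on (frontier \<Omega>) (\<lambda>x. h' x v)" for v
      by (rule continuous_on_subset[OF C1_closureD(2)[OF h] frontier_sub])
    define A where "A = (LINT x:\<Omega>|lborel. norm (f' x e1) + norm (f' x e2))"
    define B where "B = (\<integral>x. 2 * norm (f x) \<partial>\<sigma>)"
    have est: "\<bar>skew_bulk f' h' e1 e2 - skew_boundary f h' e1 e2\<bar> \<le> \<epsilon> * (A + B)" if \<epsilon>: "\<epsilon> > 0" for \<epsilon>
    proof -
      have "\<exists>d>0. \<forall>x\<in>closure \<Omega>. \<forall>y\<in>closure \<Omega>. dist y x < d \<longrightarrow> dist (h' y v) (h' x v) < \<epsilon>" for v
        using compact_uniformly_continuous[OF C1_closureD(2)[OF h, of v] compact_closure_\<Omega>] \<epsilon>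
        unfolding uniformly_continuous_on_def by blast
      then obtain d where d: "\<And>v. d v > 0"
        "\<And>v x y. x \<in> closure \<Omega> \<Longrightarrow> y \<in> closure \<Omega> \<Longrightarrow> dist y x < d v \<Longrightarrow> dist (h' y v) (h' x v) < \<epsilon>"
        by metis
      \<comment> \<open>Dividing by 7 makes the displacement bound 6 \<delta> strictly smaller than
        the moduli of uniform continuity.\<close>
      define \<delta> where "\<delta> = Min {r / 24, d e1 / 7, d e2 / 7}"
      have \<delta>: "\<delta> > 0" "\<delta> \<le> r / 24" "6 * \<delta> < d e1" "6 * \<delta> < d e2"
        using r d(1)[of e1] d(1)[of e2] by (auto simp: \<delta>_def)
      define w where "w = (- 4 * \<delta>) *\<^sub>R \<nu>0"
      have inw: "x + (w + (a * \<delta>) *\<^sub>R e1 + (b * \<delta>) *\<^sub>R e2) \<in> \<Omega>"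
        "dist (x + (w + (a * \<delta>) *\<^sub>R e1 + (b * \<delta>) *\<^sub>R e2)) x \<le> 6 * \<delta>"
        if "x \<in> closure \<Omega> \<inter> U" "a \<in> {0..1}" "b \<in> {0..1}" for x a b
        using cone_at_inward[OF r(3,2) e, of x \<delta> a b] that \<delta> unfolding w_def U_def by auto
      have unif: "norm (h' (x + (w + (a * \<delta>) *\<^sub>R e1 + (b * \<delta>) *\<^sub>R e2)) v - h' x v) \<le> \<epsilon>"
        if "x \<in> closure \<Omega> \<inter> U" "a \<in> {0..1}" "b \<in> {0..1}" "6 * \<delta> < d v" for x a b v
        using d(2)[of x "x + (w + (a * \<delta>) *\<^sub>R e1 + (b * \<delta>) *\<^sub>R e2)" v] inw[OF that(1-3)] that(1,4) \<Omega>_sub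
        by (auto simp: dist_norm intro: less_imp_le)
      note unif2 = unif[OF _ _ _ \<delta>(4)]
      have swap: "w + s *\<^sub>R e2 + t *\<^sub>R e1 = w + t *\<^sub>R e1 + s *\<^sub>R e2" for s t by simp
      have inw_swap: "x + (w + (a * \<delta>) *\<^sub>R e2 + (b * \<delta>) *\<^sub>R e1) \<in> \<Omega>"
        and unif1: "norm (h' (x + (w + (a * \<delta>) *\<^sub>R e2 + (b * \<delta>) *\<^sub>R e1)) e1 - h' x e1) \<le> \<epsilon>"
        if "x \<in> closure \<Omega> \<inter> U" "a \<in> {0..1}" "b \<in> {0..1}" for x a b
        unfolding swap by (rule inw(1)[OF that(1,3,2)], rule unif[OF that(1,3,2) \<delta>(3)])
      define k2 where "k2 = steklov h \<delta> w e1 e2"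
      define k1 where "k1 = steklov h \<delta> w e2 e1"
      obtain k2' where k2: "continuous_on (closure \<Omega> \<inter> U) k2"
          "\<And>v. continuous_on (closure \<Omega> \<inter> U) (\<lambda>x. k2' x v)"
          "\<And>x. x \<in> closure \<Omega> \<inter> U \<Longrightarrow> linear (k2' x)"
          "\<And>x. x \<in> \<Omega> \<inter> U \<Longrightarrow> (k2 has_derivative k2' x) (at x)"
        and k2_e1: "\<And>x. x \<in> closure \<Omega> \<inter> U \<Longrightarrow> k2' x e1 = (1 / \<delta>\<^sup>2) *\<^sub>R
          (h (x + w + \<delta> *\<^sub>R e1 + \<delta> *\<^sub>R e2) - h (x + w + \<delta> *\<^sub>R e2) - (h (x + w + \<delta> *\<^sub>R e1) - h (x + w)))"
        and k2_near: "\<And>x. x \<in> closure \<Omega> \<inter> U \<Longrightarrow> norm (k2 x - h' x e2) \<le> \<epsilon>"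
      proof (rule steklov_properties[OF op h U(1) \<delta>(1), of w e1 e2 \<epsilon>, folded k2_def])
        show "x + (w + (a * \<delta>) *\<^sub>R e1 + (b * \<delta>) *\<^sub>R e2) \<in> \<Omega>"
          "norm (h' (x + (w + (a * \<delta>) *\<^sub>R e1 + (b * \<delta>) *\<^sub>R e2)) e2 - h' x e2) \<le> \<epsilon>"
          if "x \<in> closure \<Omega> \<inter> U" "a \<in> {0..1}" "b \<in> {0..1}" for x a b
          by (rule inw(1)[OF that], rule unif2[OF that])
      qed (rule that)
      obtain k1' where k1: "continuous_on (closure \<Omega> \<inter> U) k1"
          "\<And>v. continuous_on (closure \<Omega> \<inter> U) (\<lambda>x. k1' x v)"
          "\<And>x. x \<in> closure \<Omega> \<inter> U \<Longrightarrow> linear (k1' x)"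
          "\<And>x. x \<in> \<Omega> \<inter> U \<Longrightarrow> (k1 has_derivative k1' x) (at x)"
        and k1_e2: "\<And>x. x \<in> closure \<Omega> \<inter> U \<Longrightarrow> k1' x e2 = (1 / \<delta>\<^sup>2) *\<^sub>R
          (h (x + w + \<delta> *\<^sub>R e2 + \<delta> *\<^sub>R e1) - h (x + w + \<delta> *\<^sub>R e1) - (h (x + w + \<delta> *\<^sub>R e2) - h (x + w)))"
        and k1_near: "\<And>x. x \<in> closure \<Omega> \<inter> U \<Longrightarrow> norm (k1 x - h' x e1) \<le> \<epsilon>"
      proof (rule steklov_properties[OF op h U(1) \<delta>(1), of w e2 e1 \<epsilon>, folded k1_def])
        show "x + (w + (a * \<delta>) *\<^sub>R e2 + (b * \<delta>) *\<^sub>R e1) \<in> \<Omega>"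
          "norm (h' (x + (w + (a * \<delta>) *\<^sub>R e2 + (b * \<delta>) *\<^sub>R e1)) e1 - h' x e1) \<le> \<epsilon>"
          if "x \<in> closure \<Omega> \<inter> U" "a \<in> {0..1}" "b \<in> {0..1}" for x a b
          by (rule inw_swap[OF that], rule unif1[OF that])
      qed (rule that)
      \<comment> \<open>Both sides are the same second difference of h over the parallelogram; it
        stands in for the equality of mixed second derivatives.\<close>
      have sym: "k2' x e1 = k1' x e2" if "x \<in> closure \<Omega> \<inter> U" for x
        unfolding k2_e1[OF that] k1_e2[OF that] by (simp add: add_ac)
      \<comment> \<open>The averages are regular on U only; the product with f extends by zero, as f
        is supported in a smaller closed ball.\<close>
      note loc = bounded_bilinear.C1_closure_prod_local[OF bounded_bilinear_inner op f U(1) closed_cball U(2) suppC]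
      have C2: "C1_closure \<Omega> (\<lambda>x. f x \<bullet> k2 x) (\<lambda>x v. f x \<bullet> k2' x v + f' x v \<bullet> k2 x)"
        by (rule loc) (use k2 in auto)
      have C1: "C1_closure \<Omega> (\<lambda>x. f x \<bullet> k1 x) (\<lambda>x v. f x \<bullet> k1' x v + f' x v \<bullet> k1 x)"
        by (rule loc) (use k1 in auto)
      have "(LINT x:\<Omega>|lborel. f' x e1 \<bullet> k2 x - f' x e2 \<bullet> k1 x)
          = (LINT x:\<Omega>|lborel. (f x \<bullet> k2' x e1 + f' x e1 \<bullet> k2 x) - (f x \<bullet> k1' x e2 + f' x e2 \<bullet> k1 x))"
      proof (intro set_lebesgue_integral_cong allI impI)
        fix x assume x: "x \<in> \<Omega>"
        show "f' x e1 \<bullet> k2 x - f' x e2 \<bullet> k1 x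
          = (f x \<bullet> k2' x e1 + f' x e1 \<bullet> k2 x) - (f x \<bullet> k1' x e2 + f' x e2 \<bullet> k1 x)"
          using sym[of x] suppU[OF \<Omega>_sub[OF x]] \<Omega>_sub[OF x] by (cases "x \<in> U") auto
      qed (use op in simp)
      also have "\<dots> = (\<integral>x. (f x \<bullet> k2 x) * (\<nu> x \<bullet> e1) \<partial>\<sigma>) - (\<integral>x. (f x \<bullet> k1 x) * (\<nu> x \<bullet> e2) \<partial>\<sigma>)"
        using divergence_theorem[OF C2 e(1)] divergence_theorem[OF C1 e(2)]
          C1_set_integrable[OF C2] C1_set_integrable[OF C1] by (simp add: set_integral_diff)
      also have "\<dots> = (\<integral>x. (f x \<bullet> k2 x) * (\<nu> x \<bullet> e1) - (f x \<bullet> k1 x) * (\<nu> x \<bullet> e2) \<partial>\<sigma>)"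
        using continuous_on_subset[OF C1_closureD(1)[OF C2] frontier_sub]
          continuous_on_subset[OF C1_closureD(1)[OF C1] frontier_sub] \<nu>_cont
        by (intro Bochner_Integration.integral_diff[symmetric] integrable_\<sigma>) (auto intro!: continuous_intros)
      finally have main: "(LINT x:\<Omega>|lborel. f' x e1 \<bullet> k2 x - f' x e2 \<bullet> k1 x)
        = (\<integral>x. (f x \<bullet> k2 x) * (\<nu> x \<bullet> e1) - (f x \<bullet> k1 x) * (\<nu> x \<bullet> e2) \<partial>\<sigma>)" .
      have f'k: "set_integrable lborel \<Omega> (\<lambda>x. f' x v \<bullet> k x)" if "continuous_on (closure \<Omega> \<inter> U) k" for v k
      proof (intro set_integrable_continuous_closure op bd)
        show "continuous_on (closure \<Omega>) (\<lambda>x. f' x v \<bullet> k x)"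
          by (rule continuous_on_glue_zero[OF U(1) closed_cball U(2)])
             (use suppC that C1_closureD(2)[OF f, of v] in
               \<open>auto intro!: continuous_on_inner intro: continuous_on_subset\<close>)
      qed
      have h'U: "continuous_on (closure \<Omega> \<inter> U) (\<lambda>x. h' x v)" for v
        by (rule continuous_on_subset[OF C1_closureD(2)[OF h]]) auto
      note int = set_integral_diff(1)[OF f'k f'k]
      have nf: "set_integrable lborel \<Omega> (\<lambda>x. norm (f' x e1) + norm (f' x e2))"
        by (intro set_integrable_continuous_closure op bd continuous_on_add continuous_on_norm C1_closureD(2)[OF f])
      let ?p = "\<lambda>x. f' x e1 \<bullet> h' x e2 - f' x e2 \<bullet> h' x e1"
      let ?q = "\<lambda>x. f' x e1 \<bullet> k2 x - f' x e2 \<bullet> k1 x"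
      note pq = set_integral_diff[OF int[OF h'U h'U] int[OF k2(1) k1(1)]]
      have "\<bar>skew_bulk f' h' e1 e2 - (LINT x:\<Omega>|lborel. ?q x)\<bar>
          = \<bar>LINT x:\<Omega>|lborel. ?p x - ?q x\<bar>"
        unfolding skew_bulk_def by (subst pq(2)) simp
      also have "\<dots> \<le> (LINT x:\<Omega>|lborel. \<bar>?p x - ?q x\<bar>)"
        using set_integral_norm_bound[OF pq(1)] by simp
      also have "\<dots> \<le> (LINT x:\<Omega>|lborel. \<epsilon> * (norm (f' x e1) + norm (f' x e2)))"
      proof (rule set_integral_mono)
        show "set_integrable lborel \<Omega> (\<lambda>x. \<bar>?p x - ?q x\<bar>)"
          by (rule set_integrable_abs[OF pq(1)])
        show "set_integrable lborel \<Omega> (\<lambda>x. \<epsilon> * (norm (f' x e1) + norm (f' x e2)))"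
          using nf by simp
        fix x assume x: "x \<in> \<Omega>"
        show "\<bar>?p x - ?q x\<bar>
            \<le> \<epsilon> * (norm (f' x e1) + norm (f' x e2))"
        proof (cases "x \<in> U")
          case True
          then have xU: "x \<in> closure \<Omega> \<inter> U" using \<Omega>_sub[OF x] by simp
          have "\<bar>f' x e1 \<bullet> (k2 x - h' x e2)\<bar> \<le> norm (f' x e1) * \<epsilon>"
            by (rule order_trans[OF Cauchy_Schwarz_ineq2 mult_left_mono[OF k2_near[OF xU]]]) simp
          moreover have "\<bar>f' x e2 \<bullet> (k1 x - h' x e1)\<bar> \<le> norm (f' x e2) * \<epsilon>"
            by (rule order_trans[OF Cauchy_Schwarz_ineq2 mult_left_mono[OF k1_near[OF xU]]]) simp
          ultimately show ?thesis by (simp add: inner_diff_right algebra_simps)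
        next
          case False
          then show ?thesis using suppU[OF \<Omega>_sub[OF x]] \<epsilon> by simp
        qed
      qed
      also have "\<dots> = \<epsilon> * A" by (simp add: A_def)
      finally have 1: "\<bar>skew_bulk f' h' e1 e2 - (LINT x:\<Omega>|lborel. ?q x)\<bar> \<le> \<epsilon> * A" .
      let ?b = "\<lambda>x. (f x \<bullet> k2 x) * (\<nu> x \<bullet> e1) - (f x \<bullet> k1 x) * (\<nu> x \<bullet> e2)"
      let ?c = "\<lambda>x. f x \<bullet> ((\<nu> x \<bullet> e1) *\<^sub>R h' x e2 - (\<nu> x \<bullet> e2) *\<^sub>R h' x e1)"
      have b: "integrable \<sigma> ?b"
        using continuous_on_subset[OF C1_closureD(1)[OF C2] frontier_sub]
          continuous_on_subset[OF C1_closureD(1)[OF C1] frontier_sub] \<nu>_cont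
        by (intro integrable_\<sigma>) (auto intro!: continuous_intros)
      have c: "integrable \<sigma> ?c"
        using fc h'c \<nu>_cont by (intro integrable_\<sigma>) (auto intro!: continuous_intros)
      have "\<bar>(\<integral>x. ?b x \<partial>\<sigma>) - skew_boundary f h' e1 e2\<bar> = \<bar>\<integral>x. ?b x - ?c x \<partial>\<sigma>\<bar>"
        unfolding skew_boundary_def by (subst Bochner_Integration.integral_diff[OF b c]) simp
      also have "\<dots> \<le> (\<integral>x. \<bar>?b x - ?c x\<bar> \<partial>\<sigma>)" by (rule integral_abs_bound)
      also have "\<dots> \<le> (\<integral>x. \<epsilon> * (2 * norm (f x)) \<partial>\<sigma>)"
      proof (rule integral_mono)
        show "integrable \<sigma> (\<lambda>x. \<bar>?b x - ?c x\<bar>)" using b c by simp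
        show "integrable \<sigma> (\<lambda>x. \<epsilon> * (2 * norm (f x)))"
          using fc by (intro integrable_\<sigma>) (auto intro!: continuous_intros)
        fix x assume "x \<in> space \<sigma>"
        then have x: "x \<in> frontier \<Omega>" "x \<in> closure \<Omega>" using frontier_sub by auto
        show "\<bar>?b x - ?c x\<bar> \<le> \<epsilon> * (2 * norm (f x))"
        proof (cases "x \<in> U")
          case True
          then have xU: "x \<in> closure \<Omega> \<inter> U" using x by simp
          have \<nu>1: "\<bar>\<nu> x \<bullet> v\<bar> \<le> 1" if "norm v = 1" for v
            using Cauchy_Schwarz_ineq2[of "\<nu> x" v] that norm_\<nu>[OF x(1)] by simp
          have "\<bar>(\<nu> x \<bullet> e1) * (f x \<bullet> (k2 x - h' x e2))\<bar> \<le> 1 * (norm (f x) * \<epsilon>)"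
            unfolding abs_mult
            by (intro mult_mono \<nu>1 e order_trans[OF Cauchy_Schwarz_ineq2 mult_left_mono[OF k2_near[OF xU]]]) auto
          moreover have "\<bar>(\<nu> x \<bullet> e2) * (f x \<bullet> (k1 x - h' x e1))\<bar> \<le> 1 * (norm (f x) * \<epsilon>)"
            unfolding abs_mult
            by (intro mult_mono \<nu>1 e order_trans[OF Cauchy_Schwarz_ineq2 mult_left_mono[OF k1_near[OF xU]]]) auto
          moreover have "?b x - ?c x = (\<nu> x \<bullet> e1) * (f x \<bullet> (k2 x - h' x e2)) - (\<nu> x \<bullet> e2) * (f x \<bullet> (k1 x - h' x e1))"
            by (simp add: inner_diff_right algebra_simps)
          ultimately show ?thesis by (simp add: algebra_simps)
        next
          case False
          then show ?thesis using suppU[OF x(2)] \<epsilon> by simp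
        qed
      qed
      also have "\<dots> = \<epsilon> * B" by (simp add: B_def)
      finally have 2: "\<bar>(\<integral>x. ?b x \<partial>\<sigma>) - skew_boundary f h' e1 e2\<bar> \<le> \<epsilon> * B" .
      have "\<epsilon> * (A + B) = \<epsilon> * A + \<epsilon> * B" by (simp add: distrib_left)
      then show ?thesis using 1 2 main by linarith
    qed
    have "skew_bulk f' h' e1 e2 - skew_boundary f h' e1 e2 = 0"
    proof (rule ccontr)
      let ?D = "\<bar>skew_bulk f' h' e1 e2 - skew_boundary f h' e1 e2\<bar>"
      assume "skew_bulk f' h' e1 e2 - skew_boundary f h' e1 e2 \<noteq> 0"
      then have D: "?D > 0" by simp
      define X where "X = \<bar>A + B\<bar> + 1"
      have X: "X > 0" unfolding X_def by (intro add_nonneg_pos) auto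
      have "?D \<le> ?D / (2 * X) * (A + B)" by (rule est) (use D X in simp)
      also have "\<dots> \<le> ?D / (2 * X) * X"
        using X by (intro mult_left_mono) (auto simp: X_def)
      also have "\<dots> = ?D / 2" using X by simp
      finally show False using D by simp
    qed
    then show "skew_bulk f' h' e1 e2 = skew_boundary f h' e1 e2" by simp
  qed (use r in simp)
qed

end

context cone_domain
begin

lemma skew_integrable:
  assumes f: "C1_closure \<Omega> f f'" and h: "C1_closure \<Omega> h (h' :: _ \<Rightarrow> _ \<Rightarrow> 'b::euclidean_space)"
  shows "set_integrable lborel \<Omega> (\<lambda>x. f' x e1 \<bullet> h' x e2 - f' x e2 \<bullet> h' x e1)"
    "integrable \<sigma> (\<lambda>x. f x \<bullet> ((\<nu> x \<bullet> e1) *\<^sub>R h' x e2 - (\<nu> x \<bullet> e2) *\<^sub>R h' x e1))"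
proof -
  show "set_integrable lborel \<Omega> (\<lambda>x. f' x e1 \<bullet> h' x e2 - f' x e2 \<bullet> h' x e1)"
    by (intro set_integrable_continuous_closure op bd continuous_on_diff continuous_on_inner
        C1_closureD(2)[OF f] C1_closureD(2)[OF h])
  have c: "continuous_on (frontier \<Omega>) f" "continuous_on (frontier \<Omega>) (\<lambda>x. h' x v)" for v
    by (rule continuous_on_subset[OF C1_closureD(1)[OF f] frontier_sub],
        rule continuous_on_subset[OF C1_closureD(2)[OF h] frontier_sub])
  then show "integrable \<sigma> (\<lambda>x. f x \<bullet> ((\<nu> x \<bullet> e1) *\<^sub>R h' x e2 - (\<nu> x \<bullet> e2) *\<^sub>R h' x e1))"
    using \<nu>_cont by (intro integrable_\<sigma> continuous_intros)
qed

text \<open>Both sides are linear in f for fixed h, so only f is decomposed by a partition of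
  unity.\<close>

theorem skew_identity:
  fixes f h :: "real^'n \<Rightarrow> 'b::euclidean_space"
  assumes f: "C1_closure \<Omega> f f'" and h: "C1_closure \<Omega> h h'" and e: "norm e1 = 1" "norm e2 = 1"
  shows "skew_bulk f' h' e1 e2 = skew_boundary f h' e1 e2"
proof -
  have "\<forall>p\<in>closure \<Omega>. \<exists>R. R > 0 \<and> (\<forall>f f'. C1_closure \<Omega> f f' \<longrightarrow>
      (\<forall>x\<in>closure \<Omega>. x \<notin> ball p R \<longrightarrow> f x = 0 \<and> f' x = (\<lambda>_. 0)) \<longrightarrow>
      skew_bulk f' h' e1 e2 = skew_boundary f h' e1 e2)"
    using skew_local[OF h _ e] by (intro ballI)
  from bchoice[OF this] obtain R where *: "\<forall>p\<in>closure \<Omega>. R p > 0 \<and> (\<forall>f f'. C1_closure \<Omega> f f' \<longrightarrow>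
      (\<forall>x\<in>closure \<Omega>. x \<notin> ball p (R p) \<longrightarrow> f x = 0 \<and> f' x = (\<lambda>_. 0)) \<longrightarrow>
      skew_bulk f' h' e1 e2 = skew_boundary f h' e1 e2)"
    by (elim exE)
  note R = bspec[OF *, THEN conjunct1]
  note loc = bspec[OF *, THEN conjunct2, rule_format]
  obtain P \<theta> k k' where P: "finite P" "P \<subseteq> closure \<Omega>"
    and k: "\<And>p. p \<in> P \<Longrightarrow> C1_closure \<Omega> (k p) (k' p)"
    and supp: "\<And>p x. p \<in> P \<Longrightarrow> x \<in> closure \<Omega> \<Longrightarrow> x \<notin> ball p (R p) \<Longrightarrow> k p x = 0 \<and> k' p x = (\<lambda>_. 0)"
    and k_eq: "\<And>p x. p \<in> P \<Longrightarrow> x \<in> closure \<Omega> \<Longrightarrow> k p x = \<theta> p x *\<^sub>R f x \<and> \<theta> p x \<ge> (0::real)"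
    and sum: "\<And>x. x \<in> closure \<Omega> \<Longrightarrow> f x = (\<Sum>p\<in>P. k p x)"
    and sum': "\<And>x v. x \<in> \<Omega> \<Longrightarrow> f' x v = (\<Sum>p\<in>P. k' p x v)"
    by (rule C1_closure_localize[where R=R, OF op bd f]) (erule R, rule that, assumption+)
  have "skew_bulk f' h' e1 e2 = (LINT x:\<Omega>|lborel. \<Sum>p\<in>P. k' p x e1 \<bullet> h' x e2 - k' p x e2 \<bullet> h' x e1)"
    unfolding skew_bulk_def using op sum'
    by (intro set_lebesgue_integral_cong) (auto simp: inner_sum_left sum_subtractf)
  also have "\<dots> = (\<Sum>p\<in>P. skew_bulk (k' p) h' e1 e2)"
    unfolding skew_bulk_def set_lebesgue_integral_def scaleR_sum_right
    using skew_integrable(1)[OF k h]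
    by (intro Bochner_Integration.integral_sum) (auto simp: set_integrable_def)
  also have "\<dots> = (\<Sum>p\<in>P. skew_boundary (k p) h' e1 e2)"
    by (intro sum.cong refl loc k) (use P(2) supp in auto)
  also have "\<dots> = (\<integral>x. (\<Sum>p\<in>P. k p x \<bullet> ((\<nu> x \<bullet> e1) *\<^sub>R h' x e2 - (\<nu> x \<bullet> e2) *\<^sub>R h' x e1)) \<partial>\<sigma>)"
    unfolding skew_boundary_def using skew_integrable(2)[OF k h]
    by (intro Bochner_Integration.integral_sum[symmetric]) auto
  also have "\<dots> = skew_boundary f h' e1 e2"
    unfolding skew_boundary_def using sum frontier_sub
    by (intro Bochner_Integration.integral_cong) (auto simp: inner_sum_left)
  finally show ?thesis .
qed

text \<open>The bulk term is symmetric under exchanging \<open>f\<close> and \<open>h\<close> together with the directions.\<close>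
lemma skew_boundary_eq_0:
  assumes f: "C1_closure \<Omega> f f'" and h: "C1_closure \<Omega> h (h' :: _ \<Rightarrow> _ \<Rightarrow> 'b::euclidean_space)"
    and e: "norm e1 = 1" "norm e2 = 1" and z: "\<And>x. x \<in> frontier \<Omega> \<Longrightarrow> h x = 0"
  shows "skew_boundary f h' e1 e2 = 0"
proof -
  have "skew_boundary f h' e1 e2 = skew_bulk f' h' e1 e2" by (rule skew_identity[OF f h e, symmetric])
  also have "\<dots> = skew_bulk h' f' e2 e1"
    unfolding skew_bulk_def by (simp add: inner_commute)
  also have "\<dots> = skew_boundary h f' e2 e1" by (rule skew_identity[OF h f e(2,1)])
  also have "\<dots> = 0" unfolding skew_boundary_def using z by (intro integral_eq_zero_AE AE_I2) simp
  finally show ?thesis .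
qed

section \<open>Extension of the normal field\<close>

text \<open>N is given near the frontier only, whereas \<open>skew_identity\<close> wants functions
  on the whole closure. The cut-off adds the multiple \<open>c x v\<close> of N to the derivative;
  this term drops out later, since B(N)u = 0 on the frontier.\<close>

lemma extend_normal:
  fixes N :: "real^'n \<Rightarrow> real^'n" and DN :: "real^'n \<Rightarrow> (real^'n) \<Rightarrow>\<^sub>L (real^'n)"
  assumes V: "open V" "frontier \<Omega> \<subseteq> V"
    and N: "\<And>x. x \<in> V \<Longrightarrow> (N has_derivative blinfun_apply (DN x)) (at x)" and DN: "continuous_on V DN"
  obtains Nt Nt' c where "C1_closure \<Omega> Nt Nt'"
    "\<And>x. x \<in> frontier \<Omega> \<Longrightarrow> Nt x = N x"
    "\<And>x v. x \<in> frontier \<Omega> \<Longrightarrow> Nt' x v = DN x v + c x v *\<^sub>R N x"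
proof -
  \<comment> \<open>Pieces centred in V have room inside V to be multiplied by N; pieces centred
    elsewhere are supported in \<Omega>, so on the frontier the kept pieces still sum to 1.\<close>
  have "\<forall>p\<in>closure \<Omega>. \<exists>R. R > 0 \<and> (p \<in> V \<longrightarrow> ball p (2 * R) \<subseteq> V) \<and> (p \<notin> V \<longrightarrow> ball p R \<subseteq> \<Omega>)"
  proof
    fix p assume p: "p \<in> closure \<Omega>"
    show "\<exists>R. R > 0 \<and> (p \<in> V \<longrightarrow> ball p (2 * R) \<subseteq> V) \<and> (p \<notin> V \<longrightarrow> ball p R \<subseteq> \<Omega>)"
    proof (cases "p \<in> V")
      case True
      then obtain r where "r > 0" "ball p r \<subseteq> V" using V(1) open_contains_ball by blast
      then show ?thesis using True by (intro exI[of _ "r/2"]) auto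
    next
      case False
      then have "p \<in> \<Omega>" using p closure_cases V(2) by blast
      then show ?thesis using False op open_contains_ball by blast
    qed
  qed
  from bchoice[OF this] obtain R where R: "\<forall>p\<in>closure \<Omega>. R p > 0 \<and>
      (p \<in> V \<longrightarrow> ball p (2 * R p) \<subseteq> V) \<and> (p \<notin> V \<longrightarrow> ball p (R p) \<subseteq> \<Omega>)"
    by (elim exE)
  have one: "C1_closure \<Omega> (\<lambda>_. 1 :: real) (\<lambda>_ _. 0)" by (rule C1_closure_const)
  obtain P w \<theta> \<theta>' where P: "finite P" "P \<subseteq> closure \<Omega>"
    and \<theta>: "\<And>p. p \<in> P \<Longrightarrow> C1_closure \<Omega> (\<theta> p) (\<theta>' p)"
    and supp: "\<And>p x. p \<in> P \<Longrightarrow> x \<in> closure \<Omega> \<Longrightarrow> x \<notin> ball p (R p) \<Longrightarrow> \<theta> p x = 0 \<and> \<theta>' p x = (\<lambda>_. 0)"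
    and "\<And>p x. p \<in> P \<Longrightarrow> x \<in> closure \<Omega> \<Longrightarrow> \<theta> p x = w p x *\<^sub>R 1 \<and> w p x \<ge> (0::real)"
    and sum: "\<And>x. x \<in> closure \<Omega> \<Longrightarrow> (1::real) = (\<Sum>p\<in>P. \<theta> p x)"
    and sum': "\<And>x v. x \<in> \<Omega> \<Longrightarrow> 0 = (\<Sum>p\<in>P. \<theta>' p x v)"
  proof (rule C1_closure_localize[where R=R, OF op bd one])
    show "R p > 0" if "p \<in> closure \<Omega>" for p using R that by blast
  qed (rule that)
  define Nt where "Nt = (\<lambda>x. \<Sum>p\<in>P \<inter> V. \<theta> p x *\<^sub>R N x)"
  define Nt' where "Nt' = (\<lambda>x v. \<Sum>p\<in>P \<inter> V. \<theta> p x *\<^sub>R DN x v + \<theta>' p x v *\<^sub>R N x)"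
  define c where "c = (\<lambda>x v. \<Sum>p\<in>P \<inter> V. \<theta>' p x v)"
  have NcV: "continuous_on V N"
    using N has_derivative_continuous continuous_at_imp_continuous_on by blast
  have DNcV: "continuous_on V (\<lambda>x. DN x v)" for v
    by (intro continuous_intros DN)
  have "C1_closure \<Omega> (\<lambda>x. \<theta> p x *\<^sub>R N x) (\<lambda>x v. \<theta> p x *\<^sub>R DN x v + \<theta>' p x v *\<^sub>R N x)"
    if p: "p \<in> P \<inter> V" for p
  proof (rule bounded_bilinear.C1_closure_prod_local[OF bounded_bilinear_scaleR op \<theta>])
    have Rp: "R p > 0" "ball p (2 * R p) \<subseteq> V" using R P(2) p by auto
    show "p \<in> P" "open (ball p (2 * R p))" "closed (cball p (R p))" using p by auto
    show "cball p (R p) \<subseteq> ball p (2 * R p)" using Rp(1) by auto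
    show "\<theta> p x = 0 \<and> \<theta>' p x = (\<lambda>_. 0)" if "x \<in> closure \<Omega>" "x \<notin> cball p (R p)" for x
      using supp[of p x] p that by auto
    show "continuous_on (closure \<Omega> \<inter> ball p (2 * R p)) N"
      "continuous_on (closure \<Omega> \<inter> ball p (2 * R p)) (\<lambda>x. DN x v)" for v
      using Rp(2) by (auto intro: continuous_on_subset[OF NcV] continuous_on_subset[OF DNcV])
    show "linear (blinfun_apply (DN x))" for x
      by (simp add: blinfun.bounded_linear_right bounded_linear.linear)
    show "(N has_derivative blinfun_apply (DN x)) (at x)" if "x \<in> \<Omega> \<inter> ball p (2 * R p)" for x
      using N Rp(2) that by blast
  qed
  then have C1: "C1_closure \<Omega> Nt Nt'"
    unfolding Nt_def Nt'_def using P(1) by (intro C1_closure_sum) auto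
  have \<theta>1: "(\<Sum>p\<in>P \<inter> V. \<theta> p x) = 1" if x: "x \<in> frontier \<Omega>" for x
  proof -
    have xcl: "x \<in> closure \<Omega>" "x \<notin> \<Omega>" using x frontier_sub op by (auto simp: frontier_def interior_open)
    have "(\<Sum>p\<in>P. \<theta> p x) = (\<Sum>p\<in>P \<inter> V. \<theta> p x)"
    proof (rule sum.mono_neutral_right)
      show "\<forall>p\<in>P - P \<inter> V. \<theta> p x = 0"
      proof
        fix p assume p: "p \<in> P - P \<inter> V"
        then have "x \<notin> ball p (R p)" using R P(2) xcl(2) by blast
        then show "\<theta> p x = 0" using supp[of p x] p xcl(1) by blast
      qed
    qed (use P in auto)
    then show ?thesis using sum[OF xcl(1)] by simp
  qed
  show ?thesis
  proof (rule that[OF C1])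
    show "Nt x = N x" if "x \<in> frontier \<Omega>" for x
      using \<theta>1[OF that] by (simp add: Nt_def flip: scaleR_sum_left)
    show "Nt' x v = DN x v + c x v *\<^sub>R N x" if "x \<in> frontier \<Omega>" for x v
      using \<theta>1[OF that] by (simp add: Nt'_def c_def sum.distrib flip: scaleR_sum_left)
  qed
qed

end

section \<open>Pointwise algebra of the integrands\<close>

text \<open>To be read with \<open>b i\<close> = B_i u, \<open>b' j i\<close> = d_i (B_j u),
  \<open>M i j\<close> = d_i N_j and \<open>z i\<close> = d_i z, where z = B(N)u. The first double
  sum reduces to minus the sum of <b i, N_j b' j i>, the second to the sum of <b i, z i>; the
  product rule for z leaves the Levi term.\<close>

lemma levi_algebra:
  fixes N :: "real^'n" and b :: "'n \<Rightarrow> 'e::real_inner"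
  assumes N: "norm N = 1" and S: "(\<Sum>i\<in>UNIV. N $ i *\<^sub>R b i) = 0"
    and z: "\<And>i. z i = (\<Sum>j\<in>UNIV. N $ j *\<^sub>R b' j i + (M i j + c i * N $ j) *\<^sub>R b j)"
  shows "(\<Sum>i\<in>UNIV. \<Sum>j\<in>UNIV. b i \<bullet> (N $ i *\<^sub>R b' j j - N $ j *\<^sub>R b' j i))
       + (\<Sum>i\<in>UNIV. \<Sum>j\<in>UNIV. (N $ j *\<^sub>R b i) \<bullet> (N $ j *\<^sub>R z i - N $ i *\<^sub>R z j))
       = (\<Sum>i\<in>UNIV. b i \<bullet> (\<Sum>j\<in>UNIV. M i j *\<^sub>R b j))"
proof -
  have N1: "(\<Sum>j\<in>UNIV. N $ j * N $ j) = 1"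
    using N by (simp add: norm_eq_1 inner_vec_def)
  \<comment> \<open>The boundary condition as tangentiality of the family b: it kills every term in
    which \<open>N $ i\<close> is paired with \<open>b i\<close>.\<close>
  have Sw: "(\<Sum>i\<in>UNIV. N $ i * (b i \<bullet> w)) = 0" for w
    using arg_cong[OF S, of "\<lambda>x. x \<bullet> w"] by (simp add: inner_sum_left)
  have z': "z i = (\<Sum>j\<in>UNIV. N $ j *\<^sub>R b' j i) + (\<Sum>j\<in>UNIV. M i j *\<^sub>R b j)" for i
  proof -
    have "(\<Sum>j\<in>UNIV. (c i * N $ j) *\<^sub>R b j) = c i *\<^sub>R (\<Sum>j\<in>UNIV. N $ j *\<^sub>R b j)"
      by (simp add: scaleR_sum_right)
    then show ?thesis using S by (simp add: z sum.distrib scaleR_add_left)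
  qed
  have "(\<Sum>i\<in>UNIV. \<Sum>j\<in>UNIV. b i \<bullet> (N $ i *\<^sub>R b' j j - N $ j *\<^sub>R b' j i))
      = (\<Sum>i\<in>UNIV. \<Sum>j\<in>UNIV. N $ i * (b i \<bullet> b' j j)) - (\<Sum>i\<in>UNIV. \<Sum>j\<in>UNIV. N $ j * (b i \<bullet> b' j i))"
    by (simp add: inner_diff_right sum_subtractf)
  also have "(\<Sum>i\<in>UNIV. \<Sum>j\<in>UNIV. N $ i * (b i \<bullet> b' j j)) = 0"
    by (subst sum.swap) (simp add: Sw)
  finally have 1: "(\<Sum>i\<in>UNIV. \<Sum>j\<in>UNIV. b i \<bullet> (N $ i *\<^sub>R b' j j - N $ j *\<^sub>R b' j i))
      = - (\<Sum>i\<in>UNIV. b i \<bullet> (\<Sum>j\<in>UNIV. N $ j *\<^sub>R b' j i))"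
    by (simp add: inner_sum_right)
  have "(\<Sum>i\<in>UNIV. \<Sum>j\<in>UNIV. (N $ j *\<^sub>R b i) \<bullet> (N $ j *\<^sub>R z i - N $ i *\<^sub>R z j))
      = (\<Sum>i\<in>UNIV. \<Sum>j\<in>UNIV. (N $ j * N $ j) * (b i \<bullet> z i)) - (\<Sum>i\<in>UNIV. \<Sum>j\<in>UNIV. N $ j * (N $ i * (b i \<bullet> z j)))"
    by (simp add: inner_diff_right sum_subtractf right_diff_distrib mult_ac)
  also have "(\<Sum>i\<in>UNIV. \<Sum>j\<in>UNIV. N $ j * (N $ i * (b i \<bullet> z j))) = 0"
    by (subst sum.swap) (simp add: Sw flip: sum_distrib_left)
  also have "(\<Sum>i\<in>UNIV. \<Sum>j\<in>UNIV. (N $ j * N $ j) * (b i \<bullet> z i)) = (\<Sum>i\<in>UNIV. b i \<bullet> z i)"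
    by (simp add: N1 flip: sum_distrib_right)
  finally have 2: "(\<Sum>i\<in>UNIV. \<Sum>j\<in>UNIV. (N $ j *\<^sub>R b i) \<bullet> (N $ j *\<^sub>R z i - N $ i *\<^sub>R z j)) = (\<Sum>i\<in>UNIV. b i \<bullet> z i)"
    by simp
  show ?thesis unfolding 1 2 by (simp add: z' inner_add_right sum.distrib)
qed

lemma sum_Basis_axis: "(\<Sum>b\<in>Basis. F b) = (\<Sum>i\<in>UNIV. F (axis i 1 :: real^'n))"
proof -
  have 1: "(Basis :: (real^'n) set) = (\<lambda>i. axis i 1) ` UNIV" by (auto simp: Basis_vec_def)
  have 2: "inj (\<lambda>i::'n. axis i (1::real))" by (auto intro: injI simp: axis_eq_axis)
  show ?thesis unfolding 1 sum.reindex[OF 2] o_def ..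
qed

lemma sym_op_axis: "sym_op B (axis j 1) = B j"
proof
  fix w
  have "(\<Sum>i\<in>UNIV. (axis j 1 $ i) *\<^sub>R B i w) = (\<Sum>i\<in>UNIV. if i = j then B j w else 0)"
    by (intro sum.cong) (auto simp: axis_def)
  then show "sym_op B (axis j 1) w = B j w" by (simp add: sym_op_def)
qed

text \<open>The A terms cancel altogether. In M the B factors carry their indices in the opposite
  order, so the subtracted B terms have the two derivatives exchanged and an antisymmetric
  expression remains.\<close>

lemma integrand_null_lagrangian:
  fixes A :: "'n::finite \<Rightarrow> 'f::euclidean_space \<Rightarrow> 'g::euclidean_space"
    and B :: "'n \<Rightarrow> 'f \<Rightarrow> 'e::euclidean_space" and D :: "real^'n \<Rightarrow> 'f"
  assumes linA: "\<And>j. linear (A j)" and linB: "\<And>j. linear (B j)" and D: "linear D"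
  shows "(norm (diff_op A D))\<^sup>2 + (norm (diff_op B D))\<^sup>2 - hs_inner D (Mop A B D)
    = (\<Sum>i\<in>UNIV. \<Sum>j\<in>UNIV. B i (D (axis i 1)) \<bullet> B j (D (axis j 1)) - B i (D (axis j 1)) \<bullet> B j (D (axis i 1)))"
proof -
  have sq: "(norm (diff_op L D))\<^sup>2 = (\<Sum>i\<in>UNIV. \<Sum>j\<in>UNIV. L i (D (axis i 1)) \<bullet> L j (D (axis j 1)))"
    for L :: "'n \<Rightarrow> 'f \<Rightarrow> 'h::euclidean_space"
    by (simp add: diff_op_def power2_norm_eq_inner inner_sum_left inner_sum_right) (rule sum.swap)
  have Mop: "Mop A B D (axis i 1) = (\<Sum>j\<in>UNIV. Mcoef A B i j (D (axis j 1)))" for i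
  proof -
    have "Mop A B D (axis i 1) = (\<Sum>k\<in>UNIV. if k = i then (\<Sum>j\<in>UNIV. Mcoef A B i j (D (axis j 1))) else 0)"
      unfolding Mop_def by (intro sum.cong) (auto simp: axis_def)
    then show ?thesis by simp
  qed
  have "hs_inner D (Mop A B D) = (\<Sum>i\<in>UNIV. D (axis i 1) \<bullet> Mop A B D (axis i 1))"
    by (simp add: hs_inner_def op_trace_def sum_Basis_axis adjoint_works[OF D])
  also have "\<dots> = (\<Sum>i\<in>UNIV. \<Sum>j\<in>UNIV. A i (D (axis i 1)) \<bullet> A j (D (axis j 1)) + B i (D (axis j 1)) \<bullet> B j (D (axis i 1)))"
    by (simp add: Mop Mcoef_def inner_sum_right inner_add_right adjoint_works[OF linA] adjoint_works[OF linB] inner_commute)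
  finally show ?thesis by (simp add: sq sum.distrib sum_subtractf)
qed

lemma levi_op_inner:
  fixes B :: "'n::finite \<Rightarrow> 'f::euclidean_space \<Rightarrow> 'e::euclidean_space"
  assumes linB: "\<And>j. linear (B j)"
  shows "u \<bullet> levi_op B DN u = (\<Sum>i\<in>UNIV. B i u \<bullet> (\<Sum>j\<in>UNIV. (DN (axis i 1) $ j) *\<^sub>R B j u))"
  by (simp add: levi_op_def inner_sum_right adjoint_works[OF linB] sym_op_axis)
     (simp add: sym_op_def inner_sum_right)

section \<open>From C2 domains to the cone condition\<close>

text \<open>Near p the derivative of \<rho> differs from <g, _> by less than \<epsilon>|g|. By the
  mean value theorem \<rho> strictly decreases along every step from x to y that is steeper than the
  cone, starting from \<rho> x \<le> 0.\<close>

lemma outward_unit_normal_cone: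
  assumes op: "open \<Omega>" and \<nu>: "outward_unit_normal \<Omega> p \<nu>" and \<epsilon>: "\<epsilon> > 0"
  shows "norm \<nu> = 1" "\<exists>r>0. cone_at \<Omega> p r \<nu> \<epsilon>"
proof -
  obtain r0 \<rho> g where loc: "local_defining_function \<Omega> p r0 \<rho>"
    and g: "(\<rho> has_derivative (\<lambda>h. g \<bullet> h)) (at p)" and \<nu>_eq: "\<nu> = g /\<^sub>R norm g"
    using \<nu> unfolding outward_unit_normal_def by blast
  have r0: "r0 > 0" and ne: "frechet_derivative \<rho> (at p) \<noteq> (\<lambda>h. 0)"
    and \<Omega>_eq: "\<Omega> \<inter> ball p r0 = {y \<in> ball p r0. \<rho> y < 0}" and C2: "C2_on (ball p r0) \<rho>"
    using loc unfolding local_defining_function_def by auto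
  have "frechet_derivative \<rho> (at p) = (\<lambda>h. g \<bullet> h)" using frechet_derivative_at[OF g] by simp
  then have g0: "g \<noteq> 0" using ne by auto
  then show "norm \<nu> = 1" by (simp add: \<nu>_eq)
  obtain D1 D2 where D1: "\<And>x. x \<in> ball p r0 \<Longrightarrow> (\<rho> has_derivative blinfun_apply (D1 x)) (at x)"
    and D2: "\<And>x. x \<in> ball p r0 \<Longrightarrow> (D1 has_derivative blinfun_apply (D2 x)) (at x)"
    using C2 unfolding C2_on_def by blast
  have pb: "p \<in> ball p r0" using r0 by simp
  have D1p: "blinfun_apply (D1 p) = (\<lambda>h. g \<bullet> h)" by (rule has_derivative_unique[OF D1[OF pb] g])
  have "isCont D1 p" using has_derivative_continuous[OF D2[OF pb]] .
  then obtain r1 where r1: "r1 > 0" "\<And>x. dist x p < r1 \<Longrightarrow> dist (D1 x) (D1 p) < \<epsilon> * norm g"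
    using \<epsilon> g0 unfolding continuous_at_eps_delta by (metis mult_pos_pos zero_less_norm_iff)
  define r where "r = min r0 r1"
  have "cone_at \<Omega> p r \<nu> \<epsilon>"
    unfolding cone_at_def
  proof (intro ballI impI)
    fix x y assume x: "x \<in> closure \<Omega> \<inter> ball p r" and y: "y \<in> ball p r"
      and xy: "\<epsilon> * norm (x - y) < (x - y) \<bullet> \<nu>"
    have ball: "z \<in> ball p r0" "dist z p < r1" if "z \<in> ball p r" for z
      using that by (auto simp: r_def dist_commute)
    \<comment> \<open>The set where \<rho> is positive is open and misses \<Omega>, hence misses its
      closure.\<close>
    have "\<rho> x \<le> 0"
    proof (rule ccontr)
      assume "\<not> \<rho> x \<le> 0"
      define W where "W = {z \<in> ball p r0. \<rho> z \<in> {0<..}}"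
      have "continuous_on (ball p r0) \<rho>"
        using D1 has_derivative_continuous continuous_at_imp_continuous_on by blast
      then have "open W" unfolding W_def
        using continuous_open_preimage[of "ball p r0" \<rho> "{0<..}"] by (simp add: vimage_def Int_def)
      moreover have "\<rho> z < 0" if "z \<in> \<Omega>" "z \<in> ball p r0" for z using \<Omega>_eq that by blast
      then have "W \<inter> \<Omega> = {}" by (force simp: W_def)
      ultimately have "W \<inter> closure \<Omega> = {}" by (simp add: open_Int_closure_eq_empty)
      then show False using x ball(1)[of x] \<open>\<not> \<rho> x \<le> 0\<close> by (auto simp: W_def)
    qed
    define c where "c = (\<lambda>t::real. y + t *\<^sub>R (x - y))"
    have c_ball: "c t \<in> ball p r" if "0 \<le> t" "t \<le> 1" for t
    proof -
      have "c t = (1 - t) *\<^sub>R y + t *\<^sub>R x" by (simp add: c_def algebra_simps)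
      then show ?thesis using convexD[OF convex_ball, of y p r x "1 - t" t] x y that by simp
    qed
    have "((\<lambda>t. \<rho> (c t)) has_real_derivative D1 (c t) (x - y)) (at t)" if "0 \<le> t" "t \<le> 1" for t
    proof -
      have "(c has_derivative (\<lambda>h. h *\<^sub>R (x - y))) (at t)"
        unfolding c_def by (auto intro!: derivative_eq_intros)
      from has_derivative_compose[OF this D1[OF ball(1)[OF c_ball[OF that]]]]
      show ?thesis by (simp add: has_field_derivative_def blinfun.scaleR_right mult_commute_abs)
    qed
    then obtain t where t: "0 < t" "t < 1" "\<rho> (c 1) - \<rho> (c 0) = (1 - 0) * D1 (c t) (x - y)"
      using MVT2[of 0 1 "\<lambda>t. \<rho> (c t)" "\<lambda>t. D1 (c t) (x - y)"] by auto
    have "\<bar>(D1 (c t) - D1 p) (x - y)\<bar> \<le> norm (D1 (c t) - D1 p) * norm (x - y)"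
      using norm_blinfun[of "D1 (c t) - D1 p" "x - y"] by simp
    also have "\<dots> \<le> (\<epsilon> * norm g) * norm (x - y)"
      using r1(2)[OF ball(2)[OF c_ball[of t]]] t by (intro mult_right_mono) (auto simp: dist_norm)
    also have "\<dots> = norm g * (\<epsilon> * norm (x - y))" by simp
    also have "\<dots> < norm g * ((x - y) \<bullet> \<nu>)" using xy g0 by (intro mult_strict_left_mono) auto
    also have "\<dots> = D1 p (x - y)" using g0 by (simp add: D1p \<nu>_eq inner_commute)
    finally have "0 < D1 (c t) (x - y)" by (simp add: blinfun.diff_left)
    then have "\<rho> y < 0" using t(3) \<open>\<rho> x \<le> 0\<close> by (simp add: c_def)
    then show "y \<in> \<Omega>" using \<Omega>_eq ball(1)[OF y] by blast
  qed
  moreover have "r > 0" using r0 r1 by (simp add: r_def)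
  ultimately show "\<exists>r>0. cone_at \<Omega> p r \<nu> \<epsilon>" by blast
qed

theorem theorem2:
  fixes \<Omega> :: "(real^'n) set"
    and A :: "'n \<Rightarrow> 'f::euclidean_space \<Rightarrow> 'g::euclidean_space"
    and B :: "'n \<Rightarrow> 'f \<Rightarrow> 'e::euclidean_space"
    and u :: "real^'n \<Rightarrow> 'f" and Du :: "real^'n \<Rightarrow> ((real^'n) \<Rightarrow>\<^sub>L 'f)"
    and N :: "real^'n \<Rightarrow> real^'n" and DN :: "real^'n \<Rightarrow> ((real^'n) \<Rightarrow>\<^sub>L (real^'n))"
    and V :: "(real^'n) set"
  assumes dom: "C2_domain \<Omega>" "bounded \<Omega>"
    and linA: "\<And>j. linear (A j)" and linB: "\<And>j. linear (B j)"
    and u_cont: "continuous_on (closure \<Omega>) u"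
    and Du_cont: "continuous_on (closure \<Omega>) Du"
    and u_deriv: "\<And>x. x \<in> \<Omega> \<Longrightarrow> (u has_derivative blinfun_apply (Du x)) (at x)"
    and V: "open V" "frontier \<Omega> \<subseteq> V"
    and N_deriv: "\<And>x. x \<in> V \<Longrightarrow> (N has_derivative blinfun_apply (DN x)) (at x)"
    and DN_cont: "continuous_on V DN"
    and N_normal: "\<And>x. x \<in> frontier \<Omega> \<Longrightarrow> outward_unit_normal \<Omega> x (N x)"
    and bc: "\<And>x. x \<in> frontier \<Omega> \<Longrightarrow> sym_op B (N x) (u x) = 0"
  shows "integral \<Omega> (\<lambda>x. (norm (diff_op A (Du x)))\<^sup>2 + (norm (diff_op B (Du x)))\<^sup>2
                          - hs_inner (Du x) (Mop A B (Du x)))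
         = (\<integral>x. u x \<bullet> levi_op B (DN x) (u x) \<partial>surface_measure (frontier \<Omega>))"
proof -
  have op: "open \<Omega>" using dom(1) by (simp add: C2_domain_def)
  note norm_N = outward_unit_normal_cone(1)[OF op N_normal zero_less_one]
  note cone = outward_unit_normal_cone(2)[OF op N_normal]
  have D: "linear (blinfun_apply (Du x))" for x
    by (simp add: blinfun.bounded_linear_right bounded_linear.linear)
  note integrand = integrand_null_lagrangian[where A=A and B=B, OF linA linB D]
  note levi = levi_op_inner[where B=B, OF linB]
  have bc': "(\<Sum>i\<in>UNIV. N x $ i *\<^sub>R B i (u x)) = 0" if "x \<in> frontier \<Omega>" for x
    using bc[OF that] by (simp add: sym_op_def)
  show ?thesis
  proof (cases "CARD('n) = 1")
    case True
    \<comment> \<open>In dimension one the only pair of indices is (k, k), so the bulk integrand is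
      zero, and the boundary condition forces B_k u = 0 on the frontier.\<close>
    then obtain k :: 'n where k: "(UNIV :: 'n set) = {k}" by (auto simp: card_1_singleton_iff)
    have "B k (u x) = 0" if x: "x \<in> frontier \<Omega>" for x
    proof -
      have "N x \<noteq> 0" using norm_N[OF x] by auto
      then have "N x $ k \<noteq> 0" using k by (metis (full_types) UNIV_I singletonD vec_eq_iff zero_index)
      then show ?thesis using bc'[OF x] by (simp add: k)
    qed
    then have "(\<integral>x. u x \<bullet> levi_op B (DN x) (u x) \<partial>surface_measure (frontier \<Omega>)) = 0"
      by (intro integral_eq_zero_AE AE_I2) (simp add: levi k surface_measure_def space_restrict_space)
    then show ?thesis by (simp add: integrand k)
  next
    case False
    have N_cont: "continuous_on (frontier \<Omega>) N"
      using N_deriv has_derivative_continuous V(2)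
      by (intro continuous_at_imp_continuous_on) blast
    interpret cone_domain \<Omega> N
      using op dom(2) False norm_N cone N_cont by unfold_locales auto
    define b where "b = (\<lambda>i x. B i (u x))"
    define b' where "b' = (\<lambda>i x v. B i (Du x v))"
    have u: "C1_closure \<Omega> u (\<lambda>x. blinfun_apply (Du x))"
      unfolding C1_closure_def
      by (intro conjI allI ballI u_cont u_deriv D blinfun.continuous_on[OF Du_cont] continuous_on_const)
    have b: "C1_closure \<Omega> (b i) (b' i)" for i
      unfolding b_def b'_def 
      by (rule C1_closure_linear[OF _ u]) (use linB linear_conv_bounded_linear in blast)
    obtain Nt Nt' c where Nt: "C1_closure \<Omega> Nt Nt'"
      and Nt_N: "\<And>x. x \<in> frontier \<Omega> \<Longrightarrow> Nt x = N x"
      and Nt'_N: "\<And>x v. x \<in> frontier \<Omega> \<Longrightarrow> Nt' x v = DN x v + c x v *\<^sub>R N x"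
      using extend_normal[OF V N_deriv DN_cont] by blast
    have Ntj: "C1_closure \<Omega> (\<lambda>x. Nt x $ j) (\<lambda>x v. Nt' x v $ j)" for j
      by (rule C1_closure_linear[OF bounded_linear_vec_nth Nt])
    \<comment> \<open>The function B(N)u, with the extended normal: C1 up to the boundary and zero
      on the frontier.\<close>
    define z where "z = (\<lambda>x. \<Sum>j\<in>UNIV. Nt x $ j *\<^sub>R b j x)"
    define z' where "z' = (\<lambda>x v. \<Sum>j\<in>UNIV. Nt x $ j *\<^sub>R b' j x v + Nt' x v $ j *\<^sub>R b j x)"
    have z: "C1_closure \<Omega> z z'"
      unfolding z_def z'_def by (intro C1_closure_sum C1_closure_scaleR Ntj b) simp
    have z0: "z x = 0" if "x \<in> frontier \<Omega>" for x
      using bc'[OF that] Nt_N[OF that] by (simp add: z_def b_def)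
    \<comment> \<open>With these factors the vanishing boundary terms for z involve its tangential
      derivatives N_j d_i z - N_i d_j z, weighted with N_j B_i u.\<close>
    define f where "f = (\<lambda>i j x. Nt x $ j *\<^sub>R b i x)"
    have f: "\<exists>f'. C1_closure \<Omega> (f i j) f'" for i j
      unfolding f_def using C1_closure_scaleR[OF Ntj b] by blast
    let ?e = "\<lambda>i. axis i 1 :: real^'n"
    have e: "norm (?e i) = 1" for i by simp
    have inner_e: "N x \<bullet> ?e i = N x $ i" for x i by (simp add: inner_axis)
    let ?F = "\<lambda>x. (norm (diff_op A (Du x)))\<^sup>2 + (norm (diff_op B (Du x)))\<^sup>2 - hs_inner (Du x) (Mop A B (Du x))"
    have F: "?F x = (\<Sum>i\<in>UNIV. \<Sum>j\<in>UNIV. b' i x (?e i) \<bullet> b' j x (?e j) - b' i x (?e j) \<bullet> b' j x (?e i))" for x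
      by (simp add: integrand b'_def)
    have F_int: "set_integrable lborel \<Omega> ?F"
      unfolding F set_integrable_def scaleR_sum_right
      using skew_integrable(1)[OF b b] by (intro Bochner_Integration.integrable_sum) (simp add: set_integrable_def)
    have "integral \<Omega> ?F = (LINT x:\<Omega>|lborel. ?F x)"
      by (rule set_borel_integral_eq_integral(2)[OF F_int, symmetric])
    also have "\<dots> = (\<Sum>i\<in>UNIV. \<Sum>j\<in>UNIV. skew_bulk (b' i) (b' j) (?e i) (?e j))"
    proof -
      have i: "integrable lborel (\<lambda>x. indicator \<Omega> x *\<^sub>R (b' i x (?e i) \<bullet> b' j x (?e j) - b' i x (?e j) \<bullet> b' j x (?e i)))" for i j
        using skew_integrable(1)[OF b b] by (simp add: set_integrable_def)
      show ?thesis
        unfolding F skew_bulk_def set_lebesgue_integral_def scaleR_sum_right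
        by (simp only: Bochner_Integration.integral_sum Bochner_Integration.integrable_sum i)
    qed
    also have "\<dots> = (\<Sum>i\<in>UNIV. \<Sum>j\<in>UNIV. skew_boundary (b i) (b' j) (?e i) (?e j))"
      by (intro sum.cong refl skew_identity[OF b b e e])
    \<comment> \<open>A sum of zeros is added: it converts the terms N_j B_j d_i u into derivatives
      of N, so that the integrands agree pointwise in the last step.\<close>
    also have "\<dots> = (\<Sum>i\<in>UNIV. \<Sum>j\<in>UNIV. skew_boundary (b i) (b' j) (?e i) (?e j))
        + (\<Sum>i\<in>UNIV. \<Sum>j\<in>UNIV. skew_boundary (f i j) z' (?e j) (?e i))"
    proof -
      have "skew_boundary (f i j) z' (?e j) (?e i) = 0" for i j
        using f[of i j] skew_boundary_eq_0[OF _ z e e z0] by blast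
      then show ?thesis by simp
    qed
    also have "\<dots> = (\<integral>x. (\<Sum>i\<in>UNIV. \<Sum>j\<in>UNIV. b i x \<bullet> ((N x \<bullet> ?e i) *\<^sub>R b' j x (?e j) - (N x \<bullet> ?e j) *\<^sub>R b' j x (?e i)))
        + (\<Sum>i\<in>UNIV. \<Sum>j\<in>UNIV. f i j x \<bullet> ((N x \<bullet> ?e j) *\<^sub>R z' x (?e i) - (N x \<bullet> ?e i) *\<^sub>R z' x (?e j))) \<partial>\<sigma>)"
    proof -
      have i1: "integrable \<sigma> (\<lambda>x. b i x \<bullet> ((N x \<bullet> ?e i) *\<^sub>R b' j x (?e j) - (N x \<bullet> ?e j) *\<^sub>R b' j x (?e i)))" for i j
        by (rule skew_integrable(2)[OF b b])
      have i2: "integrable \<sigma> (\<lambda>x. f i j x \<bullet> ((N x \<bullet> ?e j) *\<^sub>R z' x (?e i) - (N x \<bullet> ?e i) *\<^sub>R z' x (?e j)))" for i j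
        using f[of i j] skew_integrable(2)[OF _ z] by blast
      show ?thesis unfolding skew_boundary_def
        by (simp only: Bochner_Integration.integral_add Bochner_Integration.integral_sum
            Bochner_Integration.integrable_sum i1 i2)
    qed
    also have "\<dots> = (\<integral>x. u x \<bullet> levi_op B (DN x) (u x) \<partial>\<sigma>)"
    proof (rule Bochner_Integration.integral_cong[OF refl])
      fix x assume "x \<in> space \<sigma>"
      then have x: "x \<in> frontier \<Omega>" by simp
      have "(\<Sum>i\<in>UNIV. \<Sum>j\<in>UNIV. b i x \<bullet> (N x $ i *\<^sub>R b' j x (?e j) - N x $ j *\<^sub>R b' j x (?e i)))
          + (\<Sum>i\<in>UNIV. \<Sum>j\<in>UNIV. (N x $ j *\<^sub>R b i x) \<bullet> (N x $ j *\<^sub>R z' x (?e i) - N x $ i *\<^sub>R z' x (?e j)))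
          = (\<Sum>i\<in>UNIV. b i x \<bullet> (\<Sum>j\<in>UNIV. (DN x (?e i) $ j) *\<^sub>R b j x))"
      proof (rule levi_algebra)
        show "norm (N x) = 1" by (rule norm_N[OF x])
        show "(\<Sum>i\<in>UNIV. N x $ i *\<^sub>R b i x) = 0" unfolding b_def by (rule bc'[OF x])
        show "z' x (?e i) = (\<Sum>j\<in>UNIV. N x $ j *\<^sub>R b' j x (?e i) + ((DN x (?e i) $ j) + c x (?e i) * N x $ j) *\<^sub>R b j x)" for i
          unfolding z'_def by (simp add: Nt_N[OF x] Nt'_N[OF x])
      qed
      then show "(\<Sum>i\<in>UNIV. \<Sum>j\<in>UNIV. b i x \<bullet> ((N x \<bullet> ?e i) *\<^sub>R b' j x (?e j) - (N x \<bullet> ?e j) *\<^sub>R b' j x (?e i)))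
        + (\<Sum>i\<in>UNIV. \<Sum>j\<in>UNIV. f i j x \<bullet> ((N x \<bullet> ?e j) *\<^sub>R z' x (?e i) - (N x \<bullet> ?e i) *\<^sub>R z' x (?e j)))
        = u x \<bullet> levi_op B (DN x) (u x)"
        unfolding inner_e levi f_def b_def Nt_N[OF x] .
    qed
    finally show ?thesis .
  qed
qed

end
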